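(* Let $\mathrm U_q(\mathfrak l)$ be a reductive quantum sub-superalgebra of $\mathrm U_q(\mathfrak g)$, $\mathfrak g=\mathfrak{gl}_{m|n}$. Then the functor $\mathcal S$ coincides with the induction functor $\mathrm I_{\mathfrak l,\mathfrak l}^{\mathfrak g,\mathfrak g}$ on $\mathcal C(\mathfrak l,\mathfrak l)$ (on objects and on morphisms, where $\Xi\otimes\mathcal A(\mathfrak g)$ is identified with a subspace of the space of linear maps $\mathrm U_q(\mathfrak g)\to\Xi$ by $\langle\xi\otimes f,x\rangle=\langle f,x\rangle\xi$).
   Context: **Algebra.** Let $m,n$ be positive integers, $\mathbf I=\{1,\dots,m+n\}$, $\mathbf I'=\{1,\dots,m+n-1\}$, $\mathfrak g=\mathfrak{gl}_{m|n}$ (complex), $\mathfrak h$ the diagonal Cartan subalgebra, $\{\epsilon_a\}$ the basis of $\mathfrak h^*$ dual to the diagonal matrix units, with $(\epsilon_a,\epsilon_b)=\delta_{ab}$ for $a\le m$ and $-\delta_{ab}$ for $a>m$; $\mathfrak h^*_{\mathbb Z}=\bigoplus_a\mathbb Z\epsilon_a$. Let $q$ be an indeterminate, $q_a=q$ for $a\le m$, $q_a=q^{-1}$ for $a>m$. $[x]\in\mathbb Z_2$ denotes parity. $\mathrm U_q(\mathfrak g)$ is the unital associative superalgebra over $\mathbb C(q)$ generated by $E_{a,a+1},E_{a+1,a}$ ($a\in\mathbf I'$), $K_b^{\pm1}$ ($b\in\mathbf I$), with $E_{m,m+1},E_{m+1,m}$ odd and the other generators even, and relations (whenever indices make sense):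 $K_aK_a^{-1}=1$, the $K_a^{\pm1}$ commute; $K_aE_{b,b\pm1}K_a^{-1}=q^{(\epsilon_a,\epsilon_b-\epsilon_{b\pm1})}E_{b,b\pm1}$; $E_{a,a+1}E_{b+1,b}-(-1)^{\delta_{am}\delta_{bm}}E_{b+1,b}E_{a,a+1}=\delta_{ab}\frac{K_aK_{a+1}^{-1}-K_a^{-1}K_{a+1}}{q_a-q_a^{-1}}$; $E_{m,m+1}^2=E_{m+1,m}^2=0$; $E_{a,a+1}E_{b,b+1}=E_{b,b+1}E_{a,a+1}$ and $E_{a+1,a}E_{b+1,b}=E_{b+1,b}E_{a+1,a}$ for $|a-b|\ge2$; for $a\ne m$, $x^2y-(q+q^{-1})xyx+yx^2=0$ for $(x,y)=(E_{a,a+1},E_{a\pm1,a+1\pm1})$ and $(E_{a+1,a},E_{a+1\pm1,a\pm1})$; $E_{m-1,m+2}E_{m,m+1}+E_{m,m+1}E_{m-1,m+2}=0=E_{m+2,m-1}E_{m+1,m}+E_{m+1,m}E_{m+2,m-1}$, where for $a<c<b$ $E_{ab}=E_{ac}E_{cb}-q_c^{-1}E_{cb}E_{ac}$, $E_{ba}=E_{bc}E_{ca}-q_cE_{ca}E_{bc}$ (independent of $c$). It is a Hopf superalgebra with $\Delta(E_{a,a+1})=E_{a,a+1}\otimes K_aK_{a+1}^{-1}+1\otimes E_{a,a+1}$, $\Delta(E_{a+1,a})=E_{a+1,a}\otimes1+K_a^{-1}K_{a+1}\otimes E_{a+1,a}$, $\Delta(K_a^{\pm1})=K_a^{\pm1}\otimes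 K_a^{\pm1}$ and the corresponding counit $\epsilon$ and antipode $S$. **Sub-superalgebras.** A reductive quantum sub-superalgebra $\mathrm U_q(\mathfrak l)$ is one generated by all $K_b^{\pm1}$ and the $E_{a,a+1},E_{a+1,a}$ with $a\in\Theta$, for some $\Theta\subseteq\mathbf I'$. **Modules and functors.** All modules are $\mathbb Z_2$-graded. $\mathrm{Hom}_{\mathrm U}(V,W)$ is the $\mathbb Z_2$-graded space of linear maps with $\phi(xv)=(-1)^{[x][\phi]}x\phi(v)$. An integral weight vector of weight $\mu\in\mathfrak h^*_{\mathbb Z}$ is $v$ with $K_av=q^{(\mu,\epsilon_a)}v$ for all $a$. For reductive $\mathrm U_q(\mathfrak k)$, $\mathcal C(\mathfrak k,\mathfrak k)$ is the category, with even morphisms, of $\mathrm U_q(\mathfrak k)$-modules spanned by integral weight vectors $v$ with $\dim\mathrm U_q(\mathfrak k)v<\infty$ (such modules are called $\mathrm U_q(\mathfrak k)$-finite). The induction functor $\mathrm I_{\mathfrak l,\mathfrak l}^{\mathfrak g,\mathfrak g}:\mathcal C(\mathfrak l,\mathfrak l)\to\mathcal C(\mathfrak g,\mathfrak g)$ sends $V$ to the sum of all $\mathrm U_q(\mathfrak g)$-finite graded $\mathrm U_q(\mathfrak g)$-submodules of $\mathrm{Hom}_{\mathrm U_q(\mathfrak l)}(\mathrm U_q(\mathfrak g),V)$, where $\langle y\zeta,x\rangle=(-1)^{[y]([x]+[\zeta])}\langle\zeta,xy\rangle$, and acts on morphisms by post-composition. **The functor $\mathcal S$.** $\mathcal A(\mathfrak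 g)\subset\mathrm U_q(\mathfrak g)^*$ is the span of the matrix elements of all finite dimensional objects of $\mathcal C(\mathfrak g,\mathfrak g)$. It carries the commuting (in the super sense) left $\mathrm U_q(\mathfrak g)$-actions $\langle dL_x(f),y\rangle=(-1)^{[x][f]}\langle f,S(x)y\rangle$, $\langle dR_x(f),y\rangle=(-1)^{[x]}\langle f,yx\rangle$. For an object $\Xi$ of $\mathcal C(\mathfrak l,\mathfrak l)$, $\mathcal S(\Xi)=\{\zeta\in\Xi\otimes\mathcal A(\mathfrak g)\mid(\mathrm{id}\otimes dL_x)\zeta=(S(x)\otimes\mathrm{id})\zeta\ \forall x\in\mathrm U_q(\mathfrak l)\}$, a $\mathrm U_q(\mathfrak g)$-module via $x\mapsto\mathrm{id}\otimes dR_x$ (with $(\mathrm{id}\otimes T)(\xi\otimes f)=(-1)^{[T][\xi]}\xi\otimes T(f)$); on morphisms $\mathcal S(\phi)=\phi\otimes\mathrm{id}$. *)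

theory Defs
  imports
    Complex_Main
    "HOL-Library.Poly_Mapping"
    "HOL-Library.Z2"
    "HOL-Library.Function_Algebras"
    "HOL-Library.Cardinality"
    "HOL-Computational_Algebra.Polynomial"
    "HOL-Computational_Algebra.Fraction_Field"
begin

section \<open>The ground field and its vector spaces\<close>

text \<open>A type copy of \<^typ>\<open>complex poly fract\<close>: vector spaces over \<open>\<complex>(q)\<close> are organised in a
  type class below, and \<open>fract\<close> could be made an instance of it only for all coefficient
  domains at once.\<close>

typedef Cq = "UNIV :: complex poly fract set" ..

setup_lifting type_definition_Cq

instantiation Cq :: field
begin
lift_definition zero_Cq :: Cq is 0 .
lift_definition one_Cq :: Cq is 1 .
lift_definition plus_Cq :: "Cq \<Rightarrow> Cq \<Rightarrow> Cq" is "(+)" .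
lift_definition minus_Cq :: "Cq \<Rightarrow> Cq \<Rightarrow> Cq" is "(-)" .
lift_definition uminus_Cq :: "Cq \<Rightarrow> Cq" is uminus .
lift_definition times_Cq :: "Cq \<Rightarrow> Cq \<Rightarrow> Cq" is "(*)" .
lift_definition inverse_Cq :: "Cq \<Rightarrow> Cq" is inverse .
lift_definition divide_Cq :: "Cq \<Rightarrow> Cq \<Rightarrow> Cq" is "(/)" .
instance
  by standard (transfer; simp add: algebra_simps divide_inverse)+
end

lift_definition qq :: Cq is "Fract [:0, 1:] 1" .

class qvec = ab_group_add +
  fixes scaleQ :: "Cq \<Rightarrow> 'a \<Rightarrow> 'a"  (infixr "*\<^sub>q" 75)
  assumes scaleQ_add_right: "c *\<^sub>q (x + y) = c *\<^sub>q x + c *\<^sub>q y"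
    and scaleQ_add_left: "(c + d) *\<^sub>q x = c *\<^sub>q x + d *\<^sub>q x"
    and scaleQ_scaleQ: "c *\<^sub>q d *\<^sub>q x = (c * d) *\<^sub>q x"
    and scaleQ_one: "1 *\<^sub>q x = x"

interpretation qvec: vector_space "scaleQ :: Cq \<Rightarrow> 'a \<Rightarrow> 'a::qvec"
  by standard (simp_all add: scaleQ_add_right scaleQ_add_left scaleQ_scaleQ scaleQ_one)

abbreviation qlinear :: "('a::qvec \<Rightarrow> 'b::qvec) \<Rightarrow> bool" where
  "qlinear \<equiv> Vector_Spaces.linear scaleQ scaleQ"

definition qlinear_on :: "'a::qvec set \<Rightarrow> ('a \<Rightarrow> 'b::qvec) \<Rightarrow> bool" where
  "qlinear_on V f \<longleftrightarrow>
     (\<forall>u\<in>V. \<forall>v\<in>V. f (u + v) = f u + f v) \<and> (\<forall>c. \<forall>v\<in>V. f (c *\<^sub>q v) = c *\<^sub>q f v)"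

definition finite_dim :: "'a::qvec set \<Rightarrow> bool" where
  "finite_dim V \<longleftrightarrow> (\<exists>B. finite B \<and> V \<subseteq> qvec.span B)"

instantiation Cq :: qvec
begin
definition "c *\<^sub>q (x::Cq) = c * x"
instance by standard (simp_all add: scaleQ_Cq_def algebra_simps)
end

instantiation "fun" :: (type, qvec) qvec
begin
definition "c *\<^sub>q (f::'a \<Rightarrow> 'b) = (\<lambda>x. c *\<^sub>q f x)"
instance
  by standard (simp_all add: scaleQ_fun_def fun_eq_iff scaleQ_add_right scaleQ_add_left
      scaleQ_scaleQ scaleQ_one)
end

instantiation poly_mapping :: (type, qvec) qvec
begin
lift_definition scaleQ_poly_mapping :: "Cq \<Rightarrow> ('a \<Rightarrow>\<^sub>0 'b) \<Rightarrow> ('a \<Rightarrow>\<^sub>0 'b)"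
  is "\<lambda>c f x. c *\<^sub>q f x"
  by (erule rev_finite_subset) auto
instance
  by standard (transfer; simp add: fun_eq_iff scaleQ_add_right scaleQ_add_left
      scaleQ_scaleQ scaleQ_one)+
end


section \<open>Tensor products\<close>

definition tensor_null :: "('v::qvec \<times> 'w::qvec \<Rightarrow>\<^sub>0 Cq) set" where
  "tensor_null = qvec.span
     ({Poly_Mapping.single (u + v, w) 1 - Poly_Mapping.single (u, w) 1
         - Poly_Mapping.single (v, w) 1 | u v w. True}
    \<union> {Poly_Mapping.single (v, w + z) 1 - Poly_Mapping.single (v, w) 1
         - Poly_Mapping.single (v, z) 1 | v w z. True}
    \<union> {Poly_Mapping.single (c *\<^sub>q v, w) 1 - Poly_Mapping.single (v, w) c | c v w. True}
    \<union> {Poly_Mapping.single (v, c *\<^sub>q w) 1 - Poly_Mapping.single (v, w) c | c v w. True})"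

lemma subspace_tensor_null: "qvec.subspace tensor_null"
  unfolding tensor_null_def by (rule qvec.subspace_span)

definition tensor_rel :: "('v::qvec \<times> 'w::qvec \<Rightarrow>\<^sub>0 Cq) \<Rightarrow> ('v \<times> 'w \<Rightarrow>\<^sub>0 Cq) \<Rightarrow> bool" where
  "tensor_rel x y \<longleftrightarrow> x - y \<in> tensor_null"

lemma equivp_tensor_rel: "equivp tensor_rel"
proof (rule equivpI)
  show "reflp tensor_rel"
    by (simp add: reflp_def tensor_rel_def qvec.subspace_0 subspace_tensor_null)
  show "symp tensor_rel"
    unfolding symp_def tensor_rel_def
    by (auto dest: qvec.subspace_neg[OF subspace_tensor_null])
  show "transp tensor_rel"
    unfolding transp_def tensor_rel_def
    by (auto dest: qvec.subspace_add[OF subspace_tensor_null])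
qed

quotient_type (overloaded) ('v, 'w) tensor = "('v::qvec \<times> 'w::qvec) \<Rightarrow>\<^sub>0 Cq" / tensor_rel
  by (rule equivp_tensor_rel)

instantiation tensor :: (qvec, qvec) qvec
begin
lift_definition zero_tensor :: "('a, 'b) tensor" is 0 .
lift_definition plus_tensor :: "('a, 'b) tensor \<Rightarrow> ('a, 'b) tensor \<Rightarrow> ('a, 'b) tensor" is "(+)"
  unfolding tensor_rel_def by (drule (1) qvec.subspace_add[OF subspace_tensor_null]) (simp add: algebra_simps)
lift_definition uminus_tensor :: "('a, 'b) tensor \<Rightarrow> ('a, 'b) tensor" is uminus
  unfolding tensor_rel_def by (drule qvec.subspace_neg[OF subspace_tensor_null]) (simp add: algebra_simps)
lift_definition minus_tensor :: "('a, 'b) tensor \<Rightarrow> ('a, 'b) tensor \<Rightarrow> ('a, 'b) tensor" is "(-)"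
  unfolding tensor_rel_def by (drule (1) qvec.subspace_diff[OF subspace_tensor_null]) (simp add: algebra_simps)
lift_definition scaleQ_tensor :: "Cq \<Rightarrow> ('a, 'b) tensor \<Rightarrow> ('a, 'b) tensor" is "(*\<^sub>q)"
  unfolding tensor_rel_def
  by (drule qvec.subspace_scale[OF subspace_tensor_null]) (simp add: qvec.scale_right_diff_distrib)
instance
  by standard (transfer; simp add: tensor_rel_def qvec.subspace_0[OF subspace_tensor_null]
      algebra_simps scaleQ_add_right scaleQ_add_left scaleQ_scaleQ scaleQ_one)+
end

lift_definition tens :: "'v::qvec \<Rightarrow> 'w::qvec \<Rightarrow> ('v, 'w) tensor"  (infixl "\<otimes>" 76)
  is "\<lambda>v w. Poly_Mapping.single (v, w) 1" .

definition tensor_of :: "'v::qvec set \<Rightarrow> 'w::qvec set \<Rightarrow> ('v, 'w) tensor set" where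
  "tensor_of V W = qvec.span {v \<otimes> w | v w. v \<in> V \<and> w \<in> W}"

text \<open>The linear map \<open>V \<otimes> W \<rightarrow> X\<close> induced by a map \<open>b\<close> that is bilinear on \<open>V \<times> W\<close> (and arbitrary
  elsewhere, hence the choice of a representative supported on \<open>V \<times> W\<close>; the result does not
  depend on it).\<close>

definition tensor_lift ::
  "'v::qvec set \<Rightarrow> 'w::qvec set \<Rightarrow> ('v \<Rightarrow> 'w \<Rightarrow> 'x::qvec) \<Rightarrow> ('v, 'w) tensor \<Rightarrow> 'x" where
  "tensor_lift V W b t =
     (let r = (SOME r. Poly_Mapping.keys r \<subseteq> V \<times> W \<and> abs_tensor r = t)
      in \<Sum>(v, w)\<in>Poly_Mapping.keys r. Poly_Mapping.lookup r (v, w) *\<^sub>q b v w)"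


section \<open>The free algebra on the generators\<close>

text \<open>For types \<open>'m\<close>, \<open>'n\<close> of class \<^class>\<open>finite\<close> the positive integers \<open>m\<close>, \<open>n\<close> of \<open>gl\<^bsub>m|n\<^esub>\<close> are
  \<open>CARD('m)\<close>, \<open>CARD('n)\<close>.  \<open>Up a\<close>, \<open>Down a\<close>, \<open>Kp b\<close>, \<open>Km b\<close> stand for
  \<open>E\<^bsub>a,a+1\<^esub>\<close>, \<open>E\<^bsub>a+1,a\<^esub>\<close>, \<open>K\<^bsub>b\<^esub>\<close>, \<open>K\<^bsub>b\<^esub>\<^sup>-\<^sup>1\<close>.\<close>

datatype letter = Up nat | Down nat | Kp nat | Km nat

fun valid_letter :: "nat \<Rightarrow> nat \<Rightarrow> letter \<Rightarrow> bool" where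
  "valid_letter m n (Up a) \<longleftrightarrow> a \<in> {1..m + n - 1}"
| "valid_letter m n (Down a) \<longleftrightarrow> a \<in> {1..m + n - 1}"
| "valid_letter m n (Kp b) \<longleftrightarrow> b \<in> {1..m + n}"
| "valid_letter m n (Km b) \<longleftrightarrow> b \<in> {1..m + n}"

fun letter_parity :: "nat \<Rightarrow> letter \<Rightarrow> bit" where
  "letter_parity m (Up a) = (if a = m then 1 else 0)"
| "letter_parity m (Down a) = (if a = m then 1 else 0)"
| "letter_parity m (Kp b) = 0"
| "letter_parity m (Km b) = 0"

typedef ('m, 'n) gen = "{l. valid_letter CARD('m::finite) CARD('n::finite) l}"
  by (rule exI[of _ "Kp 1"]) (auto simp: Suc_le_eq)

datatype 'g fword = FWord (letters: "'g list")

instantiation fword :: (type) monoid_add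
begin
definition "0 = FWord []"
definition "u + v = FWord (letters u @ letters v)"
instance by standard (simp_all add: zero_fword_def plus_fword_def)
end

type_synonym ('m, 'n) free = "('m, 'n) gen fword \<Rightarrow>\<^sub>0 Cq"

definition free_letter :: "letter \<Rightarrow> ('m::finite, 'n::finite) free" where
  "free_letter l = Poly_Mapping.single (FWord [Abs_gen l]) 1"

abbreviation "up a \<equiv> free_letter (Up a)"
abbreviation "down a \<equiv> free_letter (Down a)"
abbreviation "kp b \<equiv> free_letter (Kp b)"
abbreviation "km b \<equiv> free_letter (Km b)"

definition word_parity :: "('m::finite, 'n::finite) gen fword \<Rightarrow> bit" where
  "word_parity w = (\<Sum>g\<leftarrow>letters w. letter_parity CARD('m) (Rep_gen g))"


section \<open>The quantum superalgebra\<close>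

definition eps :: "nat \<Rightarrow> nat \<Rightarrow> int" where
  "eps a = (\<lambda>b. if b = a then 1 else 0)"

definition wform :: "nat \<Rightarrow> nat \<Rightarrow> (nat \<Rightarrow> int) \<Rightarrow> (nat \<Rightarrow> int) \<Rightarrow> int" where
  "wform m n \<mu> \<nu> = (\<Sum>a = 1..m + n. (if a \<le> m then 1 else - 1) * \<mu> a * \<nu> a)"

definition q_at :: "nat \<Rightarrow> nat \<Rightarrow> Cq" where
  "q_at m a = (if a \<le> m then qq else inverse qq)"

text \<open>\<open>up_root a d\<close> is \<open>E\<^bsub>a,a+d+1\<^esub>\<close> and \<open>down_root a d\<close> is \<open>E\<^bsub>a+d+1,a\<^esub>\<close>, with the intermediate index
  taken to be \<open>c = a + d\<close>.\<close>

primrec up_root :: "nat \<Rightarrow> nat \<Rightarrow> ('m::finite, 'n::finite) free" where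
  "up_root a 0 = up a"
| "up_root a (Suc d) = (let c = a + Suc d in
     up_root a d * up c - inverse (q_at CARD('m) c) *\<^sub>q (up c * up_root a d))"

primrec down_root :: "nat \<Rightarrow> nat \<Rightarrow> ('m::finite, 'n::finite) free" where
  "down_root a 0 = down a"
| "down_root a (Suc d) = (let c = a + Suc d in
     down c * down_root a d - q_at CARD('m) c *\<^sub>q (down_root a d * down c))"

definition serre :: "('m::finite, 'n::finite) free \<Rightarrow> ('m, 'n) free \<Rightarrow> ('m, 'n) free" where
  "serre x y = x * x * y - (qq + inverse qq) *\<^sub>q (x * y * x) + y * x * x"

inductive_set uq_rel :: "('m::finite, 'n::finite) free set" where
  K_inv: "b \<in> {1..CARD('m) + CARD('n)} \<Longrightarrow> kp b * km b - 1 \<in> uq_rel"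
| K_comm: "a \<in> {1..CARD('m) + CARD('n)} \<Longrightarrow> b \<in> {1..CARD('m) + CARD('n)} \<Longrightarrow>
    x \<in> {kp a, km a} \<Longrightarrow> y \<in> {kp b, km b} \<Longrightarrow> x * y - y * x \<in> uq_rel"
| K_up: "a \<in> {1..CARD('m) + CARD('n)} \<Longrightarrow> b \<in> {1..CARD('m) + CARD('n) - 1} \<Longrightarrow>
    kp a * up b * km a
      - power_int qq (wform CARD('m) CARD('n) (eps a) (eps b - eps (b + 1))) *\<^sub>q up b \<in> uq_rel"
| K_down: "a \<in> {1..CARD('m) + CARD('n)} \<Longrightarrow> b \<in> {1..CARD('m) + CARD('n) - 1} \<Longrightarrow>
    kp a * down b * km a
      - power_int qq (wform CARD('m) CARD('n) (eps a) (eps (b + 1) - eps b)) *\<^sub>q down b \<in> uq_rel"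
| up_down: "a \<in> {1..CARD('m) + CARD('n) - 1} \<Longrightarrow> b \<in> {1..CARD('m) + CARD('n) - 1} \<Longrightarrow>
    up a * down b
      - (if a = CARD('m) \<and> b = CARD('m) then - 1 else 1 :: Cq) *\<^sub>q (down b * up a)
      - (if a = b
         then inverse (q_at CARD('m) a - inverse (q_at CARD('m) a))
                *\<^sub>q (kp a * km (a + 1) - km a * kp (a + 1))
         else 0) \<in> uq_rel"
| up_odd: "up CARD('m) * up CARD('m) \<in> uq_rel"
| down_odd: "down CARD('m) * down CARD('m) \<in> uq_rel"
| up_comm: "a \<in> {1..CARD('m) + CARD('n) - 1} \<Longrightarrow> b \<in> {1..CARD('m) + CARD('n) - 1} \<Longrightarrow>
    a + 2 \<le> b \<or> b + 2 \<le> a \<Longrightarrow> up a * up b - up b * up a \<in> uq_rel"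
| down_comm: "a \<in> {1..CARD('m) + CARD('n) - 1} \<Longrightarrow> b \<in> {1..CARD('m) + CARD('n) - 1} \<Longrightarrow>
    a + 2 \<le> b \<or> b + 2 \<le> a \<Longrightarrow> down a * down b - down b * down a \<in> uq_rel"
| serre_up: "a \<in> {1..CARD('m) + CARD('n) - 1} \<Longrightarrow> b \<in> {1..CARD('m) + CARD('n) - 1} \<Longrightarrow>
    a \<noteq> CARD('m) \<Longrightarrow> b = a + 1 \<or> a = b + 1 \<Longrightarrow> serre (up a) (up b) \<in> uq_rel"
| serre_down: "a \<in> {1..CARD('m) + CARD('n) - 1} \<Longrightarrow> b \<in> {1..CARD('m) + CARD('n) - 1} \<Longrightarrow>
    a \<noteq> CARD('m) \<Longrightarrow> b = a + 1 \<or> a = b + 1 \<Longrightarrow> serre (down a) (down b) \<in> uq_rel"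
| serre_odd_up: "CARD('m) \<ge> 2 \<Longrightarrow> CARD('n) \<ge> 2 \<Longrightarrow>
    up_root (CARD('m) - 1) 2 * up CARD('m) + up CARD('m) * up_root (CARD('m) - 1) 2 \<in> uq_rel"
| serre_odd_down: "CARD('m) \<ge> 2 \<Longrightarrow> CARD('n) \<ge> 2 \<Longrightarrow>
    down_root (CARD('m) - 1) 2 * down CARD('m) + down CARD('m) * down_root (CARD('m) - 1) 2
      \<in> uq_rel"

definition uq_ideal :: "('m::finite, 'n::finite) free set" where
  "uq_ideal = qvec.span {u * r * v | u r v. r \<in> uq_rel}"

definition uq_eq :: "('m::finite, 'n::finite) free \<Rightarrow> ('m, 'n) free \<Rightarrow> bool" where
  "uq_eq x y \<longleftrightarrow> x - y \<in> uq_ideal"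

lemma subspace_uq_ideal: "qvec.subspace uq_ideal"
  unfolding uq_ideal_def by (rule qvec.subspace_span)

lemma free_scale_left:
  fixes p :: "'g fword \<Rightarrow>\<^sub>0 Cq"
  shows "c *\<^sub>q p = Poly_Mapping.single 0 c * p"
proof -
  have "c *\<^sub>q p = Poly_Mapping.map (times c) p"
    by (rule poly_mapping_eqI)
      (simp add: scaleQ_poly_mapping.rep_eq scaleQ_Cq_def map.rep_eq when_def)
  then show ?thesis by (simp add: mult_map_scale_conv_mult)
qed

lemma free_scale_right:
  fixes p :: "'g fword \<Rightarrow>\<^sub>0 Cq"
  shows "c *\<^sub>q p = p * Poly_Mapping.single 0 c"
proof -
  have "(\<Sum>k\<in>K. Poly_Mapping.single 0 c * Poly_Mapping.single k (Poly_Mapping.lookup p k))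
      = (\<Sum>k\<in>K. Poly_Mapping.single k (Poly_Mapping.lookup p k) * Poly_Mapping.single 0 c)" for K
    by (simp add: mult_single mult.commute)
  then have "Poly_Mapping.single 0 c * (\<Sum>k\<in>K. Poly_Mapping.single k (Poly_Mapping.lookup p k))
      = (\<Sum>k\<in>K. Poly_Mapping.single k (Poly_Mapping.lookup p k)) * Poly_Mapping.single 0 c" for K
    by (simp add: sum_distrib_left sum_distrib_right)
  moreover have "(\<Sum>k\<in>Poly_Mapping.keys p. Poly_Mapping.single k (Poly_Mapping.lookup p k)) = p"
    by (rule poly_mapping_eqI)
      (simp add: lookup_sum lookup_single when_def sum.delta in_keys_iff)
  ultimately show ?thesis
    by (metis free_scale_left)
qed

lemma uq_ideal_mult:
  assumes "x \<in> uq_ideal"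
  shows "u * x \<in> uq_ideal" and "x * u \<in> uq_ideal"
proof -
  let ?B = "{u * r * v | u r v. r \<in> uq_rel} :: ('a, 'b) free set"
  have "u * x \<in> uq_ideal \<and> x * u \<in> uq_ideal"
    using assms unfolding uq_ideal_def
  proof (induction rule: qvec.span_induct_alt)
    case base
    then show ?case by (simp add: qvec.span_zero)
  next
    case (step c x y)
    then obtain w r v where x: "x = w * r * v" "r \<in> uq_rel" by blast
    have "u * x \<in> ?B" "x * u \<in> ?B"
      using x by (auto; metis mult.assoc)+
    then have "c *\<^sub>q (u * x) + u * y \<in> qvec.span ?B" "c *\<^sub>q (x * u) + y * u \<in> qvec.span ?B"
      using step by (auto intro!: qvec.span_add qvec.span_scale intro: qvec.span_base)
    moreover have "u * (c *\<^sub>q x + y) = c *\<^sub>q (u * x) + u * y"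
      by (simp only: free_scale_right distrib_left mult.assoc)
    moreover have "(c *\<^sub>q x + y) * u = c *\<^sub>q (x * u) + y * u"
      by (simp only: free_scale_left distrib_right mult.assoc)
    ultimately show ?case by simp
  qed
  then show "u * x \<in> uq_ideal" and "x * u \<in> uq_ideal" by auto
qed

lemma equivp_uq_eq: "equivp uq_eq"
proof (rule equivpI)
  show "reflp uq_eq"
    by (simp add: reflp_def uq_eq_def qvec.subspace_0 subspace_uq_ideal)
  show "symp uq_eq"
    unfolding symp_def uq_eq_def
    by (auto dest: qvec.subspace_neg[OF subspace_uq_ideal])
  show "transp uq_eq"
    unfolding transp_def uq_eq_def
    by (auto dest: qvec.subspace_add[OF subspace_uq_ideal])
qed

quotient_type (overloaded) ('m, 'n) uq = "('m::finite, 'n::finite) free" / uq_eq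
  by (rule equivp_uq_eq)

instantiation uq :: (finite, finite) "{ring, monoid_mult, qvec}"
begin
lift_definition zero_uq :: "('a, 'b) uq" is 0 .
lift_definition one_uq :: "('a, 'b) uq" is 1 .
lift_definition plus_uq :: "('a, 'b) uq \<Rightarrow> ('a, 'b) uq \<Rightarrow> ('a, 'b) uq" is "(+)"
  unfolding uq_eq_def by (drule (1) qvec.subspace_add[OF subspace_uq_ideal]) (simp add: algebra_simps)
lift_definition uminus_uq :: "('a, 'b) uq \<Rightarrow> ('a, 'b) uq" is uminus
  unfolding uq_eq_def by (drule qvec.subspace_neg[OF subspace_uq_ideal]) (simp add: algebra_simps)
lift_definition minus_uq :: "('a, 'b) uq \<Rightarrow> ('a, 'b) uq \<Rightarrow> ('a, 'b) uq" is "(-)"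
  unfolding uq_eq_def by (drule (1) qvec.subspace_diff[OF subspace_uq_ideal]) (simp add: algebra_simps)
lift_definition times_uq :: "('a, 'b) uq \<Rightarrow> ('a, 'b) uq \<Rightarrow> ('a, 'b) uq" is "(*)"
proof -
  fix x x' y y' :: "('a, 'b) free"
  assume "uq_eq x x'" "uq_eq y y'"
  then have "(x - x') * y + x' * (y - y') \<in> uq_ideal"
    unfolding uq_eq_def
    by (intro qvec.subspace_add[OF subspace_uq_ideal] uq_ideal_mult)
  then show "uq_eq (x * y) (x' * y')"
    by (simp add: uq_eq_def algebra_simps)
qed
lift_definition scaleQ_uq :: "Cq \<Rightarrow> ('a, 'b) uq \<Rightarrow> ('a, 'b) uq" is "(*\<^sub>q)"
  unfolding uq_eq_def
  by (drule qvec.subspace_scale[OF subspace_uq_ideal]) (simp add: qvec.scale_right_diff_distrib)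
instance
  by standard (transfer; simp add: uq_eq_def qvec.subspace_0[OF subspace_uq_ideal]
      algebra_simps scaleQ_add_right scaleQ_add_left scaleQ_scaleQ scaleQ_one)+
end

lift_definition uq_gen :: "letter \<Rightarrow> ('m::finite, 'n::finite) uq" is free_letter .

definition uq_part :: "bit \<Rightarrow> ('m::finite, 'n::finite) uq set" where
  "uq_part p = qvec.span {abs_uq (Poly_Mapping.single w 1) | w. word_parity w = p}"

definition sg :: "bit \<Rightarrow> Cq" where
  "sg p = (if p = 0 then 1 else - 1)"

text \<open>The degree \<open>p\<close> component of \<open>v \<in> G 0 \<oplus> G 1\<close>.  Formulas with signs such as
  \<open>(-1)\<^bsup>[x][f]\<^esup>\<close>, meant for homogeneous elements, are extended linearly below by summing over
  the components of the arguments.\<close>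

definition hcomp :: "(bit \<Rightarrow> 'a::qvec set) \<Rightarrow> bit \<Rightarrow> 'a \<Rightarrow> 'a" where
  "hcomp G p v = (THE u. u \<in> G p \<and> v - u \<in> G (p + 1))"

text \<open>The antipode: the values on \<open>E\<^bsub>a,a+1\<^esub>\<close> and \<open>E\<^bsub>a+1,a\<^esub>\<close> are those forced by
  \<open>\<Delta>(E\<^bsub>a,a+1\<^esub>) = E\<^bsub>a,a+1\<^esub> \<otimes> K\<^bsub>a\<^esub> K\<^bsub>a+1\<^esub>\<^sup>-\<^sup>1 + 1 \<otimes> E\<^bsub>a,a+1\<^esub>\<close> and
  \<open>\<Delta>(E\<^bsub>a+1,a\<^esub>) = E\<^bsub>a+1,a\<^esub> \<otimes> 1 + K\<^bsub>a\<^esub>\<^sup>-\<^sup>1 K\<^bsub>a+1\<^esub> \<otimes> E\<^bsub>a+1,a\<^esub>\<close>.\<close>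

definition antipode :: "('m::finite, 'n::finite) uq \<Rightarrow> ('m, 'n) uq" where
  "antipode = (THE S. qlinear S \<and> S 1 = 1 \<and>
     (\<forall>p r. \<forall>x\<in>uq_part p. \<forall>y\<in>uq_part r. S (x * y) = sg (p * r) *\<^sub>q (S y * S x)) \<and>
     (\<forall>b\<in>{1..CARD('m) + CARD('n)}.
        S (uq_gen (Kp b)) = uq_gen (Km b) \<and> S (uq_gen (Km b)) = uq_gen (Kp b)) \<and>
     (\<forall>a\<in>{1..CARD('m) + CARD('n) - 1}.
        S (uq_gen (Up a)) = - (uq_gen (Up a) * uq_gen (Km a) * uq_gen (Kp (a + 1))) \<and>
        S (uq_gen (Down a)) = - (uq_gen (Kp a) * uq_gen (Km (a + 1)) * uq_gen (Down a))))"

text \<open>The reductive sub-superalgebra attached to \<open>\<Theta> \<subseteq> {1..m+n-1}\<close>.  For \<open>\<Theta> = {1..m+n-1}\<close> it is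
  the whole of \<open>U\<^sub>q(g)\<close>.\<close>

inductive_set uq_sub :: "nat set \<Rightarrow> ('m::finite, 'n::finite) uq set" for \<Theta> where
  one: "1 \<in> uq_sub \<Theta>"
| Kp: "b \<in> {1..CARD('m) + CARD('n)} \<Longrightarrow> uq_gen (Kp b) \<in> uq_sub \<Theta>"
| Km: "b \<in> {1..CARD('m) + CARD('n)} \<Longrightarrow> uq_gen (Km b) \<in> uq_sub \<Theta>"
| Up: "a \<in> \<Theta> \<Longrightarrow> uq_gen (Up a) \<in> uq_sub \<Theta>"
| Down: "a \<in> \<Theta> \<Longrightarrow> uq_gen (Down a) \<in> uq_sub \<Theta>"
| add: "x \<in> uq_sub \<Theta> \<Longrightarrow> y \<in> uq_sub \<Theta> \<Longrightarrow> x + y \<in> uq_sub \<Theta>"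
| scale: "x \<in> uq_sub \<Theta> \<Longrightarrow> c *\<^sub>q x \<in> uq_sub \<Theta>"
| mult: "x \<in> uq_sub \<Theta> \<Longrightarrow> y \<in> uq_sub \<Theta> \<Longrightarrow> x * y \<in> uq_sub \<Theta>"


section \<open>Modules\<close>

text \<open>A module is given by its even and odd parts inside an ambient vector space and by an
  action, which matters only for elements of the acting subalgebra and of the module.\<close>

record ('m::finite, 'n::finite, 'v) smod =
  part :: "bit \<Rightarrow> 'v set"
  act :: "('m, 'n) uq \<Rightarrow> 'v \<Rightarrow> 'v"

definition scarrier :: "('m::finite, 'n::finite, 'v::qvec) smod \<Rightarrow> 'v set" where
  "scarrier M = {u + v | u v. u \<in> part M 0 \<and> v \<in> part M 1}"

definition supermodule ::
  "('m::finite, 'n::finite) uq set \<Rightarrow> ('m, 'n, 'v::qvec) smod \<Rightarrow> bool" where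
  "supermodule U M \<longleftrightarrow>
     (\<forall>p. qvec.subspace (part M p)) \<and> part M 0 \<inter> part M 1 = {0} \<and>
     (\<forall>x\<in>U. qlinear_on (scarrier M) (act M x)) \<and>
     (\<forall>v\<in>scarrier M. qlinear_on U (\<lambda>x. act M x v)) \<and>
     (\<forall>v\<in>scarrier M. act M 1 v = v) \<and>
     (\<forall>x\<in>U. \<forall>y\<in>U. \<forall>v\<in>scarrier M. act M (x * y) v = act M x (act M y v)) \<and>
     (\<forall>p r. \<forall>x\<in>U \<inter> uq_part p. \<forall>v\<in>part M r. act M x v \<in> part M (p + r))"

definition integral_weight_vec ::
  "('m::finite, 'n::finite, 'v::qvec) smod \<Rightarrow> (nat \<Rightarrow> int) \<Rightarrow> 'v \<Rightarrow> bool" where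
  "integral_weight_vec M \<mu> v \<longleftrightarrow> v \<in> scarrier M \<and>
     (\<forall>a\<in>{1..CARD('m) + CARD('n)}.
        act M (uq_gen (Kp a)) v = power_int qq (wform CARD('m) CARD('n) \<mu> (eps a)) *\<^sub>q v)"

definition cat_obj :: "nat set \<Rightarrow> ('m::finite, 'n::finite, 'v::qvec) smod \<Rightarrow> bool" where
  "cat_obj \<Theta> M \<longleftrightarrow> supermodule (uq_sub \<Theta>) M \<and>
     scarrier M = qvec.span {v. (\<exists>\<mu>. integral_weight_vec M \<mu> v) \<and>
                                finite_dim ((\<lambda>x. act M x v) ` uq_sub \<Theta>)}"

definition cat_mor ::
  "nat set \<Rightarrow> ('m::finite, 'n::finite, 'v::qvec) smod \<Rightarrow> ('m, 'n, 'w::qvec) smod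
     \<Rightarrow> ('v \<Rightarrow> 'w) \<Rightarrow> bool" where
  "cat_mor \<Theta> M N \<phi> \<longleftrightarrow> qlinear_on (scarrier M) \<phi> \<and> (\<forall>p. \<phi> ` part M p \<subseteq> part N p) \<and>
     (\<forall>x\<in>uq_sub \<Theta>. \<forall>v\<in>scarrier M. \<phi> (act M x v) = act N x (\<phi> v))"


section \<open>The induction functor\<close>

definition hom_part ::
  "nat set \<Rightarrow> ('m::finite, 'n::finite, 'v::qvec) smod \<Rightarrow> bit \<Rightarrow> (('m, 'n) uq \<Rightarrow> 'v) set" where
  "hom_part \<Theta> V p = {\<zeta>. qlinear \<zeta> \<and> (\<forall>r. \<zeta> ` uq_part r \<subseteq> part V (p + r)) \<and>
     (\<forall>r. \<forall>x\<in>uq_sub \<Theta> \<inter> uq_part r. \<forall>y. \<zeta> (x * y) = sg (r * p) *\<^sub>q act V x (\<zeta> y))}"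

definition hom_mod ::
  "nat set \<Rightarrow> ('m::finite, 'n::finite, 'v::qvec) smod \<Rightarrow> ('m, 'n, ('m, 'n) uq \<Rightarrow> 'v) smod" where
  "hom_mod \<Theta> V = \<lparr> part = hom_part \<Theta> V,
     act = (\<lambda>y \<zeta> x. \<Sum>a\<in>{0, 1}. \<Sum>b\<in>{0, 1}. \<Sum>c\<in>{0, 1}.
        sg (a * (b + c)) *\<^sub>q hcomp (hom_part \<Theta> V) c \<zeta> (hcomp uq_part b x * hcomp uq_part a y)) \<rparr>"

definition ind_obj ::
  "nat set \<Rightarrow> ('m::finite, 'n::finite, 'v::qvec) smod \<Rightarrow> ('m, 'n, ('m, 'n) uq \<Rightarrow> 'v) smod" where
  "ind_obj \<Theta> V = (hom_mod \<Theta> V) \<lparr> part := (\<lambda>p. qvec.span (\<Union> {N p | N.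
     (\<forall>r. N r \<subseteq> hom_part \<Theta> V r) \<and>
     cat_obj {1..CARD('m) + CARD('n) - 1} ((hom_mod \<Theta> V) \<lparr> part := N \<rparr>)})) \<rparr>"

definition ind_mor ::
  "('v \<Rightarrow> 'w) \<Rightarrow> (('m::finite, 'n::finite) uq \<Rightarrow> 'v) \<Rightarrow> ('m, 'n) uq \<Rightarrow> 'w" where
  "ind_mor \<phi> \<zeta> = \<phi> \<circ> \<zeta>"


section \<open>The functor \<open>S\<close>\<close>

text \<open>Every finite dimensional module is isomorphic to one carried by a subspace of
  \<^typ>\<open>nat \<Rightarrow> Cq\<close>, so it suffices to consider these.\<close>

definition matrix_elements :: "(('m::finite, 'n::finite) uq \<Rightarrow> Cq) set" where
  "matrix_elements = {(\<lambda>x. w (act M x v)) | (M :: ('m, 'n, nat \<Rightarrow> Cq) smod) v w.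
     cat_obj {1..CARD('m) + CARD('n) - 1} M \<and> finite_dim (scarrier M) \<and>
     v \<in> scarrier M \<and> qlinear w}"

definition Ag :: "(('m::finite, 'n::finite) uq \<Rightarrow> Cq) set" where
  "Ag = qvec.span matrix_elements"

definition Ag_part :: "bit \<Rightarrow> (('m::finite, 'n::finite) uq \<Rightarrow> Cq) set" where
  "Ag_part p = {f \<in> Ag. \<forall>x\<in>uq_part (p + 1). f x = 0}"

definition dL ::
  "('m::finite, 'n::finite) uq \<Rightarrow> (('m, 'n) uq \<Rightarrow> Cq) \<Rightarrow> ('m, 'n) uq \<Rightarrow> Cq" where
  "dL x f y = (\<Sum>a\<in>{0, 1}. \<Sum>c\<in>{0, 1}.
     sg (a * c) * hcomp Ag_part c f (antipode (hcomp uq_part a x) * y))"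

definition dR ::
  "('m::finite, 'n::finite) uq \<Rightarrow> (('m, 'n) uq \<Rightarrow> Cq) \<Rightarrow> ('m, 'n) uq \<Rightarrow> Cq" where
  "dR x f y = (\<Sum>a\<in>{0, 1}. sg a * f (y * hcomp uq_part a x))"

type_synonym ('m, 'n, 'v) VA = "('v, ('m, 'n) uq \<Rightarrow> Cq) tensor"

definition VA :: "('m::finite, 'n::finite, 'v::qvec) smod \<Rightarrow> ('m, 'n, 'v) VA set" where
  "VA V = tensor_of (scarrier V) Ag"

definition VA_part ::
  "('m::finite, 'n::finite, 'v::qvec) smod \<Rightarrow> bit \<Rightarrow> ('m, 'n, 'v) VA set" where
  "VA_part V p = qvec.span {\<xi> \<otimes> f | \<xi> f r s. p = r + s \<and> \<xi> \<in> part V r \<and> f \<in> Ag_part s}"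

text \<open>\<open>id \<otimes> T\<^bsub>x\<^esub>\<close> for a family of operators \<open>T\<^bsub>x\<^esub>\<close> on \<^const>\<open>Ag\<close>, linear in \<open>x\<close> and of the same
  parity as \<open>x\<close>.\<close>

definition id_tens ::
  "('m::finite, 'n::finite, 'v::qvec) smod
     \<Rightarrow> (('m, 'n) uq \<Rightarrow> (('m, 'n) uq \<Rightarrow> Cq) \<Rightarrow> (('m, 'n) uq \<Rightarrow> Cq))
     \<Rightarrow> ('m, 'n) uq \<Rightarrow> ('m, 'n, 'v) VA \<Rightarrow> ('m, 'n, 'v) VA" where
  "id_tens V T x = tensor_lift (scarrier V) Ag (\<lambda>\<xi> f. \<Sum>a\<in>{0, 1}. \<Sum>b\<in>{0, 1}.
     sg (a * b) *\<^sub>q (hcomp (part V) b \<xi> \<otimes> T (hcomp uq_part a x) f))"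

definition act_tens_id ::
  "('m::finite, 'n::finite, 'v::qvec) smod \<Rightarrow> ('m, 'n) uq
     \<Rightarrow> ('m, 'n, 'v) VA \<Rightarrow> ('m, 'n, 'v) VA" where
  "act_tens_id V x = tensor_lift (scarrier V) Ag (\<lambda>\<xi> f. act V x \<xi> \<otimes> f)"

definition S_space ::
  "nat set \<Rightarrow> ('m::finite, 'n::finite, 'v::qvec) smod \<Rightarrow> ('m, 'n, 'v) VA set" where
  "S_space \<Theta> V =
     {\<zeta> \<in> VA V. \<forall>x\<in>uq_sub \<Theta>. id_tens V dL x \<zeta> = act_tens_id V (antipode x) \<zeta>}"

definition S_obj ::
  "nat set \<Rightarrow> ('m::finite, 'n::finite, 'v::qvec) smod \<Rightarrow> ('m, 'n, ('m, 'n, 'v) VA) smod" where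
  "S_obj \<Theta> V = \<lparr> part = (\<lambda>p. S_space \<Theta> V \<inter> VA_part V p), act = id_tens V dR \<rparr>"

definition S_mor ::
  "('m::finite, 'n::finite, 'v::qvec) smod \<Rightarrow> ('v \<Rightarrow> 'w::qvec)
     \<Rightarrow> ('m, 'n, 'v) VA \<Rightarrow> ('m, 'n, 'w) VA" where
  "S_mor V \<phi> = tensor_lift (scarrier V) Ag (\<lambda>\<xi> f. \<phi> \<xi> \<otimes> f)"

definition ident ::
  "('m::finite, 'n::finite, 'v::qvec) smod \<Rightarrow> ('m, 'n, 'v) VA \<Rightarrow> ('m, 'n) uq \<Rightarrow> 'v" where
  "ident V = tensor_lift (scarrier V) Ag (\<lambda>\<xi> f x. f x *\<^sub>q \<xi>)"

end

theory Submission
  imports Defs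
begin

text \<open>View \<open>\<Xi> \<otimes> A(g)\<close> as the space of maps \<open>U\<^sub>q(g) \<rightarrow> \<Xi>\<close> that are finite sums \<open>x \<mapsto> f(x) \<xi>\<close>.  Since the antipode
  maps \<open>U\<^sub>q(l)\<close> onto itself, the equations defining \<open>S(\<Xi>)\<close> say exactly that the homogeneous components
  of such a map are \<open>U\<^sub>q(l)\<close>-homomorphisms.  A matrix element spans a finite dimensional module under
  right translation, and a sum of weight vectors lies in an invariant subspace only if all its summands
  do, so these homomorphisms form a \<open>U\<^sub>q(g)\<close>-finite module.  Conversely, let \<open>\<zeta>\<close> lie in a
  \<open>U\<^sub>q(g)\<close>-finite submodule of \<open>Hom(U\<^sub>q(g), \<Xi>)\<close>.  Up to signs \<open>\<zeta>(x) = (x \<zeta>)(1)\<close>; expanding \<open>x \<zeta>\<close> in a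
  basis of a finite dimensional graded submodule containing \<open>\<zeta>\<close> exhibits \<open>\<zeta>\<close> as a finite sum of matrix
  elements times vectors of \<open>\<Xi>\<close>.

  The antipode is given by a definite description, so its existence has to be proved: on words it is
  a signed reversal, and up to scalars and factors \<open>K\<^sub>a\<close> it maps every relation of \<open>U\<^sub>q(g)\<close> to its reversal.\<close>

section \<open>Linear algebra over \<open>\<complex>(q)\<close>\<close>

text \<open>The signs shape the proof. The definitions extend each signed formula to arbitrary
  elements through components given by a definite description, and \<open>uq\<close> is a quotient
  in which it is not evident that the even and odd spans meet only in 0. Both difficulties are met
  by the parity automorphism x -> (-1)^[x] x: it descends to \<open>uq\<close> because the relations
  are homogeneous, its eigenspaces are the two parts, and \<open>par_twist\<close> replaces a signed
  sum over the components of a factor by one algebra map. Components of maps are always taken in the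
  ambient grading \<open>lin_part\<close>, with which the gradings of homomorphisms and of \<Xi>
  \<otimes> A(g) are compared.

  Two more obstacles. A weight vector generating a finite dimensional submodule need not be
  homogeneous, so its orbit is enlarged to the space of homogeneous components. And matrix elements
  come only from modules inside \<open>nat \<Rightarrow> Cq\<close>, so a finite dimensional module
  of maps is copied there by coordinates before its coefficients count as elements of
  \<open>Ag\<close>.\<close>

interpretation qpair: vector_space_pair
  "scaleQ :: Cq \<Rightarrow> 'a \<Rightarrow> 'a::qvec" "scaleQ :: Cq \<Rightarrow> 'b \<Rightarrow> 'b::qvec" ..

lemma bit_1_plus_1 [simp]: "1 + 1 = (0::bit)"
  by (metis bit_2_eq_0 one_add_one)

lemma bit_self_plus [simp]: "p + p = (0::bit)" "p + (p + r) = (r::bit)"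
  by (cases p; cases r; simp)+

lemma sg_simps [simp]: "sg 0 = 1" "sg 1 = - 1" "sg p * sg p = 1"
  by (simp_all add: sg_def)

lemma sg_add: "sg (p + r) = sg p * sg r"
  by (cases p; cases r; simp)

lemma sg_mult_scale [simp]: "sg p *\<^sub>q sg p *\<^sub>q v = v"
  by (simp add: scaleQ_scaleQ scaleQ_one)

text \<open>Needed for the eigenprojections (1 + s twist)/2 of the parity automorphism, with s = 1
  or s = -1.\<close>

lemma Cq_2_neq_0 [simp]: "(2 :: Cq) \<noteq> 0"
proof -
  have "(1 :: complex poly fract) + 1 \<noteq> 0"
    by (simp add: Zero_fract_def One_fract_def eq_fract)
  then have "(1 :: Cq) + 1 \<noteq> 0"
    by transfer
  then show ?thesis by simp
qed

lemma qlinear_iff: "qlinear f \<longleftrightarrow> qlinear_on UNIV f"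
  by (auto simp: qlinear_on_def Vector_Spaces.linear_def module_hom_def module_hom_axioms_def
      intro: qvec.vector_space_axioms qvec.module_axioms)

lemma qlinear_onI:
  assumes "\<And>u v. u \<in> V \<Longrightarrow> v \<in> V \<Longrightarrow> f (u + v) = f u + f v"
    and "\<And>c v. v \<in> V \<Longrightarrow> f (c *\<^sub>q v) = c *\<^sub>q f v"
  shows "qlinear_on V f"
  using assms by (simp add: qlinear_on_def)

lemma qlinear_onD:
  assumes "qlinear_on V f"
  shows "u \<in> V \<Longrightarrow> v \<in> V \<Longrightarrow> f (u + v) = f u + f v" "v \<in> V \<Longrightarrow> f (c *\<^sub>q v) = c *\<^sub>q f v"
  using assms by (simp_all add: qlinear_on_def)

lemma qlinearI:
  assumes "\<And>u v. f (u + v) = f u + f v" and "\<And>c v. f (c *\<^sub>q v) = c *\<^sub>q f v"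
  shows "qlinear f"
  using assms by (simp add: qlinear_iff qlinear_on_def)

lemma qlinearD:
  assumes "qlinear f"
  shows "f (u + v) = f u + f v" "f (c *\<^sub>q v) = c *\<^sub>q f v" "f 0 = 0" "f (u - v) = f u - f v"
    "f (- u) = - f u"
  using assms qpair.linear_add qpair.linear_scale qpair.linear_0 qpair.linear_diff qpair.linear_neg
  by blast+

lemma qlinear_imp_on: "qlinear f \<Longrightarrow> qlinear_on V f"
  by (simp add: qlinear_on_def qlinearD)

lemma qlinear_on_subset: "qlinear_on V f \<Longrightarrow> W \<subseteq> V \<Longrightarrow> qlinear_on W f"
  by (simp add: qlinear_on_def subset_iff)

lemma qlinear_on_compose:
  "qlinear_on V f \<Longrightarrow> f ` V \<subseteq> W \<Longrightarrow> qlinear_on W g \<Longrightarrow> qlinear_on V (\<lambda>v. g (f v))"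
  by (simp add: qlinear_on_def image_subset_iff)

lemma qlinear_on_add: "qlinear_on V f \<Longrightarrow> qlinear_on V g \<Longrightarrow> qlinear_on V (\<lambda>v. f v + g v)"
  by (simp add: qlinear_on_def scaleQ_add_right algebra_simps)

lemma qlinear_on_scale: "qlinear_on V f \<Longrightarrow> qlinear_on V (\<lambda>v. c *\<^sub>q f v)"
  by (simp add: qlinear_on_def scaleQ_add_right scaleQ_scaleQ mult.commute)

lemma qlinear_on_const_0: "qlinear_on V (\<lambda>v. 0)"
  by (simp add: qlinear_on_def)

lemma qlinear_on_sumf:
  "(\<And>i. i \<in> I \<Longrightarrow> qlinear_on V (f i)) \<Longrightarrow> qlinear_on V (\<lambda>v. \<Sum>i\<in>I. f i v)"
  by (induction I rule: infinite_finite_induct) (simp_all add: qlinear_on_const_0 qlinear_on_add)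

lemma qlinear_on_0: "qlinear_on V f \<Longrightarrow> qvec.subspace V \<Longrightarrow> f 0 = 0"
  by (metis qlinear_onD(2) qvec.scale_zero_left qvec.subspace_0)

lemma qlinear_on_diff:
  "qlinear_on V f \<Longrightarrow> qvec.subspace V \<Longrightarrow> u \<in> V \<Longrightarrow> v \<in> V \<Longrightarrow> f (u - v) = f u - f v"
  using qlinear_onD(1)[of V f "u - v" v] qvec.subspace_diff[of V u v] by simp

lemma qlinear_on_sum:
  assumes "qlinear_on V f" "qvec.subspace V" "\<And>i. i \<in> I \<Longrightarrow> g i \<in> V"
  shows "f (\<Sum>i\<in>I. g i) = (\<Sum>i\<in>I. f (g i))"
  using assms(3)
  by (induction I rule: infinite_finite_induct)
    (simp_all add: qlinear_on_0[OF assms(1,2)] qlinear_onD(1)[OF assms(1)]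
      qvec.subspace_sum[OF assms(2)])

lemma qlinear_on_image_subspace:
  assumes "qlinear_on V f" "qvec.subspace V"
  shows "qvec.subspace (f ` V)"
  unfolding qvec.subspace_def
proof (intro conjI ballI allI)
  show "0 \<in> f ` V" using qlinear_on_0[OF assms] qvec.subspace_0[OF assms(2)] by force
next
  fix x y assume "x \<in> f ` V" "y \<in> f ` V"
  then obtain u v where "x = f u" "y = f v" "u \<in> V" "v \<in> V" by blast
  then show "x + y \<in> f ` V"
    using qlinear_onD(1)[OF assms(1), of u v] qvec.subspace_add[OF assms(2), of u v] by force
next
  fix c x assume "x \<in> f ` V"
  then obtain u where "x = f u" "u \<in> V" by blast
  then show "c *\<^sub>q x \<in> f ` V"
    using qlinear_onD(2)[OF assms(1), of u c] qvec.subspace_scale[OF assms(2), of u c] by force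
qed

lemma subspace_qlinear_eq:
  assumes "qlinear_on V f" "qlinear_on V g" "qvec.subspace V"
  shows "qvec.subspace {v \<in> V. f v = g v}"
  using assms qlinear_on_0[OF assms(1,3)] qlinear_on_0[OF assms(2,3)]
  by (auto simp: qvec.subspace_def qlinear_onD)

lemma qlinear_on_span_eqI:
  assumes "qlinear_on (qvec.span S) f" "qlinear_on (qvec.span S) g" "\<And>s. s \<in> S \<Longrightarrow> f s = g s"
    "v \<in> qvec.span S"
  shows "f v = g v"
proof -
  have "S \<subseteq> {v \<in> qvec.span S. f v = g v}"
    using assms(3) by (auto intro: qvec.span_base)
  then have "qvec.span S \<subseteq> {v \<in> qvec.span S. f v = g v}"
    by (rule qvec.span_minimal) (rule subspace_qlinear_eq[OF assms(1,2) qvec.subspace_span])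
  then show ?thesis using assms(4) by blast
qed

lemma qlinear_on_image_span_subset:
  assumes "qlinear_on (qvec.span S) f" "\<And>s. s \<in> S \<Longrightarrow> f s \<in> W" "qvec.subspace W"
    "v \<in> qvec.span S"
  shows "f v \<in> W"
proof -
  have "qvec.subspace {v \<in> qvec.span S. f v \<in> W}"
    using assms(3) qlinear_on_0[OF assms(1) qvec.subspace_span]
    by (auto simp: qvec.subspace_def[of "Collect _"] qlinear_onD[OF assms(1)] qvec.span_zero
        qvec.span_add qvec.span_scale qvec.subspace_0 qvec.subspace_add qvec.subspace_scale)
  then have "qvec.span S \<subseteq> {v \<in> qvec.span S. f v \<in> W}"
    by (intro qvec.span_minimal) (auto intro: qvec.span_base assms(2))
  then show ?thesis using assms(4) by blast
qed

text \<open>Extend from a basis of \<open>V\<close>, by zero on a complement. The control of the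
  range makes an extension of the identity a projection onto \<open>V\<close>, which is how maps
  bilinear only on subspaces are handled below.\<close>

lemma qlinear_on_extend:
  assumes "qvec.subspace V" "qlinear_on V f"
  obtains g where "qlinear g" "\<And>v. v \<in> V \<Longrightarrow> g v = f v" "range g \<subseteq> f ` V"
proof -
  obtain B where B: "B \<subseteq> V" "qvec.independent B" "V \<subseteq> qvec.span B"
    using qvec.maximal_independent_subset by metis
  have sp: "qvec.span B = V"
    using B assms(1) by (simp add: qvec.span_minimal subset_antisym)
  obtain g where g: "qlinear g" "\<And>x. x \<in> B \<Longrightarrow> g x = f x" "range g = qvec.span (f ` B)"
    using qpair.linear_independent_extend_subspace[OF B(2), of f] by blast
  have "g v = f v" if "v \<in> V" for v
    by (rule qlinear_on_span_eqI[of B])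
      (use that g assms sp in \<open>auto intro: qlinear_imp_on\<close>)
  moreover have "range g \<subseteq> f ` V"
    unfolding g(3) using B(1) qlinear_on_image_subspace[OF assms(2,1)]
    by (intro qvec.span_minimal) auto
  ultimately show ?thesis using g(1) that by blast
qed

lemma finite_dim_mono: "finite_dim W \<Longrightarrow> V \<subseteq> W \<Longrightarrow> finite_dim V"
  by (meson finite_dim_def order_trans)

lemma finite_dim_span: "finite_dim V \<Longrightarrow> finite_dim (qvec.span V)"
  unfolding finite_dim_def using qvec.span_mono qvec.span_span by metis

lemma finite_dim_Un: "finite_dim V \<Longrightarrow> finite_dim W \<Longrightarrow> finite_dim (V \<union> W)"
  unfolding finite_dim_def
proof (elim exE conjE)
  fix A B assume "finite A" "V \<subseteq> qvec.span A" "finite B" "W \<subseteq> qvec.span B"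
  moreover have "qvec.span A \<subseteq> qvec.span (A \<union> B)" "qvec.span B \<subseteq> qvec.span (A \<union> B)"
    by (rule qvec.span_mono, blast)+
  ultimately show "\<exists>B. finite B \<and> V \<union> W \<subseteq> qvec.span B"
    by (intro exI[of _ "A \<union> B"]) auto
qed

lemma finite_dim_image:
  assumes "finite_dim V" "qlinear_on W f" "V \<subseteq> W" "qvec.subspace W"
  shows "finite_dim (f ` V)"
proof -
  obtain g where g: "qlinear g" "\<And>v. v \<in> W \<Longrightarrow> g v = f v"
    using qlinear_on_extend assms by metis
  obtain B where B: "finite B" "V \<subseteq> qvec.span B"
    using assms by (auto simp: finite_dim_def)
  have "g ` qvec.span B = qvec.span (g ` B)"
    by (rule qpair.linear_span_image[symmetric, OF g(1)])
  then have "f ` V \<subseteq> qvec.span (g ` B)" using B assms g by auto force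
  then show ?thesis using B by (auto simp: finite_dim_def)
qed

text \<open>The universal property of a free vector space. It produces linear maps both from formal
  sums of pairs (tensor products) and from formal sums of words (the free algebra).\<close>

definition lin_ext :: "('a \<Rightarrow> 'b::qvec) \<Rightarrow> ('a \<Rightarrow>\<^sub>0 Cq) \<Rightarrow> 'b" where
  "lin_ext b x = (\<Sum>w\<in>Poly_Mapping.keys x. Poly_Mapping.lookup x w *\<^sub>q b w)"

lemma lin_ext_superset:
  assumes "finite K" "Poly_Mapping.keys x \<subseteq> K"
  shows "lin_ext b x = (\<Sum>w\<in>K. Poly_Mapping.lookup x w *\<^sub>q b w)"
  unfolding lin_ext_def using assms
  by (intro sum.mono_neutral_left) (auto simp: in_keys_iff)

lemma lookup_scaleQ: "Poly_Mapping.lookup (c *\<^sub>q x) w = c * Poly_Mapping.lookup x w"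
  for x :: "'a \<Rightarrow>\<^sub>0 Cq"
  by (simp add: scaleQ_poly_mapping.rep_eq scaleQ_Cq_def)

lemma qlinear_lin_ext: "qlinear (lin_ext b)"
proof (rule qlinearI)
  fix x y :: "'a \<Rightarrow>\<^sub>0 Cq" and c
  let ?K = "Poly_Mapping.keys x \<union> Poly_Mapping.keys y"
  have K: "finite ?K" "Poly_Mapping.keys (x + y) \<subseteq> ?K" "Poly_Mapping.keys (c *\<^sub>q x) \<subseteq> ?K"
    by (auto simp: in_keys_iff lookup_add lookup_scaleQ)
  show "lin_ext b (x + y) = lin_ext b x + lin_ext b y"
    using K by (simp add: lin_ext_superset[of ?K] lookup_add scaleQ_add_left sum.distrib)
  show "lin_ext b (c *\<^sub>q x) = c *\<^sub>q lin_ext b x"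
    using K by (simp add: lin_ext_superset[of ?K] lookup_scaleQ qvec.scale_sum_right scaleQ_scaleQ)
qed

lemma lin_ext_single [simp]: "lin_ext b (Poly_Mapping.single w c) = c *\<^sub>q b w"
  by (simp add: lin_ext_superset[of "{w}"])

lemma single_scaleQ: "Poly_Mapping.single w c = c *\<^sub>q Poly_Mapping.single w (1::Cq)"
  by (rule poly_mapping_eqI) (simp add: lookup_scaleQ lookup_single when_def)

lemma poly_mapping_in_span_singles:
  "x \<in> qvec.span ((\<lambda>w. Poly_Mapping.single w (1::Cq)) ` Poly_Mapping.keys x)"
proof -
  have "x = lin_ext (\<lambda>w. Poly_Mapping.single w 1) x"
    by (rule poly_mapping_eqI)
      (simp add: lin_ext_def lookup_sum lookup_scaleQ lookup_single when_def in_keys_iff if_distrib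
        cong: if_cong)
  then show ?thesis
    unfolding lin_ext_def
    by (metis (no_types, lifting) imageI qvec.span_base qvec.span_scale qvec.span_sum)
qed

lemma qlinear_poly_mapping_eqI:
  assumes "qlinear f" "qlinear g" "\<And>w. f (Poly_Mapping.single w 1) = g (Poly_Mapping.single w 1)"
  shows "f x = g (x :: 'a \<Rightarrow>\<^sub>0 Cq)"
  by (rule qlinear_on_span_eqI[OF _ _ _ poly_mapping_in_span_singles])
    (auto simp: assms intro: qlinear_imp_on)


section \<open>Tensor products\<close>

definition bilin_on :: "'v::qvec set \<Rightarrow> 'w::qvec set \<Rightarrow> ('v \<Rightarrow> 'w \<Rightarrow> 'x::qvec) \<Rightarrow> bool" where
  "bilin_on V W b \<longleftrightarrow>
     (\<forall>v\<in>V. qlinear_on W (b v)) \<and> (\<forall>w\<in>W. qlinear_on V (\<lambda>v. b v w))"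

lemma tens_add_left: "(u + v) \<otimes> w = u \<otimes> w + v \<otimes> w"
  unfolding tens.abs_eq plus_tensor.abs_eq tensor.abs_eq_iff tensor_rel_def tensor_null_def
  by (rule qvec.span_base) (force simp: algebra_simps)

lemma tens_add_right: "v \<otimes> (w + z) = v \<otimes> w + v \<otimes> z"
  unfolding tens.abs_eq plus_tensor.abs_eq tensor.abs_eq_iff tensor_rel_def tensor_null_def
  by (rule qvec.span_base) (force simp: algebra_simps)

lemma tens_scale_left: "(c *\<^sub>q v) \<otimes> w = c *\<^sub>q (v \<otimes> w)"
  unfolding tens.abs_eq scaleQ_tensor.abs_eq tensor.abs_eq_iff tensor_rel_def tensor_null_def
  by (rule qvec.span_base) (subst single_scaleQ[symmetric], force)

lemma tens_scale_right: "v \<otimes> (c *\<^sub>q w) = c *\<^sub>q (v \<otimes> w)"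
  unfolding tens.abs_eq scaleQ_tensor.abs_eq tensor.abs_eq_iff tensor_rel_def tensor_null_def
  by (rule qvec.span_base) (subst single_scaleQ[symmetric], force)

lemma qlinear_tens: "qlinear (\<lambda>v. v \<otimes> w)" "qlinear (\<lambda>w. v \<otimes> w)"
  by (auto intro!: qlinearI simp: tens_add_left tens_add_right tens_scale_left tens_scale_right)

lemma tens_zero [simp]: "0 \<otimes> w = 0" "v \<otimes> 0 = 0"
  using qlinearD(3)[OF qlinear_tens(1)] qlinearD(3)[OF qlinear_tens(2)] by metis+

lemma subspace_tensor_of: "qvec.subspace (tensor_of V W)"
  unfolding tensor_of_def by (rule qvec.subspace_span)

lemma tens_in_tensor_of: "v \<in> V \<Longrightarrow> w \<in> W \<Longrightarrow> v \<otimes> w \<in> tensor_of V W"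
  unfolding tensor_of_def by (rule qvec.span_base) blast

lemma tensor_of_eqI:
  assumes "qlinear_on (tensor_of V W) f" "qlinear_on (tensor_of V W) g"
    "\<And>v w. v \<in> V \<Longrightarrow> w \<in> W \<Longrightarrow> f (v \<otimes> w) = g (v \<otimes> w)" "t \<in> tensor_of V W"
  shows "f t = g t"
  by (rule qlinear_on_span_eqI) (use assms in \<open>auto simp: tensor_of_def\<close>)

text \<open>The generators of \<open>tensor_null\<close> are the four instances of bilinearity, and
  the linear extension of a bilinear map kills each of them.\<close>

lemma lin_ext_tensor_null:
  assumes "bilin_on UNIV UNIV b" "x \<in> tensor_null"
  shows "lin_ext (case_prod b) x = 0"
proof -
  have b: "b (u + v) w = b u w + b v w" "b v (w + z) = b v w + b v z"
    "b (c *\<^sub>q v) w = c *\<^sub>q b v w" "b v (c *\<^sub>q w) = c *\<^sub>q b v w" for u v w z c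
    using assms(1) by (simp_all add: bilin_on_def qlinear_on_def)
  note L = qlinear_lin_ext[of "case_prod b"]
  have 0: "qlinear (\<lambda>_. 0)" by (auto intro: qlinearI)
  show ?thesis
    using assms(2)[unfolded tensor_null_def]
    by (rule qlinear_on_span_eqI[OF qlinear_imp_on[OF L] qlinear_imp_on[OF 0], rotated])
      (auto simp: qlinearD[OF L] b scaleQ_one)
qed

text \<open>Guarantees that the choice made in \<open>tensor_lift\<close> has a candidate.\<close>

lemma tensor_of_representative:
  assumes "t \<in> tensor_of V W"
  shows "\<exists>r. Poly_Mapping.keys r \<subseteq> V \<times> W \<and> abs_tensor r = t"
  using assms unfolding tensor_of_def
proof (induction rule: qvec.span_induct_alt)
  case base
  then show ?case by (intro exI[of _ 0]) (simp add: zero_tensor.abs_eq)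
next
  case (step c x y)
  then obtain v w r where x: "x = v \<otimes> w" "v \<in> V" "w \<in> W"
    and r: "Poly_Mapping.keys r \<subseteq> V \<times> W" "abs_tensor r = y" by blast
  let ?r = "c *\<^sub>q Poly_Mapping.single (v, w) 1 + r"
  have "Poly_Mapping.keys ?r \<subseteq> V \<times> W"
    using x r(1) by (auto simp: in_keys_iff lookup_add lookup_scaleQ lookup_single when_def
        split: if_splits)
  moreover have "abs_tensor ?r = c *\<^sub>q x + y"
    using x r by (simp add: tens.abs_eq flip: plus_tensor.abs_eq scaleQ_tensor.abs_eq)
  ultimately show ?case by blast
qed

text \<open>Relations in \<open>tensor_null\<close> may pass through vectors outside
  \<open>V\<close> and \<open>W\<close>, where \<open>b\<close> is not bilinear. Precomposing
  \<open>b\<close> with linear projections onto \<open>V\<close> and \<open>W\<close> gives a map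
  \<open>b'\<close> that is bilinear everywhere and has the same values on representatives supported
  on \<open>V \<times> W\<close>, so the chosen representative does not matter.\<close>

lemma tensor_lift:
  assumes "qvec.subspace V" "qvec.subspace W" "bilin_on V W b"
  shows qlinear_on_tensor_lift: "qlinear_on (tensor_of V W) (tensor_lift V W b)"
    and tensor_lift_tens: "v \<in> V \<Longrightarrow> w \<in> W \<Longrightarrow> tensor_lift V W b (v \<otimes> w) = b v w"
proof -
  have id: "qlinear_on A (\<lambda>x. x)" for A :: "'z::qvec set" by (simp add: qlinear_on_def)
  obtain P where P: "qlinear P" "\<And>v. v \<in> V \<Longrightarrow> P v = v" "range P \<subseteq> V"
    using qlinear_on_extend[OF assms(1) id] by (metis image_ident)
  obtain Q where Q: "qlinear Q" "\<And>v. v \<in> W \<Longrightarrow> Q v = v" "range Q \<subseteq> W"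
    using qlinear_on_extend[OF assms(2) id] by (metis image_ident)
  define b' where "b' v w = b (P v) (Q w)" for v w
  have PQ: "P v \<in> V" "Q w \<in> W" for v w using P(3) Q(3) by auto
  have "bilin_on UNIV UNIV b'"
    using assms(3) PQ unfolding bilin_on_def b'_def qlinear_on_def
    by (simp add: qlinearD[OF P(1)] qlinearD[OF Q(1)])
  note null = lin_ext_tensor_null[OF this]
  let ?T = "lin_ext (case_prod b')"
  have T: "?T r = ?T s" if "abs_tensor r = abs_tensor s" for r s
    using null[of "r - s"] that
    by (simp add: tensor.abs_eq_iff tensor_rel_def qlinearD[OF qlinear_lin_ext])
  have lift: "tensor_lift V W b (abs_tensor r) = ?T r" if "abs_tensor r \<in> tensor_of V W" for r
  proof -
    define s where "s = (SOME s. Poly_Mapping.keys s \<subseteq> V \<times> W \<and> abs_tensor s = abs_tensor r)"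
    have s: "Poly_Mapping.keys s \<subseteq> V \<times> W" "abs_tensor s = abs_tensor r"
      using someI_ex[OF tensor_of_representative[OF that]] unfolding s_def by auto
    have "tensor_lift V W b (abs_tensor r) = ?T s"
      unfolding tensor_lift_def s_def[symmetric] Let_def lin_ext_def
      using s(1) by (intro sum.cong) (auto simp: b'_def P Q)
    then show ?thesis using T[OF s(2)] by simp
  qed
  note sub = subspace_tensor_of[of V W]
  show "qlinear_on (tensor_of V W) (tensor_lift V W b)"
  proof (rule qlinear_onI)
    fix t u assume tu: "t \<in> tensor_of V W" "u \<in> tensor_of V W"
    obtain r s where rs: "t = abs_tensor r" "u = abs_tensor s"
      using tensor_of_representative tu by metis
    have "tensor_lift V W b (t + u) = ?T (r + s)"
      using qvec.subspace_add[OF sub tu] by (simp add: rs plus_tensor.abs_eq lift)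
    then show "tensor_lift V W b (t + u) = tensor_lift V W b t + tensor_lift V W b u"
      using tu by (simp add: rs lift qlinearD[OF qlinear_lin_ext])
  next
    fix c t assume t: "t \<in> tensor_of V W"
    obtain r where r: "t = abs_tensor r"
      using tensor_of_representative t by metis
    have "tensor_lift V W b (c *\<^sub>q t) = ?T (c *\<^sub>q r)"
      using qvec.subspace_scale[OF sub t] by (simp add: r scaleQ_tensor.abs_eq lift)
    then show "tensor_lift V W b (c *\<^sub>q t) = c *\<^sub>q tensor_lift V W b t"
      using t by (simp add: r lift qlinearD[OF qlinear_lin_ext])
  qed
  show "tensor_lift V W b (v \<otimes> w) = b v w" if "v \<in> V" "w \<in> W"
    using tens_in_tensor_of[OF that] that
    by (simp add: tens.abs_eq lift b'_def P Q scaleQ_one)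
qed

text \<open>Expand every first factor over \<open>B\<close>, move the scalars to the second factor
  and collect the terms belonging to the same vector of \<open>B\<close>.\<close>

lemma tensor_of_basis_expansion:
  assumes "t \<in> tensor_of (qvec.span B) W" "qvec.subspace W"
  shows "\<exists>F g. finite F \<and> F \<subseteq> B \<and> (\<forall>b. g b \<in> W) \<and> t = (\<Sum>b\<in>F. b \<otimes> g b)"
  using assms(1) unfolding tensor_of_def
proof (induction rule: qvec.span_induct_alt)
  case base
  then show ?case using qvec.subspace_0[OF assms(2)]
    by (intro exI[of _ "{}"] exI[of _ "\<lambda>_. 0"]) simp
next
  case (step c x y)
  then obtain v w F g where x: "x = v \<otimes> w" "v \<in> qvec.span B" "w \<in> W"
    and g: "finite F" "F \<subseteq> B" "\<And>b. g b \<in> W" "y = (\<Sum>b\<in>F. b \<otimes> g b)" by blast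
  obtain G a where G: "finite G" "G \<subseteq> B" "v = (\<Sum>b\<in>G. a b *\<^sub>q b)"
    using x(2) by (auto simp: qvec.span_explicit)
  define h where "h b = (if b \<in> F then g b else 0) + (if b \<in> G then c *\<^sub>q a b *\<^sub>q w else 0)" for b
  have "c *\<^sub>q x = (\<Sum>b\<in>G. b \<otimes> (c *\<^sub>q a b *\<^sub>q w))"
    unfolding x(1) G(3) qpair.linear_sum[OF qlinear_tens(1)]
    by (simp add: tens_scale_left tens_scale_right qvec.scale_sum_right)
  also have "\<dots> = (\<Sum>b\<in>F \<union> G. b \<otimes> (if b \<in> G then c *\<^sub>q a b *\<^sub>q w else 0))"
    using g(1) G(1) by (intro sum.mono_neutral_cong_left) auto
  finally have cx: "c *\<^sub>q x = \<dots>" .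
  have "y = (\<Sum>b\<in>F \<union> G. b \<otimes> (if b \<in> F then g b else 0))"
    unfolding g(4) using g(1) G(1) by (intro sum.mono_neutral_cong_left) auto
  with cx have "c *\<^sub>q x + y = (\<Sum>b\<in>F \<union> G. b \<otimes> h b)"
    by (simp add: h_def tens_add_right sum.distrib add.commute)
  moreover have "h b \<in> W" for b
    using g(3) x(3) assms(2) unfolding h_def
    by (auto intro!: qvec.subspace_add qvec.subspace_scale qvec.subspace_0)
  ultimately show ?case using g(1,2) G(1,2)
    by (intro exI[of _ "F \<union> G"] exI[of _ h]) auto
qed

lemma sum_apply: "(\<Sum>i\<in>I. f i) x = (\<Sum>i\<in>I. f i x)"
  by (induction I rule: infinite_finite_induct) simp_all

text \<open>Expand \<open>t\<close> over a basis of \<open>V\<close>. If the map \<open>F t\<close>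
  vanishes, then at each point \<open>x\<close> the combination of basis vectors with coefficients
  \<open>g b x\<close> is zero, so all the coefficient functions vanish.\<close>

lemma inj_on_tensor_evaluation:
  assumes "qvec.subspace V" "qvec.subspace A" "qlinear_on (tensor_of V A) F"
    and F: "\<And>v f. v \<in> V \<Longrightarrow> f \<in> A \<Longrightarrow> F (v \<otimes> f) = (\<lambda>x. f x *\<^sub>q v)"
  shows "inj_on F (tensor_of V A)"
proof -
  have 0: "t = 0" if t: "t \<in> tensor_of V A" "F t = 0" for t
  proof -
    obtain B where B: "B \<subseteq> V" "qvec.independent B" "V \<subseteq> qvec.span B"
      using qvec.maximal_independent_subset by metis
    have sp: "V = qvec.span B"
      using B assms(1) by (simp add: qvec.span_minimal subset_antisym)
    obtain K g where K: "finite K" "K \<subseteq> B" "\<And>b. g b \<in> A" "t = (\<Sum>b\<in>K. b \<otimes> g b)"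
      using tensor_of_basis_expansion[of t B A] t assms(2) sp by blast
    have "F t = (\<Sum>b\<in>K. F (b \<otimes> g b))"
      unfolding K(4) using K(2,3) B(1)
      by (intro qlinear_on_sum[OF assms(3) subspace_tensor_of] tens_in_tensor_of) auto
    also have "\<dots> = (\<Sum>b\<in>K. (\<lambda>x. g b x *\<^sub>q b))"
      using K(2,3) B(1) F by (intro sum.cong) auto
    finally have "(\<Sum>b\<in>K. g b x *\<^sub>q b) = 0" for x
      using t(2) by (metis (no_types, lifting) sum.cong sum_apply zero_fun_apply)
    then have "g b x = 0" if "b \<in> K" for b x
      using qvec.independentD[OF B(2) K(1,2), of "\<lambda>b. g b x"] that by blast
    then have "g b = 0" if "b \<in> K" for b using that by auto
    then show "t = 0" using K(4) by simp
  qed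
  show ?thesis
  proof (rule inj_onI)
    fix s t assume st: "s \<in> tensor_of V A" "t \<in> tensor_of V A" "F s = F t"
    have "F (s - t) = 0"
      using st by (simp add: qlinear_on_diff[OF assms(3) subspace_tensor_of])
    then have "s - t = 0"
      by (intro 0 qvec.subspace_diff[OF subspace_tensor_of] st)
    then show "s = t" by simp
  qed
qed


section \<open>Gradings by \<open>\<int>\<^sub>2\<close>\<close>

definition graded :: "(bit \<Rightarrow> 'a::qvec set) \<Rightarrow> bool" where
  "graded G \<longleftrightarrow> (\<forall>p. qvec.subspace (G p)) \<and> G 0 \<inter> G 1 = {0}"

definition gsum :: "(bit \<Rightarrow> 'a::qvec set) \<Rightarrow> 'a set" where
  "gsum G = {u + v | u v. u \<in> G 0 \<and> v \<in> G 1}"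

lemma scarrier_eq_gsum: "scarrier M = gsum (part M)"
  by (simp add: scarrier_def gsum_def)

context
  fixes G :: "bit \<Rightarrow> 'a::qvec set"
  assumes G: "graded G"
begin

lemma graded_subspace: "qvec.subspace (G p)"
  using G by (simp add: graded_def)

lemma graded_disjoint: "u \<in> G p \<Longrightarrow> u \<in> G (p + 1) \<Longrightarrow> u = 0"
  using G by (cases p) (auto simp: graded_def)

lemma graded_in_gsum: "u \<in> G p \<Longrightarrow> u \<in> gsum G"
  using qvec.subspace_0[OF graded_subspace]
  by (cases p) (force simp: gsum_def)+

lemma subspace_gsum: "qvec.subspace (gsum G)"
proof -
  show ?thesis
    unfolding gsum_def by (rule qvec.subspace_sums[OF graded_subspace graded_subspace])
qed

text \<open>Two candidates for the component differ by an element of both parts, which is zero; so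
  the definite description in \<open>hcomp\<close> is met.\<close>

lemma hcompI: "u \<in> G p \<Longrightarrow> v - u \<in> G (p + 1) \<Longrightarrow> hcomp G p v = u"
  unfolding hcomp_def
proof (rule the_equality)
  fix w assume u: "u \<in> G p" "v - u \<in> G (p + 1)" and w: "w \<in> G p \<and> v - w \<in> G (p + 1)"
  have "w - u \<in> G p" using u w by (intro qvec.subspace_diff[OF graded_subspace]) auto
  moreover have "(v - u) - (v - w) \<in> G (p + 1)"
    using u w by (metis qvec.subspace_diff[OF graded_subspace])
  ultimately have "w - u = 0" by (intro graded_disjoint[of _ p]) auto
  then show "w = u" by simp
qed auto

lemma hcomp_add_distinct: "u \<in> G p \<Longrightarrow> w \<in> G (p + 1) \<Longrightarrow> hcomp G p (u + w) = u"
  by (rule hcompI) auto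

lemma hcomp_same [simp]: "u \<in> G p \<Longrightarrow> hcomp G p u = u"
  by (rule hcompI) (auto simp: qvec.subspace_0[OF graded_subspace])

lemma hcomp_other: "u \<in> G p \<Longrightarrow> r \<noteq> p \<Longrightarrow> hcomp G r u = 0"
  by (cases p; cases r)
    (auto intro!: hcompI simp: qvec.subspace_0[OF graded_subspace])

lemma hcomp_in_diff:
  assumes "v \<in> gsum G" shows "hcomp G p v \<in> G p \<and> v - hcomp G p v \<in> G (p + 1)"
proof -
  obtain u w where "u \<in> G p" "w \<in> G (p + 1)" "v = u + w"
    using assms by (cases p) (auto simp: gsum_def add.commute)
  then show ?thesis by (simp add: hcomp_add_distinct)
qed

lemma hcomp_in: "v \<in> gsum G \<Longrightarrow> hcomp G p v \<in> G p"
  using hcomp_in_diff by blast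

lemma hcomp_sum: assumes "v \<in> gsum G" shows "hcomp G 0 v + hcomp G 1 v = v"
proof -
  have "hcomp G 1 v = v - hcomp G 0 v"
    using hcomp_in_diff[OF assms, of 0] by (intro hcompI) (simp_all add: hcomp_in_diff)
  then show ?thesis by simp
qed

lemma qlinear_on_hcomp: "qlinear_on (gsum G) (hcomp G p)"
proof (rule qlinear_onI)
  fix u v assume uv: "u \<in> gsum G" "v \<in> gsum G"
  have "(u - hcomp G p u) + (v - hcomp G p v) \<in> G (p + 1)"
    using uv hcomp_in_diff by (intro qvec.subspace_add[OF graded_subspace]) auto
  then show "hcomp G p (u + v) = hcomp G p u + hcomp G p v"
    using uv by (intro hcompI qvec.subspace_add[OF graded_subspace] hcomp_in)
      (simp_all add: algebra_simps)
next
  fix c v assume v: "v \<in> gsum G"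
  have "c *\<^sub>q (v - hcomp G p v) \<in> G (p + 1)"
    using v hcomp_in_diff by (intro qvec.subspace_scale[OF graded_subspace]) auto
  then show "hcomp G p (c *\<^sub>q v) = c *\<^sub>q hcomp G p v"
    using v by (intro hcompI qvec.subspace_scale[OF graded_subspace] hcomp_in)
      (simp_all add: qvec.scale_right_diff_distrib)
qed

lemma hcomp_hcomp: "v \<in> gsum G \<Longrightarrow> hcomp G p (hcomp G r v) = (if p = r then hcomp G p v else 0)"
  by (simp add: hcomp_in hcomp_other[OF hcomp_in])

end

lemma gsum_mono: "(\<And>p. G p \<subseteq> H p) \<Longrightarrow> gsum G \<subseteq> gsum H"
  unfolding gsum_def by blast

section \<open>The quantum superalgebra\<close>

lemma abs_uq_surj: "\<exists>u. x = abs_uq u"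
  by (induction x rule: uq.abs_induct) blast

lemma uq_scale_mult:
  fixes x y :: "('m::finite, 'n::finite) uq"
  shows "(c *\<^sub>q x) * y = c *\<^sub>q (x * y)" "x * (c *\<^sub>q y) = c *\<^sub>q (x * y)"
proof -
  obtain u v where uv: "x = abs_uq u" "y = abs_uq v"
    using abs_uq_surj by blast
  show "(c *\<^sub>q x) * y = c *\<^sub>q (x * y)"
    unfolding uv times_uq.abs_eq scaleQ_uq.abs_eq by (simp only: free_scale_left mult.assoc)
  show "x * (c *\<^sub>q y) = c *\<^sub>q (x * y)"
    unfolding uv times_uq.abs_eq scaleQ_uq.abs_eq by (simp only: free_scale_right mult.assoc)
qed

lemma free_scale_mult:
  fixes x y :: "'g fword \<Rightarrow>\<^sub>0 Cq"
  shows "(c *\<^sub>q x) * y = c *\<^sub>q (x * y)" "x * (c *\<^sub>q y) = c *\<^sub>q (x * y)"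
  by (simp_all only: free_scale_left mult.assoc) (simp only: free_scale_left[symmetric] free_scale_right mult.assoc)

lemma qlinear_free_mult:
  fixes x :: "'g fword \<Rightarrow>\<^sub>0 Cq"
  shows "qlinear (\<lambda>y. x * y)" "qlinear (\<lambda>y. y * x)"
  by (auto intro!: qlinearI simp: algebra_simps free_scale_mult)

lemma qlinear_abs_uq: "qlinear abs_uq"
  by (rule qlinearI) (simp_all only: plus_uq.abs_eq scaleQ_uq.abs_eq)

lemma abs_uq_simps:
  "abs_uq (x + y) = abs_uq x + abs_uq y" "abs_uq (x - y) = abs_uq x - abs_uq y"
  "abs_uq (- x) = - abs_uq x"
  "abs_uq (c *\<^sub>q x) = c *\<^sub>q abs_uq x" "abs_uq (x * y) = abs_uq x * abs_uq y"
  "abs_uq 1 = 1" "abs_uq 0 = 0" "abs_uq (free_letter l) = uq_gen l"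
  by (simp_all only: qlinearD[OF qlinear_abs_uq] times_uq.abs_eq one_uq.abs_eq uq_gen.abs_eq)

lemma abs_uq_eq_0_iff: "abs_uq x = 0 \<longleftrightarrow> x \<in> uq_ideal"
  by (simp add: zero_uq.abs_eq uq.abs_eq_iff uq_eq_def)

lemma abs_uq_rel: "r \<in> uq_rel \<Longrightarrow> abs_uq r = 0"
proof -
  assume "r \<in> uq_rel"
  then have "1 * r * 1 \<in> {u * r * v | u r v. r \<in> uq_rel}" by blast
  then show ?thesis by (simp add: abs_uq_eq_0_iff uq_ideal_def qvec.span_base)
qed

text \<open>The ideal is spanned by products with arbitrary outer factors; by linearity in each of
  them it is enough to look at words.\<close>

lemma uq_ideal_induct:
  assumes "qlinear T"
    and "\<And>u r v. r \<in> uq_rel \<Longrightarrow> T (Poly_Mapping.single u 1 * r * Poly_Mapping.single v 1) = 0"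
    and "x \<in> uq_ideal"
  shows "T x = 0"
proof -
  have 0: "qlinear (\<lambda>_. 0)" by (auto intro: qlinearI)
  have "T (u * r * v) = 0" if "r \<in> uq_rel" for u r v
  proof -
    have *: "T (Poly_Mapping.single w 1 * r * v) = 0" for w
      by (rule qlinear_poly_mapping_eqI[OF _ 0, of "\<lambda>v. T (Poly_Mapping.single w 1 * r * v)"])
        (use assms(2)[OF that] in \<open>auto intro!: qlinearI simp: qlinearD[OF assms(1)]
          distrib_left free_scale_mult\<close>)
    show ?thesis
      by (rule qlinear_poly_mapping_eqI[OF _ 0, of "\<lambda>u. T (u * r * v)"])
        (use * in \<open>auto intro!: qlinearI simp: qlinearD[OF assms(1)] distrib_right free_scale_mult\<close>)
  qed
  then show ?thesis
    by (intro qlinear_on_span_eqI[OF qlinear_imp_on[OF assms(1)] qlinear_imp_on[OF 0] _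
          assms(3)[unfolded uq_ideal_def]]) blast
qed

text \<open>Choosing a representative allows the map \<open>T\<close> to be a parameter;
  independence of the choice is proved once, for all \<open>T\<close> that kill the ideal.\<close>

definition uq_lift :: "(('m::finite, 'n::finite) free \<Rightarrow> 'a) \<Rightarrow> ('m, 'n) uq \<Rightarrow> 'a" where
  "uq_lift T x = T (SOME r. abs_uq r = x)"

lemma uq_lift:
  assumes "qlinear T"
    and "\<And>u r v. r \<in> uq_rel \<Longrightarrow> T (Poly_Mapping.single u 1 * r * Poly_Mapping.single v 1) = 0"
  shows uq_lift_abs: "uq_lift T (abs_uq x) = T x" and qlinear_uq_lift: "qlinear (uq_lift T)"
proof -
  have *: "uq_lift T (abs_uq x) = T x" for x
  proof -
    define r where "r = (SOME r. abs_uq r = abs_uq x)"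
    have "abs_uq r = abs_uq x" unfolding r_def by (rule someI) simp
    then have "r - x \<in> uq_ideal" by (simp add: abs_uq_simps flip: abs_uq_eq_0_iff)
    then have "T (r - x) = 0" using uq_ideal_induct[OF assms(1)] assms(2) by blast
    then show ?thesis by (simp add: uq_lift_def r_def qlinearD[OF assms(1)])
  qed
  then show "uq_lift T (abs_uq x) = T x" .
  show "qlinear (uq_lift T)"
  proof (rule qlinearI)
    fix x y :: "('a, 'b) uq" and c
    obtain u v where uv: "x = abs_uq u" "y = abs_uq v"
      using abs_uq_surj by blast
    show "uq_lift T (x + y) = uq_lift T x + uq_lift T y"
      unfolding uv by (simp add: * qlinearD[OF assms(1)] flip: abs_uq_simps)
    show "uq_lift T (c *\<^sub>q x) = c *\<^sub>q uq_lift T x"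
      unfolding uv by (simp add: * qlinearD[OF assms(1)] flip: abs_uq_simps)
  qed
qed

section \<open>Parity on the free algebra and on its quotient\<close>

lemma word_parity_simps [simp]:
  "word_parity 0 = 0" "word_parity (u + v) = word_parity u + word_parity v"
  by (simp_all add: word_parity_def zero_fword_def plus_fword_def)

definition free_part :: "bit \<Rightarrow> ('m::finite, 'n::finite) free set" where
  "free_part p = qvec.span {Poly_Mapping.single w 1 | w. word_parity w = p}"

lemma subspace_free_part: "qvec.subspace (free_part p)"
  unfolding free_part_def by (rule qvec.subspace_span)

lemma uq_part_eq: "uq_part p = abs_uq ` free_part p"
  unfolding uq_part_def free_part_def qpair.linear_span_image[OF qlinear_abs_uq, symmetric]
  by (rule arg_cong[of _ _ qvec.span]) auto

lemma free_part_induct: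
  assumes "x \<in> free_part p" "qlinear f" "qlinear g"
    and "\<And>w. word_parity w = p \<Longrightarrow> f (Poly_Mapping.single w 1) = g (Poly_Mapping.single w 1)"
  shows "f x = g x"
  by (rule qlinear_on_span_eqI[OF _ _ _ assms(1)[unfolded free_part_def]])
    (use assms in \<open>auto intro: qlinear_imp_on\<close>)

lemma single_in_free_part: "word_parity w = p \<Longrightarrow> Poly_Mapping.single w 1 \<in> free_part p"
  unfolding free_part_def by (rule qvec.span_base) blast

lemma free_part_mult:
  assumes "x \<in> free_part p" "y \<in> free_part r" "s = p + r"
  shows "x * y \<in> free_part s"
proof -
  have *: "x * Poly_Mapping.single w 1 \<in> free_part (p + r)" if w: "word_parity w = r" for w
    by (rule qlinear_on_image_span_subset[OF qlinear_imp_on[OF qlinear_free_mult(2)] _ _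
          assms(1)[unfolded free_part_def]])
      (auto simp only: mult_single subspace_free_part mult_1 word_parity_simps w
        intro!: single_in_free_part)
  show ?thesis unfolding assms(3)
    by (rule qlinear_on_image_span_subset[OF qlinear_imp_on[OF qlinear_free_mult(1)] _ _
          assms(2)[unfolded free_part_def]])
      (use * in \<open>auto simp only: subspace_free_part\<close>)
qed

lemma uq_part_mult: "x \<in> uq_part p \<Longrightarrow> y \<in> uq_part r \<Longrightarrow> x * y \<in> uq_part (p + r)"
  unfolding uq_part_eq using free_part_mult by (fastforce simp flip: abs_uq_simps)

lemma subspace_uq_part: "qvec.subspace (uq_part p)"
  unfolding uq_part_def by (rule qvec.subspace_span)

lemma word_parity_letter:
  "valid_letter CARD('m) CARD('n) l \<Longrightarrow>
    word_parity (FWord [Abs_gen l :: ('m::finite, 'n::finite) gen]) = letter_parity CARD('m) l"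
  by (simp add: word_parity_def Abs_gen_inverse)

text \<open>The parity automorphism x -> (-1)^[x] x. It is multiplicative and its eigenspaces are
  the homogeneous parts, so parity statements become equations.\<close>

definition free_twist :: "('m::finite, 'n::finite) free \<Rightarrow> ('m, 'n) free" where
  "free_twist = lin_ext (\<lambda>w. sg (word_parity w) *\<^sub>q Poly_Mapping.single w 1)"

lemma qlinear_free_twist: "qlinear free_twist"
  unfolding free_twist_def by (rule qlinear_lin_ext)

lemma free_twist_single: "free_twist (Poly_Mapping.single w 1) = sg (word_parity w) *\<^sub>q Poly_Mapping.single w 1"
  by (simp add: free_twist_def scaleQ_one)

lemma free_twist_mult: "free_twist (x * y) = free_twist x * free_twist y"
proof -
  note L = qlinearD[OF qlinear_free_twist]
  have *: "free_twist (Poly_Mapping.single u 1 * y) = free_twist (Poly_Mapping.single u 1) * free_twist y" for u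
    by (rule qlinear_poly_mapping_eqI[of "\<lambda>y. free_twist (Poly_Mapping.single u 1 * y)"])
      (auto intro!: qlinearI simp: L distrib_left free_scale_mult mult_single free_twist_single
        sg_add scaleQ_scaleQ scaleQ_add_right mult.commute)
  show ?thesis
    by (rule qlinear_poly_mapping_eqI[of "\<lambda>x. free_twist (x * y)"])
      (auto intro!: qlinearI simp: L distrib_right free_scale_mult *)
qed

lemma free_twist_letter:
  "valid_letter CARD('m) CARD('n) l \<Longrightarrow>
    free_twist (free_letter l :: ('m::finite, 'n::finite) free)
      = sg (letter_parity CARD('m) l) *\<^sub>q free_letter l"
  by (simp add: free_letter_def free_twist_single word_parity_letter)

lemma free_twist_1: "free_twist 1 = 1"
  by (simp add: free_twist_single scaleQ_one flip: single_one)

lemmas free_twist_simps = qlinearD[OF qlinear_free_twist] free_twist_mult free_twist_1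

lemma half_sum_eq: "inverse 2 *\<^sub>q (x + x) = (x :: 'a::qvec)" "(1 / 2) *\<^sub>q (x + x) = x"
proof -
  have "inverse 2 + inverse 2 = 2 * inverse (2 :: Cq)"
    by (rule mult_2[symmetric])
  also have "\<dots> = 1" by (rule right_inverse) simp
  finally have "(inverse 2 + inverse 2) *\<^sub>q x = x" by (simp only: scaleQ_one)
  then show "inverse 2 *\<^sub>q (x + x) = x" by (simp only: scaleQ_add_left scaleQ_add_right)
  then show "(1 / 2) *\<^sub>q (x + x) = x" by (simp only: inverse_eq_divide)
qed

lemma free_part_iff: "x \<in> free_part p \<longleftrightarrow> free_twist x = sg p *\<^sub>q x"
proof
  assume x: "x \<in> free_part p"
  show "free_twist x = sg p *\<^sub>q x"
    by (rule free_part_induct[OF x qlinear_free_twist])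
      (auto intro!: qlinearI simp: scaleQ_add_right scaleQ_scaleQ mult.commute free_twist_single)
next
  assume tw: "free_twist x = sg p *\<^sub>q x"
  \<comment> \<open>The projection onto the eigenspace for \<open>sg p\<close>: it fixes the words
    of parity \<open>p\<close>, kills the other words, and fixes \<open>x\<close> by
    assumption.\<close>
  let ?f = "\<lambda>x. inverse 2 *\<^sub>q (x + sg p *\<^sub>q free_twist x)"
  have "?f x \<in> free_part p"
  proof (rule qlinear_on_image_span_subset[where f = ?f, OF qlinear_imp_on _ subspace_free_part
        poly_mapping_in_span_singles])
    show "qlinear ?f"
      by (auto intro!: qlinearI simp: scaleQ_add_right scaleQ_scaleQ algebra_simps free_twist_simps)
    show "?f s \<in> free_part p"
      if s0: "s \<in> (\<lambda>w. Poly_Mapping.single w 1) ` Poly_Mapping.keys x" for s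
    proof -
      obtain w where s: "s = Poly_Mapping.single w 1" using s0 by blast
      show ?thesis
      proof (cases "word_parity w = p")
        case True
        then show ?thesis
          by (simp add: s free_twist_single half_sum_eq single_in_free_part)
      next
        case False
        then have "sg p * sg (word_parity w) = - 1"
          by (cases p; cases "word_parity w"; simp)
        then have "?f s = 0" by (simp add: s free_twist_single scaleQ_scaleQ scaleQ_one)
        then show ?thesis by (simp only: qvec.subspace_0[OF subspace_free_part])
      qed
    qed
  qed
  then show "x \<in> free_part p" by (simp add: tw half_sum_eq)
qed

text \<open>This is what lets parity descend to the quotient. In each case the exponent is the
  parity of one monomial; letters that occur twice, as in the Serre relations, contribute nothing to
  it.\<close>

lemma uq_rel_homogeneous:
  assumes "(r :: ('m::finite, 'n::finite) free) \<in> uq_rel"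
  shows "\<exists>p. r \<in> free_part p"
proof -
  have c: "CARD('m) \<ge> 1" "CARD('n) \<ge> 1" by (simp_all add: Suc_le_eq)
  then have c': "Suc 0 \<le> CARD('m)" "CARD('m) \<le> CARD('m) + CARD('n) - Suc 0"
    by linarith+
  have KK: "x \<in> {kp a, km a} \<Longrightarrow> a \<in> {1..CARD('m) + CARD('n)} \<Longrightarrow>
     free_twist x = (x :: ('m, 'n) free)" for x a
    by (auto simp: free_twist_letter scaleQ_one)
  let ?l = "letter_parity CARD('m)"
  note [simp] = free_twist_simps free_twist_letter scaleQ_one free_scale_mult
    qvec.scale_right_diff_distrib scaleQ_add_right scaleQ_scaleQ
  from assms have "\<exists>p. free_twist r = sg p *\<^sub>q r"
  proof cases
    case (K_inv b)
    then show ?thesis by (intro exI[of _ 0]) simp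
  next
    case (K_comm a b x y)
    then show ?thesis using KK[of x a] KK[of y b]
      by (intro exI[of _ 0]) simp
  next
    case (K_up a b)
    then show ?thesis by (intro exI[of _ "?l (Up b)"]) (simp add: mult.commute)
  next
    case (K_down a b)
    then show ?thesis by (intro exI[of _ "?l (Up b)"]) (simp add: mult.commute)
  next
    case (up_down a b)
    \<comment> \<open>The right-hand side of the relation contains K with index
      \<open>a + 1\<close>, which has to be a valid index.\<close>
    then have "a \<le> CARD('m) + CARD('n) - 1" by simp
    with c have "Suc a \<le> CARD('m) + CARD('n)" by linarith
    with up_down show ?thesis
      by (intro exI[of _ "?l (Up a) + ?l (Up b)"]) simp
  next
    case up_odd
    then show ?thesis using c' by (intro exI[of _ 0]) simp
  next
    case down_odd
    then show ?thesis using c' by (intro exI[of _ 0]) simp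
  next
    case (up_comm a b)
    then show ?thesis by (intro exI[of _ "?l (Up a) + ?l (Up b)"]) simp
  next
    case (down_comm a b)
    then show ?thesis by (intro exI[of _ "?l (Up a) + ?l (Up b)"]) simp
  next
    case (serre_up a b)
    then show ?thesis unfolding serre_def
      by (intro exI[of _ "?l (Up b)"]) (simp add: mult.commute)
  next
    case (serre_down a b)
    then show ?thesis unfolding serre_def
      by (intro exI[of _ "?l (Up b)"]) (simp add: mult.commute)
  next
    case serre_odd_up
    then obtain k j where "CARD('m) = Suc (Suc k)" "CARD('n) = Suc (Suc j)"
      by (metis add_2_eq_Suc le_Suc_ex)
    then show ?thesis unfolding serre_odd_up(1)
      by (intro exI[of _ 0]) (simp add: numeral_2_eq_2 Let_def algebra_simps)
  next
    case serre_odd_down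
    then obtain k j where "CARD('m) = Suc (Suc k)" "CARD('n) = Suc (Suc j)"
      by (metis add_2_eq_Suc le_Suc_ex)
    then show ?thesis unfolding serre_odd_down(1)
      by (intro exI[of _ 0]) (simp add: numeral_2_eq_2 Let_def algebra_simps)
  qed
  then show ?thesis by (simp only: free_part_iff)
qed

definition uq_twist :: "('m::finite, 'n::finite) uq \<Rightarrow> ('m, 'n) uq" where
  "uq_twist = uq_lift (\<lambda>x. abs_uq (free_twist x))"

lemma qlinear_abs_free_twist: "qlinear (\<lambda>x. abs_uq (free_twist x))"
  by (auto intro!: qlinearI simp: abs_uq_simps free_twist_simps)

lemma abs_free_twist_rel:
  assumes "r \<in> uq_rel" shows "abs_uq (free_twist (u * r * v)) = 0"
proof -
  obtain p where "r \<in> free_part p" using uq_rel_homogeneous[OF assms] by blast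
  then show ?thesis
    by (simp add: free_part_iff free_twist_simps abs_uq_simps abs_uq_rel[OF assms])
qed

lemma uq_twist_abs: "uq_twist (abs_uq x) = abs_uq (free_twist x)"
  unfolding uq_twist_def
  by (rule uq_lift_abs[OF qlinear_abs_free_twist abs_free_twist_rel])

lemma qlinear_uq_twist: "qlinear uq_twist"
  unfolding uq_twist_def
  by (rule qlinear_uq_lift[OF qlinear_abs_free_twist abs_free_twist_rel])

lemma uq_twist_mult: "uq_twist (x * y) = uq_twist x * uq_twist y"
proof -
  obtain u v where uv: "x = abs_uq u" "y = abs_uq v"
    using abs_uq_surj by blast
  show ?thesis unfolding uv
    by (simp only: uq_twist_abs free_twist_mult flip: abs_uq_simps(5))
qed

lemma uq_twist_1: "uq_twist 1 = 1"
  by (metis abs_uq_simps(6) free_twist_1 uq_twist_abs)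

lemma uq_twist_gen:
  "valid_letter CARD('m) CARD('n) l \<Longrightarrow>
    uq_twist (uq_gen l :: ('m::finite, 'n::finite) uq) = sg (letter_parity CARD('m) l) *\<^sub>q uq_gen l"
  by (metis abs_uq_simps(4,8) free_twist_letter uq_twist_abs)

lemmas uq_twist_simps = qlinearD[OF qlinear_uq_twist] uq_twist_mult uq_twist_1

lemma free_twist_twist: "free_twist (free_twist x) = x"
  by (rule qlinear_poly_mapping_eqI)
    (auto intro!: qlinearI simp: free_twist_simps free_twist_single)

lemma uq_twist_twist: "uq_twist (uq_twist x) = x"
  using abs_uq_surj[of x] by (auto simp: uq_twist_abs free_twist_twist)

text \<open>The nontrivial direction lifts an eigenvector in the quotient to an eigenvector in the
  free algebra.\<close>

lemma uq_part_iff: "x \<in> uq_part p \<longleftrightarrow> uq_twist x = sg p *\<^sub>q x"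
proof
  assume "x \<in> uq_part p"
  then show "uq_twist x = sg p *\<^sub>q x"
    by (auto simp: uq_part_eq uq_twist_abs free_part_iff abs_uq_simps)
next
  assume tw: "uq_twist x = sg p *\<^sub>q x"
  obtain u where u: "x = abs_uq u" using abs_uq_surj by blast
  \<comment> \<open>The representative \<open>u\<close> need not be homogeneous; its average is, and
    by \<open>tw\<close> it still represents \<open>x\<close>.\<close>
  let ?u = "inverse 2 *\<^sub>q (u + sg p *\<^sub>q free_twist u)"
  have "?u \<in> free_part p"
    by (simp add: free_part_iff free_twist_simps free_twist_twist scaleQ_add_right
        qvec.scale_left_commute[of "sg p" "inverse 2"] add.commute)
  moreover have "abs_uq ?u = x"
    using tw by (simp add: abs_uq_simps u half_sum_eq flip: uq_twist_abs)
  ultimately show "x \<in> uq_part p" by (auto simp: uq_part_eq)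
qed

text \<open>Directness is not visible from the two spans. An element of both parts is fixed and
  negated by \<open>uq_twist\<close>, hence twice it is zero.\<close>

lemma graded_uq_part: "graded uq_part"
proof -
  have "x = 0" if "x \<in> uq_part 0" "x \<in> uq_part 1" for x :: "('m::finite, 'n::finite) uq"
  proof -
    have "x + x = 0"
      using that by (simp add: uq_part_iff eq_neg_iff_add_eq_0 scaleQ_one)
    then show ?thesis using half_sum_eq[of x] by simp
  qed
  then show ?thesis
    by (auto simp: graded_def subspace_uq_part qvec.subspace_0)
qed

lemma gsum_uq_part: "gsum uq_part = UNIV"
proof -
  have "x \<in> gsum uq_part" for x :: "('m::finite, 'n::finite) uq"
  proof -
    have *: "inverse 2 *\<^sub>q (x + sg p *\<^sub>q uq_twist x) \<in> uq_part p" for p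
      by (simp add: uq_part_iff uq_twist_simps uq_twist_twist scaleQ_add_right
          qvec.scale_left_commute[of "sg p" "inverse 2"] add.commute)
    have "x = inverse 2 *\<^sub>q (x + sg 0 *\<^sub>q uq_twist x) + inverse 2 *\<^sub>q (x + sg 1 *\<^sub>q uq_twist x)"
      by (simp add: scaleQ_one half_sum_eq flip: scaleQ_add_right)
    then show ?thesis unfolding gsum_def using * by blast
  qed
  then show ?thesis by blast
qed

section \<open>The antipode\<close>

abbreviation (input) "uE a \<equiv> uq_gen (Up a)"
abbreviation (input) "uF a \<equiv> uq_gen (Down a)"
abbreviation (input) "uK a \<equiv> uq_gen (Kp a)"
abbreviation (input) "uL a \<equiv> uq_gen (Km a)"

lemma qq_neq_0 [simp]: "qq \<noteq> 0"
  by transfer (simp add: Zero_fract_def eq_fract)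

lemma uq_KK_commute:
  assumes "x \<in> {uK a, uL a}" "y \<in> {uK b, uL b}"
    "a \<in> {1..CARD('m) + CARD('n)}" "b \<in> {1..CARD('m) + CARD('n)}"
  shows "x * y = y * (x :: ('m::finite, 'n::finite) uq)"
proof -
  have "\<exists>u v. u \<in> {kp a, km a} \<and> v \<in> {kp b, km b} \<and> x = abs_uq u \<and> y = abs_uq v"
    using assms(1,2) by (auto simp flip: abs_uq_simps)
  then obtain u v where "u \<in> {kp a, km a}" "v \<in> {kp b, km b}" "x = abs_uq u" "y = abs_uq v"
    by blast
  then show ?thesis
    using abs_uq_rel[OF uq_rel.K_comm[OF assms(3,4)]] by (simp add: abs_uq_simps)
qed

lemma uq_KL:
  assumes "b \<in> {1..CARD('m) + CARD('n)}"
  shows "uK b * uL b = (1 :: ('m::finite, 'n::finite) uq)"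
    "uL b * uK b = (1 :: ('m::finite, 'n::finite) uq)"
proof -
  show 1: "uK b * uL b = (1 :: ('m::finite, 'n::finite) uq)"
    using abs_uq_rel[OF uq_rel.K_inv[OF assms]] by (simp add: abs_uq_simps)
  show "uL b * uK b = (1 :: ('m::finite, 'n::finite) uq)"
    using uq_KK_commute[OF _ _ assms assms, of "uL b" "uK b"] 1 by simp
qed

text \<open>Rewrites the conjugation relations of the presentation as commutation up to a scalar,
  for \<open>k\<close> and for its inverse.\<close>

lemma conj_scalar_imp_commute:
  fixes k l x :: "('m::finite, 'n::finite) uq"
  assumes "k * l = 1" "l * k = 1" "k * x * l = c *\<^sub>q x" "c \<noteq> 0"
  shows "k * x = c *\<^sub>q (x * k)" "l * x = inverse c *\<^sub>q (x * l)"
proof -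
  have "k * x * l * k = k * x * (l * k)" by (simp only: mult.assoc)
  then have *: "k * x = k * x * l * k" by (simp add: assms(2))
  then show 1: "k * x = c *\<^sub>q (x * k)" unfolding assms(3) by (simp add: uq_scale_mult)
  have "l * x = inverse c *\<^sub>q (l * (c *\<^sub>q (x * k)) * l)"
    using assms by (simp add: uq_scale_mult scaleQ_scaleQ scaleQ_one mult.assoc)
  also have "\<dots> = inverse c *\<^sub>q (l * k * x * l)" by (simp add: mult.assoc flip: 1)
  finally show "l * x = inverse c *\<^sub>q (x * l)" by (simp add: assms)
qed

text \<open>The pairing of \<epsilon>_a with the simple root \<alpha>_b = \<epsilon>_b -
  \<epsilon>_(b+1): the exponent of q when K_a moves past E_(b,b+1).\<close>

definition root_pairing :: "nat \<Rightarrow> nat \<Rightarrow> nat \<Rightarrow> nat \<Rightarrow> int" where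
  "root_pairing m n a b = wform m n (eps a) (eps b - eps (b + 1))"

lemma wform_eps:
  "wform m n (eps a) \<nu> = (if a \<in> {1..m + n} then (if a \<le> m then 1 else - 1) * \<nu> a else 0)"
proof -
  have "wform m n (eps a) \<nu>
      = (\<Sum>b = 1..m + n. if b = a then (if a \<le> m then 1 else - 1) * \<nu> a else 0)"
    unfolding wform_def eps_def by (rule sum.cong) auto
  then show ?thesis by simp
qed

lemma root_pairing_eq:
  "a \<in> {1..m + n} \<Longrightarrow> root_pairing m n a b
    = (if a \<le> m then 1 else - 1) * ((if a = b then 1 else 0) - (if a = b + 1 then 1 else 0))"
  unfolding root_pairing_def wform_eps by (auto simp: eps_def)

lemma root_pairing_uminus:
  "a \<in> {1..m + n} \<Longrightarrow> wform m n (eps a) (eps (b + 1) - eps b) = - root_pairing m n a b"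
  unfolding root_pairing_def wform_eps by (auto simp: eps_def)

lemma
  assumes "a \<in> {1..CARD('m) + CARD('n)}" "b \<in> {1..CARD('m) + CARD('n) - 1}"
  defines "c \<equiv> power_int qq (root_pairing CARD('m) CARD('n) a b)"
  shows uq_K_up: "uK a * uE b = c *\<^sub>q (uE b * uK a :: ('m::finite, 'n::finite) uq)"
      "uL a * uE b = inverse c *\<^sub>q (uE b * uL a :: ('m, 'n) uq)"
    and uq_K_down: "uK a * uF b = inverse c *\<^sub>q (uF b * uK a :: ('m, 'n) uq)"
      "uL a * uF b = c *\<^sub>q (uF b * uL a :: ('m, 'n) uq)"
proof -
  have c: "c \<noteq> 0" by (simp add: c_def)
  have "uK a * uE b * uL a = c *\<^sub>q (uE b :: ('m::finite, 'n::finite) uq)"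
    using abs_uq_rel[OF uq_rel.K_up[OF assms(1,2)]]
    by (simp add: abs_uq_simps c_def root_pairing_def)
  from conj_scalar_imp_commute[OF uq_KL[OF assms(1)] this c]
  show "uK a * uE b = c *\<^sub>q (uE b * uK a :: ('m::finite, 'n::finite) uq)"
    "uL a * uE b = inverse c *\<^sub>q (uE b * uL a :: ('m, 'n) uq)" .
  have "uK a * uF b * uL a = inverse c *\<^sub>q (uF b :: ('m::finite, 'n::finite) uq)"
    using abs_uq_rel[OF uq_rel.K_down[OF assms(1,2)]] root_pairing_uminus[OF assms(1), of b]
    by (simp add: abs_uq_simps c_def power_int_minus)
  from conj_scalar_imp_commute[OF uq_KL[OF assms(1)] this] c
  show "uK a * uF b = inverse c *\<^sub>q (uF b * uK a :: ('m::finite, 'n::finite) uq)"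
    "uL a * uF b = c *\<^sub>q (uF b * uL a :: ('m, 'n) uq)" by simp_all
qed

fun antipode_letter :: "letter \<Rightarrow> ('m::finite, 'n::finite) uq" where
  "antipode_letter (Up a) = - (uE a * uL a * uK (a + 1))"
| "antipode_letter (Down a) = - (uK a * uL (a + 1) * uF a)"
| "antipode_letter (Kp b) = uL b"
| "antipode_letter (Km b) = uK b"

text \<open>Signed reversal: an odd first letter picks up one sign for each odd letter of the tail
  across which it moves.\<close>

primrec antipode_word :: "('m::finite, 'n::finite) gen list \<Rightarrow> ('m, 'n) uq" where
  "antipode_word [] = 1"
| "antipode_word (g # gs) = sg (letter_parity CARD('m) (Rep_gen g) * word_parity (FWord gs))
     *\<^sub>q (antipode_word gs * antipode_letter (Rep_gen g))"

definition antipode_free :: "('m::finite, 'n::finite) free \<Rightarrow> ('m, 'n) uq" where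
  "antipode_free = lin_ext (\<lambda>w. antipode_word (letters w))"

lemma antipode_word_append:
  fixes u v :: "('m::finite, 'n::finite) gen list"
  shows "antipode_word (u @ v)
    = sg (word_parity (FWord u) * word_parity (FWord v)) *\<^sub>q (antipode_word v * antipode_word u)"
proof (induction u)
  case Nil
  then show ?case by (simp add: word_parity_def scaleQ_one)
next
  case (Cons g u)
  have "word_parity (FWord (g # u)) = letter_parity CARD('m) (Rep_gen g) + word_parity (FWord u)"
    "word_parity (FWord (u @ v)) = word_parity (FWord u) + word_parity (FWord v)"
    by (simp_all add: word_parity_def)
  then show ?case
    by (simp add: Cons uq_scale_mult scaleQ_scaleQ mult.assoc distrib_left distrib_right sg_add
        mult.commute mult.left_commute)
qed

lemma qlinear_antipode_free: "qlinear antipode_free"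
  unfolding antipode_free_def by (rule qlinear_lin_ext)

lemma antipode_free_single:
  "antipode_free (Poly_Mapping.single w 1) = antipode_word (letters w)"
  by (simp add: antipode_free_def scaleQ_one)

lemma antipode_free_mult:
  assumes "x \<in> free_part p" "y \<in> free_part r"
  shows "antipode_free (x * y) = sg (p * r) *\<^sub>q (antipode_free y * antipode_free x)"
proof -
  note L = qlinearD[OF qlinear_antipode_free]
  have *: "antipode_free (Poly_Mapping.single u 1 * y)
      = sg (p * r) *\<^sub>q (antipode_free y * antipode_free (Poly_Mapping.single u 1))"
    if u: "word_parity u = p" for u
  proof (rule free_part_induct[OF assms(2),
        of "\<lambda>y. antipode_free (Poly_Mapping.single u 1 * y)"])
    fix w :: "('a, 'b) gen fword" assume w: "word_parity w = r"
    have "antipode_word (letters u @ letters w)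
      = sg (word_parity u * word_parity w) *\<^sub>q (antipode_word (letters w) * antipode_word (letters u))"
      by (simp add: antipode_word_append)
    then show "antipode_free (Poly_Mapping.single u 1 * Poly_Mapping.single w 1)
        = sg (p * r) *\<^sub>q (antipode_free (Poly_Mapping.single w 1) * antipode_free (Poly_Mapping.single u 1))"
      by (simp add: mult_single plus_fword_def antipode_free_single u w)
  qed (auto intro!: qlinearI simp: L distrib_left distrib_right free_scale_mult uq_scale_mult
        scaleQ_add_right qvec.scale_left_commute)
  show ?thesis
    by (rule free_part_induct[OF assms(1), of "\<lambda>x. antipode_free (x * y)"])
      (auto intro!: qlinearI simp: L * distrib_left distrib_right free_scale_mult uq_scale_mult
        scaleQ_add_right qvec.scale_left_commute)
qed

text \<open>The abstract form of the computation showing that the antipode preserves the relations among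
  the \<open>E\<^bsub>a,a+1\<^esub>\<close>, and those among the \<open>E\<^bsub>a+1,a\<^esub>\<close>: up to a scalar, it maps the generator \<open>e a\<close> to
  \<open>e a * k a\<close> where the \<open>k a\<close> commute with everything up to scalars.\<close>

lemma
  fixes e k :: "nat \<Rightarrow> ('m::finite, 'n::finite) uq"
  assumes ke: "\<forall>a\<in>I. \<forall>b\<in>I. k a * e b = g a b *\<^sub>q (e b * k a)"
    and g: "\<forall>a\<in>I. \<forall>b\<in>I. g a b = g b a"
    and kk: "\<forall>a\<in>I. \<forall>b\<in>I. k a * k b = k b * k a"
    and X: "\<forall>a\<in>I. X a = c a *\<^sub>q (e a * k a)"
  shows twisted_square: "a \<in> I \<Longrightarrow> e a * e a = 0 \<Longrightarrow> X a * X a = 0"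
    and twisted_commute: "a \<in> I \<Longrightarrow> b \<in> I \<Longrightarrow> e a * e b = e b * e a \<Longrightarrow> X a * X b = X b * X a"
    and twisted_serre: "a \<in> I \<Longrightarrow> b \<in> I \<Longrightarrow>
      e a * e a * e b - Q *\<^sub>q (e a * e b * e a) + e b * e a * e a = 0 \<Longrightarrow>
      X b * X a * X a - Q *\<^sub>q (X a * X b * X a) + X a * X a * X b = 0"
    and twisted_serre_odd: "a \<in> I \<Longrightarrow> b \<in> I \<Longrightarrow> d \<in> I \<Longrightarrow> e b * e b = 0 \<Longrightarrow> e a * e d = e d * e a \<Longrightarrow>
      e a * e b * e d * e b + e d * e b * e a * e b + e b * e a * e b * e d + e b * e d * e b * e a
        = Q *\<^sub>q (e b * e a * e d * e b) \<Longrightarrow>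
      X a * X b * X d * X b + X d * X b * X a * X b + X b * X a * X b * X d + X b * X d * X b * X a
        = Q *\<^sub>q (X b * X a * X d * X b)"
proof -
  note ke = ke[rule_format] and g = g[rule_format] and kk = kk[rule_format] and X = X[rule_format]
  have ke': "k a * (e b * z) = g a b *\<^sub>q (e b * (k a * z))" if "a \<in> I" "b \<in> I" for a b z
  proof -
    have "k a * e b * z = g a b *\<^sub>q (e b * k a * z)" using ke[OF that] by (simp add: uq_scale_mult)
    then show ?thesis by (simp add: mult.assoc)
  qed
  have kk': "k a * (k b * z) = k b * (k a * z)" if "a \<in> I" "b \<in> I" for a b z
    using kk[OF that] by (metis mult.assoc)
  note simps = X ke ke' mult.assoc uq_scale_mult scaleQ_scaleQ
  show "X a * X a = 0" if a: "a \<in> I" "e a * e a = 0"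
  proof -
    have "e a * (e a * z) = 0" for z using a(2) by (metis mult.assoc mult_zero_left)
    then show ?thesis using a(1) by (simp add: simps)
  qed
  show "X a * X b = X b * X a" if a: "a \<in> I" "b \<in> I" "e a * e b = e b * e a"
  proof -
    have "e a * (e b * z) = e b * (e a * z)" for z using a(3) by (metis mult.assoc)
    then show ?thesis using a(1,2) g[OF a(1,2)] kk[OF a(1,2)] by (simp add: simps mult.commute)
  qed
  show "X b * X a * X a - Q *\<^sub>q (X a * X b * X a) + X a * X a * X b = 0"
    if a: "a \<in> I" "b \<in> I" "e a * e a * e b - Q *\<^sub>q (e a * e b * e a) + e b * e a * e a = 0"
  proof -
    have "(e a * e a * e b - Q *\<^sub>q (e a * e b * e a) + e b * e a * e a) * z = 0" for z
      using a(3) by simp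
    \<comment> \<open>With an arbitrary tail \<open>z\<close> the Serre relation becomes a rewrite
      rule for products nested to the right.\<close>
    then have *: "e b * (e a * (e a * z)) = Q *\<^sub>q (e a * (e b * (e a * z))) - e a * (e a * (e b * z))"
      for z
      by (simp add: algebra_simps uq_scale_mult eq_neg_iff_add_eq_0)
    show ?thesis using a(1,2) g[OF a(1,2)] kk[OF a(1,2)] kk'[OF a(1,2)]
      by (simp add: simps * qvec.scale_right_diff_distrib mult_ac)
  qed
  show "X a * X b * X d * X b + X d * X b * X a * X b + X b * X a * X b * X d + X b * X d * X b * X a
        = Q *\<^sub>q (X b * X a * X d * X b)"
    if a: "a \<in> I" "b \<in> I" "d \<in> I" "e b * e b = 0" "e a * e d = e d * e a"
     "e a * e b * e d * e b + e d * e b * e a * e b + e b * e a * e b * e d + e b * e d * e b * e a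
        = Q *\<^sub>q (e b * e a * e d * e b)"
  proof -
    define kz where "kz = k a * (k b * (k b * k d))"
    \<comment> \<open>Each of the five words uses \<open>a\<close> and \<open>d\<close> once and
      \<open>b\<close> twice. Moving all factors \<open>k\<close> to the right costs one
      \<open>g\<close> for each of the six pairs of positions; as \<open>g\<close> is symmetric, the
      product is the same for every order of the letters.\<close>
    define t where "t = c a * c b * c b * c d * g a b * g a b * g b d * g b d * g b b * g a d"
    note s = simps t_def kz_def g[OF a(2,1)] g[OF a(3,1)] g[OF a(3,2)]
      kk[OF a(2,1)] kk[OF a(3,1)] kk[OF a(3,2)] kk'[OF a(2,1)] kk'[OF a(3,1)] kk'[OF a(3,2)]
    have X4:
      "X a * X b * X d * X b = t *\<^sub>q (e a * e b * e d * e b * kz)"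
      "X d * X b * X a * X b = t *\<^sub>q (e d * e b * e a * e b * kz)"
      "X b * X a * X b * X d = t *\<^sub>q (e b * e a * e b * e d * kz)"
      "X b * X d * X b * X a = t *\<^sub>q (e b * e d * e b * e a * kz)"
      "X b * X a * X d * X b = t *\<^sub>q (e b * e a * e d * e b * kz)"
      using a(1,2,3) by (simp_all add: s mult_ac)
    then have "X a * X b * X d * X b + X d * X b * X a * X b + X b * X a * X b * X d + X b * X d * X b * X a
      = t *\<^sub>q ((e a * e b * e d * e b + e d * e b * e a * e b + e b * e a * e b * e d + e b * e d * e b * e a) * kz)"
      by (simp only: distrib_right scaleQ_add_right)
    also have "\<dots> = Q *\<^sub>q (X b * X a * X d * X b)"
      unfolding a(6) X4(5) by (simp add: uq_scale_mult qvec.scale_left_commute)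
    finally show ?thesis .
  qed
qed

text \<open>The Gram matrix (\<alpha>_a, \<alpha>_b) of the simple roots, hence symmetric. It is the
  exponent of q when \<open>uKappa a\<close> moves past E_(b,b+1), and the symmetry is the
  hypothesis on \<open>g\<close> in the twisted relations.\<close>

definition cartan_pairing :: "nat \<Rightarrow> nat \<Rightarrow> nat \<Rightarrow> nat \<Rightarrow> int" where
  "cartan_pairing m n a b = root_pairing m n a b - root_pairing m n (a + 1) b"

lemma cartan_pairing_sym:
  "a \<in> {1..m + n - 1} \<Longrightarrow> b \<in> {1..m + n - 1} \<Longrightarrow> cartan_pairing m n a b = cartan_pairing m n b a"
  unfolding cartan_pairing_def by (subst (1 2 3 4) root_pairing_eq) auto

abbreviation (input) "uKappa a \<equiv> uK a * uL (Suc a)"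
abbreviation (input) "uKappa' a \<equiv> uL a * uK (Suc a)"

lemma commute_scalar_mult:
  fixes k l x :: "('m::finite, 'n::finite) uq"
  assumes "k * x = c *\<^sub>q (x * k)" "l * x = d *\<^sub>q (x * l)"
  shows "(k * l) * x = (c * d) *\<^sub>q (x * (k * l))"
proof -
  have "(k * l) * x = d *\<^sub>q (k * x * l)" using assms(2) by (simp add: mult.assoc uq_scale_mult)
  then show ?thesis unfolding assms(1) by (simp add: uq_scale_mult scaleQ_scaleQ mult_ac)
qed

lemma
  assumes ab: "a \<in> {1..CARD('m) + CARD('n) - 1}" "b \<in> {1..CARD('m) + CARD('n) - 1}"
  defines "c \<equiv> power_int qq (cartan_pairing CARD('m) CARD('n) a b)"
  shows uKappa_up: "uKappa a * uE b = c *\<^sub>q (uE b * uKappa a :: ('m::finite, 'n::finite) uq)"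
      "uKappa' a * uE b = inverse c *\<^sub>q (uE b * uKappa' a :: ('m, 'n) uq)"
    and uKappa_down: "uKappa a * uF b = inverse c *\<^sub>q (uF b * uKappa a :: ('m, 'n) uq)"
      "uKappa' a * uF b = c *\<^sub>q (uF b * uKappa' a :: ('m, 'n) uq)"
proof -
  have a: "a \<in> {1..CARD('m) + CARD('n)}" "Suc a \<in> {1..CARD('m) + CARD('n)}" using ab by auto
  note K = uq_K_up[OF a(1) ab(2)] uq_K_up[OF a(2) ab(2)]
    uq_K_down[OF a(1) ab(2)] uq_K_down[OF a(2) ab(2)]
  have c: "c = power_int qq (root_pairing CARD('m) CARD('n) a b)
      * inverse (power_int qq (root_pairing CARD('m) CARD('n) (Suc a) b))"
    by (simp add: c_def cartan_pairing_def power_int_diff divide_inverse)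
  show "uKappa a * uE b = c *\<^sub>q (uE b * uKappa a :: ('m::finite, 'n::finite) uq)"
    unfolding c by (rule commute_scalar_mult[OF K(1) K(4)])
  show "uKappa' a * uE b = inverse c *\<^sub>q (uE b * uKappa' a :: ('m, 'n) uq)"
    unfolding c using commute_scalar_mult[OF K(2) K(3)] by (simp add: mult_ac)
  show "uKappa a * uF b = inverse c *\<^sub>q (uF b * uKappa a :: ('m, 'n) uq)"
    unfolding c using commute_scalar_mult[OF K(5) K(8)] by (simp add: mult_ac)
  show "uKappa' a * uF b = c *\<^sub>q (uF b * uKappa' a :: ('m, 'n) uq)"
    unfolding c using commute_scalar_mult[OF K(6) K(7)] by (simp add: mult_ac)
qed

lemma
  assumes ab: "a \<in> {1..CARD('m) + CARD('n) - 1}" "b \<in> {1..CARD('m) + CARD('n) - 1}"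
  shows uKappa_commute:
      "uKappa a * uKappa b = (uKappa b * uKappa a :: ('m::finite, 'n::finite) uq)"
      "uKappa' a * uKappa' b = (uKappa' b * uKappa' a :: ('m::finite, 'n::finite) uq)"
      "uKappa a * uKappa' b = (uKappa' b * uKappa a :: ('m::finite, 'n::finite) uq)"
    and uKappa_inverse: "uKappa a * uKappa' a = (1 :: ('m, 'n) uq)"
proof -
  have a: "a \<in> {1..CARD('m) + CARD('n)}" "Suc a \<in> {1..CARD('m) + CARD('n)}" using ab by auto
  have b: "b \<in> {1..CARD('m) + CARD('n)}" "Suc b \<in> {1..CARD('m) + CARD('n)}" using ab by auto
  have *: "(x * y) * (z * w) = (z * w) * (x * y)"
    if "x * z = z * x" "x * w = w * x" "y * z = z * y" "y * w = w * y"
    for x y z w :: "('m, 'n) uq"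
  proof -
    have "(x * y) * (z * w) = x * (y * z) * w" by (simp only: mult.assoc)
    also have "\<dots> = (x * z) * (y * w)" unfolding that(3) by (simp only: mult.assoc)
    also have "\<dots> = z * (x * w) * y" unfolding that(1,4) by (simp only: mult.assoc)
    also have "\<dots> = (z * w) * (x * y)" unfolding that(2) by (simp only: mult.assoc)
    finally show ?thesis .
  qed
  show "uKappa a * uKappa b = (uKappa b * uKappa a :: ('m::finite, 'n::finite) uq)"
    by (intro * uq_KK_commute) (use a b in auto)
  show "uKappa' a * uKappa' b = (uKappa' b * uKappa' a :: ('m::finite, 'n::finite) uq)"
    by (intro * uq_KK_commute) (use a b in auto)
  show "uKappa a * uKappa' b = (uKappa' b * uKappa a :: ('m::finite, 'n::finite) uq)"
    by (intro * uq_KK_commute) (use a b in auto)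
  have "uL (Suc a) * uL a = (uL a * uL (Suc a) :: ('m, 'n) uq)"
    by (rule uq_KK_commute) (use a in auto)
  then have "uKappa a * uKappa' a = uK a * (uL a * uL (Suc a)) * (uK (Suc a) :: ('m, 'n) uq)"
    by (metis mult.assoc)
  then have "uKappa a * uKappa' a = (uK a * uL a) * (uL (Suc a) * (uK (Suc a) :: ('m, 'n) uq))"
    by (simp only: mult.assoc)
  then show "uKappa a * uKappa' a = (1 :: ('m, 'n) uq)"
    by (simp add: uq_KL[OF a(1)] uq_KL[OF a(2)])
qed

lemma bit_eq_1_iff_eq_0: "(p = (1::bit)) = (p = 0) \<longleftrightarrow> False"
  by (cases p) simp_all

section \<open>The antipode on the defining relations\<close>

lemma antipode_free_1: "antipode_free 1 = 1"
  using antipode_free_single[of 0] by (simp add: zero_fword_def flip: single_one)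

text \<open>The defining relations consist of words with at most four letters, so these lengths
  cover all of them.\<close>

lemma
  assumes v: "valid_letter CARD('m) CARD('n) l\<^sub>1"
  defines "S \<equiv> (antipode_letter :: letter \<Rightarrow> ('m::finite, 'n::finite) uq)"
    and "p \<equiv> letter_parity CARD('m)"
    and "f \<equiv> (free_letter :: letter \<Rightarrow> ('m, 'n) free)"
  shows antipode_free_letter: "antipode_free (f l\<^sub>1) = S l\<^sub>1"
    and antipode_free_2: "valid_letter CARD('m) CARD('n) l\<^sub>2 \<Longrightarrow>
      antipode_free (f l\<^sub>1 * f l\<^sub>2) = sg (p l\<^sub>1 * p l\<^sub>2) *\<^sub>q (S l\<^sub>2 * S l\<^sub>1)"
    and antipode_free_3: "valid_letter CARD('m) CARD('n) l\<^sub>2 \<Longrightarrow>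
      valid_letter CARD('m) CARD('n) l\<^sub>3 \<Longrightarrow>
      antipode_free (f l\<^sub>1 * f l\<^sub>2 * f l\<^sub>3)
        = sg (p l\<^sub>1 * p l\<^sub>2 + p l\<^sub>1 * p l\<^sub>3 + p l\<^sub>2 * p l\<^sub>3) *\<^sub>q (S l\<^sub>3 * S l\<^sub>2 * S l\<^sub>1)"
    and antipode_free_4: "valid_letter CARD('m) CARD('n) l\<^sub>2 \<Longrightarrow>
      valid_letter CARD('m) CARD('n) l\<^sub>3 \<Longrightarrow> valid_letter CARD('m) CARD('n) l\<^sub>4 \<Longrightarrow>
      antipode_free (f l\<^sub>1 * f l\<^sub>2 * f l\<^sub>3 * f l\<^sub>4)
        = sg (p l\<^sub>1 * p l\<^sub>2 + p l\<^sub>1 * p l\<^sub>3 + p l\<^sub>1 * p l\<^sub>4 + p l\<^sub>2 * p l\<^sub>3 + p l\<^sub>2 * p l\<^sub>4 + p l\<^sub>3 * p l\<^sub>4)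
          *\<^sub>q (S l\<^sub>4 * S l\<^sub>3 * S l\<^sub>2 * S l\<^sub>1)"
  using v unfolding S_def f_def p_def
  by (simp_all add: free_letter_def mult_single plus_fword_def antipode_free_single
      word_parity_def Abs_gen_inverse uq_scale_mult scaleQ_scaleQ scaleQ_one sg_add distrib_left
      mult_ac bit_eq_1_iff_eq_0)

text \<open>The odd Serre element multiplied out, where a, b, d are the root vectors with indices m
  - 1, m, m + 1. In the relations \<open>s\<close> is the inverse of q and \<open>t\<close> is q, so
  the coefficient s t of d b a is 1. Both parameters are kept because reversing words exchanges
  them. The lowering relation expands to the same expression.\<close>

definition serre_odd :: "Cq \<Rightarrow> Cq \<Rightarrow> 'a \<Rightarrow> 'a \<Rightarrow> 'a \<Rightarrow> 'a::{ring,qvec}" where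
  "serre_odd s t a b d = a * b * d * b - s *\<^sub>q (b * a * d * b) - t *\<^sub>q (d * a * b * b) + d * b * a * b
     + b * a * b * d - s *\<^sub>q (b * b * a * d) - t *\<^sub>q (b * d * a * b) + b * d * b * a"

text \<open>The words d a b b and b b a d contain b b, and b a d b equals b d a b. So only
  \<open>s + t\<close> matters, and an exchange of \<open>s\<close> and \<open>t\<close> does no
  harm.\<close>

lemma serre_odd_eq_0_iff:
  fixes a b d :: "('m::finite, 'n::finite) uq"
  assumes "b * b = 0" "a * d = d * a"
  shows "serre_odd s t a b d = 0 \<longleftrightarrow>
    a * b * d * b + d * b * a * b + b * a * b * d + b * d * b * a = (s + t) *\<^sub>q (b * a * d * b)"
proof -
  have "d * (a * z) = a * (d * z)" "b * (b * z) = 0" for z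
    using assms by (metis mult.assoc, metis mult.assoc mult_zero_left)
  then show ?thesis
    by (simp add: serre_odd_def mult.assoc assms(1) scaleQ_add_left algebra_simps)
qed

text \<open>Reversal permutes the eight words, exchanging b a d b with b d a b and d a b b with b b
  a d, hence \<open>s\<close> with \<open>t\<close>. The common sign comes from the two odd letters
  passing each other.\<close>

lemma antipode_free_serre_odd:
  assumes "valid_letter CARD('m) CARD('n) l\<^sub>1" "valid_letter CARD('m) CARD('n) l\<^sub>2"
    "valid_letter CARD('m) CARD('n) l\<^sub>3" "letter_parity CARD('m) l\<^sub>1 = 0"
    "letter_parity CARD('m) l\<^sub>2 = 1" "letter_parity CARD('m) l\<^sub>3 = 0"
  shows "antipode_free (serre_odd s t (free_letter l\<^sub>1) (free_letter l\<^sub>2) (free_letter l\<^sub>3)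
      :: ('m::finite, 'n::finite) free)
    = - serre_odd t s (antipode_letter l\<^sub>1) (antipode_letter l\<^sub>2) (antipode_letter l\<^sub>3)"
  by (simp add: serre_odd_def qlinearD[OF qlinear_antipode_free] antipode_free_4 assms)

lemma antipode_free_rel:
  assumes "(r :: ('m::finite, 'n::finite) free) \<in> uq_rel"
  shows "antipode_free r = 0"
proof -
  define N where "N = CARD('m) + CARD('n)"
  have c: "CARD('m) \<ge> 1" "CARD('n) \<ge> 1" by (simp_all add: Suc_le_eq)
  have "CARD('m) \<le> CARD('m) + CARD('n) - 1" using c by linarith
  with c have m: "CARD('m) \<in> {1..N - 1}" by (simp add: N_def)
  \<comment> \<open>The scalar for moving \<open>uKappa' a\<close> past \<open>uE b\<close>, and
    equally for moving \<open>uKappa a\<close> past \<open>uF b\<close>; so one \<open>g\<close>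
    serves the raising and the lowering relations.\<close>
  define g where "g a b = inverse (power_int qq (cartan_pairing CARD('m) CARD('n) a b))" for a b
  define XE where "XE a = (antipode_letter (Up a) :: ('m, 'n) uq)" for a
  define XF where "XF a = (antipode_letter (Down a) :: ('m, 'n) uq)" for a
  have g: "\<forall>a\<in>{1..N - 1}. \<forall>b\<in>{1..N - 1}. g a b = g b a"
    using cartan_pairing_sym[of _ "CARD('m)" "CARD('n)"] by (simp add: g_def N_def)
  have XE: "\<forall>a\<in>{1..N - 1}. XE a = (- 1) *\<^sub>q (uE a * uKappa' a)"
    by (simp add: XE_def mult.assoc)
  \<comment> \<open>In the antipode of a lowering generator the Cartan factor stands on the left.
    Moving it to the right gives the shape required by the twisted relations and costs the scalar
    \<open>g a a\<close>.\<close>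
  have XF: "\<forall>a\<in>{1..N - 1}. XF a = (- g a a) *\<^sub>q (uF a * uKappa a)"
    using uKappa_down(1)[where 'm = 'm and 'n = 'n] by (simp add: XF_def mult.assoc g_def N_def)
  have cE: "\<forall>a\<in>{1..N - 1}. \<forall>b\<in>{1..N - 1}.
      uKappa' a * uE b = g a b *\<^sub>q (uE b * uKappa' a :: ('m, 'n) uq)"
    using uKappa_up(2)[where 'm = 'm and 'n = 'n] by (simp add: g_def N_def)
  have cF: "\<forall>a\<in>{1..N - 1}. \<forall>b\<in>{1..N - 1}.
      uKappa a * uF b = g a b *\<^sub>q (uF b * uKappa a :: ('m, 'n) uq)"
    using uKappa_down(1)[where 'm = 'm and 'n = 'n] by (simp add: g_def N_def)
  have kE: "\<forall>a\<in>{1..N - 1}. \<forall>b\<in>{1..N - 1}.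
      uKappa' a * uKappa' b = (uKappa' b * uKappa' a :: ('m, 'n) uq)"
    using uKappa_commute(2)[where 'm = 'm and 'n = 'n] by (simp add: N_def)
  have kF: "\<forall>a\<in>{1..N - 1}. \<forall>b\<in>{1..N - 1}.
      uKappa a * uKappa b = (uKappa b * uKappa a :: ('m, 'n) uq)"
    using uKappa_commute(1)[where 'm = 'm and 'n = 'n] by (simp add: N_def)
  note twE = twisted_square[OF cE g kE XE] twisted_commute[OF cE g kE XE] twisted_serre[OF cE g kE XE]
    twisted_serre_odd[OF cE g kE XE]
  note twF = twisted_square[OF cF g kF XF] twisted_commute[OF cF g kF XF] twisted_serre[OF cF g kF XF]
    twisted_serre_odd[OF cF g kF XF]
  note [simp] = qlinearD[OF qlinear_antipode_free] antipode_free_letter antipode_free_1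
    antipode_free_2 antipode_free_3 antipode_free_4 scaleQ_one
  note rel0 = abs_uq_rel[OF assms]
  have comm: "x * (y * z) = y * z * x" if "x * y = y * x" "x * z = z * x"
    for x y z :: "('m, 'n) uq"
    using that by (metis mult.assoc)
  show ?thesis
    using assms
  proof cases
    case (K_inv b)
    then show ?thesis by (simp add: uq_KL)
  next
    case (K_comm a b x y)
    have *: "u * v = v * u" if "u \<in> {uK a, uL a}" "v \<in> {uK b, uL b}" for u v :: "('m, 'n) uq"
      using uq_KK_commute[OF that K_comm(2,3)] .
    have "uK a * uK b = (uK b * uK a :: ('m, 'n) uq)" "uK a * uL b = (uL b * uK a :: ('m, 'n) uq)"
      "uL a * uK b = (uK b * uL a :: ('m, 'n) uq)" "uL a * uL b = (uL b * uL a :: ('m, 'n) uq)"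
      by (rule *; simp)+
    moreover have "x = kp a \<or> x = km a" "y = kp b \<or> y = km b" using K_comm(4,5) by simp_all
    ultimately show ?thesis using K_comm(1-3) by (elim disjE) simp_all
  next
    case (K_up a b)
    have b: "b \<in> {1..CARD('m) + CARD('n)}" "Suc b \<in> {1..CARD('m) + CARD('n)}"
      using K_up(3) by auto
    have "uK a * uL b = (uL b * uK a :: ('m, 'n) uq)"
      "uK a * uK (Suc b) = (uK (Suc b) * uK a :: ('m, 'n) uq)"
      by (rule uq_KK_commute[OF _ _ K_up(2) b(1)] uq_KK_commute[OF _ _ K_up(2) b(2)]; simp)+
    \<comment> \<open>Reversal together with inversion of the outer factors leaves a conjugation by
      \<open>uK a\<close>, now of the antipode of E_b. Its extra factor \<open>uKappa' b\<close>
      commutes with \<open>uK a\<close>, so the scalar of the relation is unchanged.\<close>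
    then have k: "uK a * uKappa' b = (uKappa' b * uK a :: ('m, 'n) uq)"
      by (rule comm)
    have "uE b * uK a * uKappa' b * uL a = uE b * (uK a * uKappa' b) * (uL a :: ('m, 'n) uq)"
      by (simp only: mult.assoc)
    also have "\<dots> = uE b * uKappa' b * (uK a * uL a)"
      unfolding k by (simp only: mult.assoc)
    finally have "uK a * uE b * uKappa' b * uL a
        = power_int qq (root_pairing CARD('m) CARD('n) a b)
            *\<^sub>q (uE b * uKappa' b * (uK a * uL a) :: ('m, 'n) uq)"
      unfolding uq_K_up(1)[OF K_up(2,3)] uq_scale_mult by simp
    moreover have "antipode_free r = power_int qq (root_pairing CARD('m) CARD('n) a b)
        *\<^sub>q (uE b * uKappa' b) - uK a * uE b * uKappa' b * uL a"
      unfolding K_up(1) using K_up(2,3) b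
      by (simp add: root_pairing_def) (simp add: mult.assoc)
    ultimately show ?thesis by (simp add: uq_KL[OF K_up(2)])
  next
    case (K_down a b)
    have b: "b \<in> {1..CARD('m) + CARD('n)}" "Suc b \<in> {1..CARD('m) + CARD('n)}"
      using K_down(3) by auto
    have "uK a * uK b = (uK b * uK a :: ('m, 'n) uq)"
      "uK a * uL (Suc b) = (uL (Suc b) * uK a :: ('m, 'n) uq)"
      by (rule uq_KK_commute[OF _ _ K_down(2) b(1)] uq_KK_commute[OF _ _ K_down(2) b(2)]; simp)+
    then have k: "uK a * uKappa b = (uKappa b * uK a :: ('m, 'n) uq)"
      by (rule comm)
    have "uK a * uKappa b * uF b * uL a = uKappa b * (uK a * uF b) * (uL a :: ('m, 'n) uq)"
      unfolding k by (simp only: mult.assoc)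
    also have "\<dots> = power_int qq (- root_pairing CARD('m) CARD('n) a b)
        *\<^sub>q (uKappa b * uF b * (uK a * uL a))"
      unfolding uq_K_down(1)[OF K_down(2,3)] uq_scale_mult
      by (simp add: mult.assoc power_int_minus)
    finally have "uK a * uKappa b * uF b * uL a
        = power_int qq (- root_pairing CARD('m) CARD('n) a b) *\<^sub>q (uKappa b * uF b :: ('m, 'n) uq)"
      by (simp add: uq_KL[OF K_down(2)])
    moreover have "antipode_free r = power_int qq (- root_pairing CARD('m) CARD('n) a b)
        *\<^sub>q (uKappa b * uF b) - uK a * uKappa b * uF b * uL a"
      unfolding K_down(1) root_pairing_uminus[OF K_down(2), of b] using K_down(2,3) b
      by simp (simp add: mult.assoc)
    ultimately show ?thesis by simp
  next
    case (up_down a b)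
    then have ab: "a \<in> {1..N - 1}" "b \<in> {1..N - 1}" by (simp_all add: N_def)
    define \<sigma> :: Cq where "\<sigma> = (if a = CARD('m) \<and> b = CARD('m) then - 1 else 1)"
    define h where "h = inverse (q_at CARD('m) a - inverse (q_at CARD('m) a))"
    have \<sigma>: "sg (letter_parity CARD('m) (Up a) * letter_parity CARD('m) (Down b)) = \<sigma>"
      by (simp add: \<sigma>_def)
    have \<sigma>2: "\<sigma> * \<sigma> = 1" by (simp add: \<sigma>_def)
    have gn: "g a b \<noteq> 0" for a b by (simp add: g_def)
    have kE: "uKappa b * uE a = inverse (g a b) *\<^sub>q (uE a * uKappa b :: ('m, 'n) uq)"
      using uKappa_up(1)[where 'm = 'm and 'n = 'n, of b a] ab g[rule_format, of a b] by (simp add: g_def N_def)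
    have kF: "uKappa' a * uF b = inverse (g a b) *\<^sub>q (uF b * uKappa' a :: ('m, 'n) uq)"
      using uKappa_down(2)[where 'm = 'm and 'n = 'n, of a b] ab by (simp add: g_def N_def)
    have kk: "uKappa' a * uKappa b = (uKappa b * uKappa' a :: ('m, 'n) uq)"
      using uKappa_commute(3)[where 'm = 'm and 'n = 'n, of b a] ab by (simp add: N_def)
    \<comment> \<open>The scalar left when the Cartan factors are collected on the right:
      \<open>g b b\<close> comes from \<open>XF b\<close>, the inverse of \<open>g a b\<close> from
      one exchange. It is the same for both orders of the product, and equals 1 if
      \<open>a = b\<close>.\<close>
    define t where "t = g b b * inverse (g a b)"
    have 1: "XF b * XE a = t *\<^sub>q (uF b * uE a * (uKappa b * uKappa' a))"
    proof -
      have "XF b * XE a = g b b *\<^sub>q (uF b * (uKappa b * uE a) * uKappa' a)"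
        unfolding XF[rule_format, OF ab(2)] XE[rule_format, OF ab(1)] by (simp add: uq_scale_mult scaleQ_scaleQ mult.assoc)
      then show ?thesis unfolding kE t_def
        by (simp add: uq_scale_mult scaleQ_scaleQ mult.assoc)
    qed
    have 2: "XE a * XF b = t *\<^sub>q (uE a * uF b * (uKappa b * uKappa' a))"
    proof -
      have "XE a * XF b = g b b *\<^sub>q (uE a * (uKappa' a * uF b) * uKappa b)"
        unfolding XF[rule_format, OF ab(2)] XE[rule_format, OF ab(1)] by (simp add: uq_scale_mult scaleQ_scaleQ mult.assoc)
      also have "\<dots> = t *\<^sub>q (uE a * uF b * (uKappa' a * uKappa b))"
        unfolding kF t_def by (simp add: uq_scale_mult scaleQ_scaleQ mult.assoc)
      finally show ?thesis unfolding kk .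
    qed
    have rel: "uE a * uF b - \<sigma> *\<^sub>q (uF b * uE a)
        = ((if a = b then h *\<^sub>q (uKappa a - uKappa' a) else 0) :: ('m, 'n) uq)"
      using rel0 unfolding up_down(1) by (auto simp: abs_uq_simps \<sigma>_def h_def)
    have kv: "uK (Suc a) * uL a = (uKappa' a :: ('m, 'n) uq)" "uL (Suc a) * uK a = (uKappa a :: ('m, 'n) uq)"
      by (rule uq_KK_commute[of _ "Suc a" _ a]; use ab in \<open>auto simp: N_def\<close>)+
    have a: "a \<in> {1..CARD('m) + CARD('n)}" "Suc a \<in> {1..CARD('m) + CARD('n)}"
      using up_down(2) by auto
    have "antipode_free r = \<sigma> *\<^sub>q (XF b * XE a) - XE a * XF b
        - (if a = b then h *\<^sub>q (uKappa' a - uKappa a) else 0)"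
      using up_down(2,3) a \<sigma> kv unfolding up_down(1) \<sigma>_def[symmetric] h_def[symmetric]
      by (auto simp: XE_def XF_def scaleQ_scaleQ \<sigma>2 mult.commute)
    \<comment> \<open>The original supercommutator reappears with a factor
      \<open>uKappa b * uKappa' a\<close> on its right. For \<open>a = b\<close> this factor is 1,
      and the antipode of the right-hand side of the relation cancels what remains.\<close>
    also have "\<sigma> *\<^sub>q (XF b * XE a) - XE a * XF b
        = - (t *\<^sub>q ((uE a * uF b - \<sigma> *\<^sub>q (uF b * uE a)) * (uKappa b * uKappa' a)))"
      unfolding 1 2 by (simp add: left_diff_distrib uq_scale_mult qvec.scale_right_diff_distrib
          qvec.scale_left_commute[of t])
    also have "\<dots> - (if a = b then h *\<^sub>q (uKappa' a - uKappa a) else 0) = 0"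
    proof (cases "a = b")
      case True
      then have "t = 1" using gn by (simp add: t_def)
      moreover have "uKappa b * uKappa' a = (1 :: ('m, 'n) uq)"
        using uKappa_inverse[where 'm = 'm and 'n = 'n, of a] up_down(2) True by simp
      ultimately show ?thesis unfolding rel using True
        by (simp add: scaleQ_one qvec.scale_right_diff_distrib)
    next
      case False
      then show ?thesis unfolding rel by simp
    qed
    finally show ?thesis .
  next
    case up_odd
    then show ?thesis using m rel0 twE(1)[OF m] by (simp add: N_def abs_uq_simps XE_def)
  next
    case down_odd
    then show ?thesis using m rel0 twF(1)[OF m] by (simp add: N_def abs_uq_simps XF_def)
  next
    case (up_comm a b)
    then show ?thesis using rel0 twE(2)[of a b] by (simp add: abs_uq_simps XE_def N_def)
  next
    case (down_comm a b)
    then show ?thesis using rel0 twF(2)[of a b] by (simp add: abs_uq_simps XF_def N_def)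
  next
    case (serre_up a b)
    then show ?thesis using rel0 twE(3)[of a b "qq + inverse qq"]
      by (simp add: abs_uq_simps XE_def N_def serre_def)
  next
    case (serre_down a b)
    then show ?thesis using rel0 twF(3)[of a b "qq + inverse qq"]
      by (simp add: abs_uq_simps XF_def N_def serre_def)
  next
    case serre_odd_up
    define a b d where "a = CARD('m) - 1" and "b = CARD('m)" and "d = CARD('m) + 1"
    from serre_odd_up obtain k j where kj: "CARD('m) = Suc (Suc k)" "CARD('n) = Suc (Suc j)"
      by (metis add_2_eq_Suc le_Suc_ex)
    have abd: "a \<in> {1..N - 1}" "b \<in> {1..N - 1}" "d \<in> {1..N - 1}"
      by (auto simp: a_def b_def d_def N_def kj)
    then have v: "a \<in> {1..CARD('m) + CARD('n) - 1}" "b \<in> {1..CARD('m) + CARD('n) - 1}"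
      "d \<in> {1..CARD('m) + CARD('n) - 1}" by (simp_all add: N_def)
    have r: "r = serre_odd (inverse qq) qq (up a) (up b) (up d)"
      unfolding serre_odd_up(1) serre_odd_def
      by (simp add: kj a_def b_def d_def numeral_2_eq_2 Let_def algebra_simps q_at_def
          free_scale_mult scaleQ_scaleQ qvec.scale_right_diff_distrib scaleQ_add_right)
    have bb: "uE b * uE b = (0 :: ('m, 'n) uq)"
      using abs_uq_rel[OF uq_rel.up_odd] by (simp add: abs_uq_simps b_def)
    have ad: "uE a * uE d = (uE d * uE a :: ('m, 'n) uq)"
      using abs_uq_rel[OF uq_rel.up_comm[OF v(1,3)]] by (simp add: abs_uq_simps a_def d_def)
    have "serre_odd (inverse qq) qq (uE a) (uE b) (uE d) = (0 :: ('m, 'n) uq)"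
      using rel0 unfolding r serre_odd_def by (simp only: abs_uq_simps)
    then have "serre_odd qq (inverse qq) (XE a) (XE b) (XE d) = 0"
      using twE(4)[OF abd bb ad] twisted_square[OF cE g kE XE abd(2) bb]
        twisted_commute[OF cE g kE XE abd(1,3) ad]
      by (simp add: serre_odd_eq_0_iff bb ad add.commute[of qq])
    moreover have "(a = CARD('m)) = False" "(b = CARD('m)) = True" "(d = CARD('m)) = False"
      by (simp_all add: a_def b_def d_def kj)
    ultimately show ?thesis
      unfolding r using v by (subst antipode_free_serre_odd) (simp_all add: XE_def del: antipode_letter.simps)
  next
    case serre_odd_down
    define a b d where "a = CARD('m) - 1" and "b = CARD('m)" and "d = CARD('m) + 1"
    from serre_odd_down obtain k j where kj: "CARD('m) = Suc (Suc k)" "CARD('n) = Suc (Suc j)"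
      by (metis add_2_eq_Suc le_Suc_ex)
    have abd: "a \<in> {1..N - 1}" "b \<in> {1..N - 1}" "d \<in> {1..N - 1}"
      by (auto simp: a_def b_def d_def N_def kj)
    then have v: "a \<in> {1..CARD('m) + CARD('n) - 1}" "b \<in> {1..CARD('m) + CARD('n) - 1}"
      "d \<in> {1..CARD('m) + CARD('n) - 1}" by (simp_all add: N_def)
    have r: "r = serre_odd (inverse qq) qq (down a) (down b) (down d)"
      unfolding serre_odd_down(1) serre_odd_def
      by (simp add: kj a_def b_def d_def numeral_2_eq_2 Let_def algebra_simps q_at_def
          free_scale_mult scaleQ_scaleQ qvec.scale_right_diff_distrib scaleQ_add_right)
    have bb: "uF b * uF b = (0 :: ('m, 'n) uq)"
      using abs_uq_rel[OF uq_rel.down_odd] by (simp add: abs_uq_simps b_def)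
    have ad: "uF a * uF d = (uF d * uF a :: ('m, 'n) uq)"
      using abs_uq_rel[OF uq_rel.down_comm[OF v(1,3)]] by (simp add: abs_uq_simps a_def d_def)
    have "serre_odd (inverse qq) qq (uF a) (uF b) (uF d) = (0 :: ('m, 'n) uq)"
      using rel0 unfolding r serre_odd_def by (simp only: abs_uq_simps)
    then have "serre_odd qq (inverse qq) (XF a) (XF b) (XF d) = 0"
      using twF(4)[OF abd bb ad] twisted_square[OF cF g kF XF abd(2) bb]
        twisted_commute[OF cF g kF XF abd(1,3) ad]
      by (simp add: serre_odd_eq_0_iff bb ad add.commute[of qq])
    moreover have "(a = CARD('m)) = False" "(b = CARD('m)) = True" "(d = CARD('m)) = False"
      by (simp_all add: a_def b_def d_def kj)
    ultimately show ?thesis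
      unfolding r using v by (subst antipode_free_serre_odd) (simp_all add: XF_def del: antipode_letter.simps)
  qed
qed

lemma antipode_free_ideal:
  assumes "r \<in> uq_rel"
  shows "antipode_free (Poly_Mapping.single u 1 * r * Poly_Mapping.single v 1) = 0"
proof -
  obtain p where p: "r \<in> free_part p" using uq_rel_homogeneous[OF assms] by blast
  have uv: "Poly_Mapping.single u 1 \<in> free_part (word_parity u)"
    "Poly_Mapping.single v 1 \<in> free_part (word_parity v)"
    by (simp_all add: single_in_free_part)
  show ?thesis
    by (simp add: antipode_free_mult[OF free_part_mult[OF uv(1) p refl] uv(2)]
        antipode_free_mult[OF uv(1) p] antipode_free_rel[OF assms])
qed

text \<open>The specification inside \<open>antipode\<close>, with the clauses for the generators
  gathered into one statement about letters, so that induction on words applies.\<close>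

definition is_antipode :: "(('m::finite, 'n::finite) uq \<Rightarrow> ('m, 'n) uq) \<Rightarrow> bool" where
  "is_antipode S \<longleftrightarrow> qlinear S \<and> S 1 = 1 \<and>
     (\<forall>p r. \<forall>x\<in>uq_part p. \<forall>y\<in>uq_part r. S (x * y) = sg (p * r) *\<^sub>q (S y * S x)) \<and>
     (\<forall>l. valid_letter CARD('m) CARD('n) l \<longrightarrow> S (uq_gen l) = antipode_letter l)"

lemma is_antipode_iff:
  "is_antipode S \<longleftrightarrow> (qlinear S \<and> S 1 = 1 \<and>
     (\<forall>p r. \<forall>x\<in>uq_part p. \<forall>y\<in>uq_part r. S (x * y) = sg (p * r) *\<^sub>q (S y * S x)) \<and>
     (\<forall>b\<in>{1..CARD('m) + CARD('n)}.
        S (uq_gen (Kp b)) = uq_gen (Km b) \<and> S (uq_gen (Km b)) = uq_gen (Kp b)) \<and>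
     (\<forall>a\<in>{1..CARD('m) + CARD('n) - 1}.
        S (uq_gen (Up a)) = - (uq_gen (Up a) * uq_gen (Km a) * uq_gen (Kp (a + 1))) \<and>
        S (uq_gen (Down a)) = - (uq_gen (Kp a) * uq_gen (Km (a + 1)) * uq_gen (Down a))))"
  for S :: "('m::finite, 'n::finite) uq \<Rightarrow> ('m, 'n) uq"
proof -
  have *: "(\<forall>l. P l) \<longleftrightarrow> (\<forall>b. P (Kp b) \<and> P (Km b)) \<and> (\<forall>a. P (Up a) \<and> P (Down a))" for P
  proof (intro iffI allI)
    fix l assume "(\<forall>b. P (Kp b) \<and> P (Km b)) \<and> (\<forall>a. P (Up a) \<and> P (Down a))"
    then show "P l" by (cases l) simp_all
  qed simp
  have "(\<forall>l. valid_letter CARD('m) CARD('n) l \<longrightarrow> S (uq_gen l) = antipode_letter l) \<longleftrightarrow>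
    (\<forall>b\<in>{1..CARD('m) + CARD('n)}.
        S (uq_gen (Kp b)) = uq_gen (Km b) \<and> S (uq_gen (Km b)) = uq_gen (Kp b)) \<and>
     (\<forall>a\<in>{1..CARD('m) + CARD('n) - 1}.
        S (uq_gen (Up a)) = - (uq_gen (Up a) * uq_gen (Km a) * uq_gen (Kp (a + 1))) \<and>
        S (uq_gen (Down a)) = - (uq_gen (Kp a) * uq_gen (Km (a + 1)) * uq_gen (Down a)))"
    unfolding * Ball_def by (simp only: valid_letter.simps antipode_letter.simps) blast
  then show ?thesis unfolding is_antipode_def by (simp only:)
qed

lemma ex_is_antipode: "is_antipode (uq_lift antipode_free)"
proof -
  have abs: "uq_lift antipode_free (abs_uq x) = antipode_free x" for x :: "('a, 'b) free"
    by (rule uq_lift_abs[OF qlinear_antipode_free antipode_free_ideal])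
  have "uq_lift antipode_free (x * y)
      = sg (p * r) *\<^sub>q (uq_lift antipode_free y * uq_lift antipode_free x)"
    if xy: "x \<in> uq_part p" "y \<in> uq_part r" for x y :: "('a, 'b) uq" and p r
  proof -
    obtain u v where "x = abs_uq u" "u \<in> free_part p" "y = abs_uq v" "v \<in> free_part r"
      using xy unfolding uq_part_eq by blast
    then show ?thesis by (simp add: abs antipode_free_mult flip: abs_uq_simps(5))
  qed
  moreover have "uq_lift antipode_free (uq_gen l) = (antipode_letter l :: ('a, 'b) uq)"
    if "valid_letter CARD('a) CARD('b) l" for l
    using abs[of "free_letter l"] antipode_free_letter[where 'm = 'a and 'n = 'b, OF that] by (simp add: abs_uq_simps)
  moreover have "uq_lift antipode_free 1 = (1 :: ('a, 'b) uq)"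
    using abs[of 1] by (simp add: abs_uq_simps antipode_free_1)
  ultimately show ?thesis
    using qlinear_uq_lift[OF qlinear_antipode_free antipode_free_ideal]
    by (simp add: is_antipode_def)
qed

definition uq_word :: "('m::finite, 'n::finite) gen list \<Rightarrow> ('m, 'n) uq" where
  "uq_word gs = abs_uq (Poly_Mapping.single (FWord gs) 1)"

lemma uq_word_Nil: "uq_word [] = 1"
  unfolding uq_word_def by (simp add: abs_uq_simps flip: zero_fword_def)

lemma uq_word_Cons: "uq_word (g # gs) = uq_gen (Rep_gen g) * uq_word gs"
  by (simp add: uq_word_def free_letter_def Rep_gen_inverse mult_single plus_fword_def
      flip: abs_uq_simps(5,8))

lemma uq_word_in_part: "uq_word gs \<in> uq_part (word_parity (FWord gs))"
  unfolding uq_word_def uq_part_eq by (intro imageI single_in_free_part) simp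

lemma valid_Rep_gen: "valid_letter CARD('m) CARD('n) (Rep_gen (g :: ('m::finite, 'n::finite) gen))"
  using Rep_gen[of g] by simp

lemma uq_gen_in_part:
  "valid_letter CARD('m) CARD('n) l \<Longrightarrow>
    (uq_gen l :: ('m::finite, 'n::finite) uq) \<in> uq_part (letter_parity CARD('m) l)"
  by (simp add: uq_part_iff uq_twist_gen)

lemma in_span_uq_words: "x \<in> qvec.span (range uq_word)"
proof -
  obtain u where u: "x = abs_uq u" using abs_uq_surj by blast
  show ?thesis unfolding u
  proof (rule qlinear_on_image_span_subset[OF qlinear_imp_on[OF qlinear_abs_uq] _
        qvec.subspace_span poly_mapping_in_span_singles])
    fix s :: "('a, 'b) free" assume "s \<in> (\<lambda>w. Poly_Mapping.single w 1) ` Poly_Mapping.keys u"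
    then obtain w where "s = Poly_Mapping.single w 1" by blast
    then have "abs_uq s = uq_word (letters w)" by (simp add: uq_word_def)
    then show "abs_uq s \<in> qvec.span (range uq_word)" by (auto intro: qvec.span_base)
  qed
qed

lemma uq_words_eqI:
  assumes "qlinear f" "qlinear g" "\<And>w. f (uq_word w) = g (uq_word w)"
  shows "f x = g x"
  by (rule qlinear_on_span_eqI[OF qlinear_imp_on[OF assms(1)] qlinear_imp_on[OF assms(2)] _
        in_span_uq_words]) (use assms(3) in blast)

lemma is_antipode_word:
  assumes "is_antipode S"
  shows "S (uq_word gs) = antipode_word gs"
proof (induction gs)
  case Nil
  then show ?case using assms by (simp add: uq_word_Nil is_antipode_def)
next
  case (Cons g gs)
  have "S (uq_gen (Rep_gen g) * uq_word gs) = sg (letter_parity CARD('a) (Rep_gen g) * word_parity (FWord gs))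
      *\<^sub>q (S (uq_word gs) * S (uq_gen (Rep_gen g)))"
    using assms uq_gen_in_part[OF valid_Rep_gen] uq_word_in_part unfolding is_antipode_def by blast
  then show ?case
    using assms valid_Rep_gen[of g] by (simp add: uq_word_Cons Cons is_antipode_def)
qed

text \<open>Uniqueness: the conditions force the values on words, and words span the algebra. With
  the existence shown before, the definite description is met.\<close>

lemma is_antipode_antipode: "is_antipode (antipode :: ('a::finite, 'b::finite) uq \<Rightarrow> ('a, 'b) uq)"
proof -
  have "S = uq_lift antipode_free" if S: "is_antipode S" for S :: "('a, 'b) uq \<Rightarrow> ('a, 'b) uq"
  proof
    fix x show "S x = uq_lift antipode_free x"
    proof (rule uq_words_eqI[of S "uq_lift antipode_free"])
      show "qlinear S" "qlinear (uq_lift antipode_free)"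
        using S ex_is_antipode unfolding is_antipode_def by blast+
    qed (simp only: is_antipode_word[OF S] is_antipode_word[OF ex_is_antipode])
  qed
  then have "antipode = (uq_lift antipode_free :: ('a, 'b) uq \<Rightarrow> ('a, 'b) uq)"
    unfolding antipode_def is_antipode_iff[symmetric] using ex_is_antipode by (intro the_equality)
  then show ?thesis by (rule ssubst[of _ _ is_antipode]) (rule ex_is_antipode)
qed

lemma
  shows qlinear_antipode: "qlinear antipode"
    and antipode_1: "antipode 1 = 1"
    and antipode_mult: "x \<in> uq_part p \<Longrightarrow> y \<in> uq_part r \<Longrightarrow>
      antipode (x * y) = sg (p * r) *\<^sub>q (antipode y * antipode x)"
    and antipode_gen: "valid_letter CARD('m) CARD('n) l \<Longrightarrow>
      antipode (uq_gen l :: ('m::finite, 'n::finite) uq) = antipode_letter l"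
  using is_antipode_antipode unfolding is_antipode_def by blast+

lemma antipode_letter_in_part:
  "valid_letter CARD('m) CARD('n) l \<Longrightarrow>
    (antipode_letter l :: ('m::finite, 'n::finite) uq) \<in> uq_part (letter_parity CARD('m) l)"
  by (cases l) (auto simp: uq_part_iff uq_twist_simps uq_twist_gen scaleQ_one)

text \<open>The antipode preserves the parity of words, so it commutes with the parity automorphism
  everywhere; \<open>uq_part_iff\<close> turns this back into a statement about parts.\<close>

lemma antipode_in_part:
  fixes x :: "('a::finite, 'b::finite) uq"
  assumes "x \<in> uq_part p" shows "antipode x \<in> uq_part p"
proof -
  have w: "antipode_word gs \<in> uq_part (word_parity (FWord gs))" for gs :: "('a, 'b) gen list"
  proof (induction gs)
    case Nil
    then show ?case by (simp add: word_parity_def uq_part_iff uq_twist_1 scaleQ_one)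
  next
    case (Cons g gs)
    have "word_parity (FWord (g # gs)) = word_parity (FWord gs) + letter_parity CARD('a) (Rep_gen g)"
      by (simp add: word_parity_def add.commute del: add_bit_eq_xor)
    then show ?case
      using uq_part_mult[OF Cons antipode_letter_in_part[OF valid_Rep_gen, of g]]
      by (simp add: qvec.subspace_scale[OF subspace_uq_part])
  qed
  have "uq_twist (antipode x) = antipode (uq_twist x)"
  proof (rule uq_words_eqI[of "\<lambda>x. uq_twist (antipode x)"])
    show "qlinear (\<lambda>x. uq_twist (antipode x))" "qlinear (\<lambda>x. antipode (uq_twist x))"
      by (auto intro!: qlinearI simp: qlinearD[OF qlinear_antipode] uq_twist_simps)
    show "uq_twist (antipode (uq_word gs)) = antipode (uq_twist (uq_word gs))"
      for gs :: "('a, 'b) gen list"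
      using w[of gs] uq_word_in_part[of gs]
      by (simp add: is_antipode_word[OF is_antipode_antipode] uq_part_iff
          qlinearD[OF qlinear_antipode])
  qed
  then show ?thesis using assms by (simp add: uq_part_iff qlinearD[OF qlinear_antipode])
qed

abbreviation "uq_comp \<equiv> hcomp uq_part"

text \<open>Components as eigenprojections: a subspace stable under \<open>uq_twist\<close>
  therefore contains the components of its elements.\<close>

lemma uq_comp_eq: "uq_comp p x = inverse 2 *\<^sub>q (x + sg p *\<^sub>q uq_twist x)"
proof (rule hcompI[OF graded_uq_part])
  show "inverse 2 *\<^sub>q (x + sg p *\<^sub>q uq_twist x) \<in> uq_part p"
    by (simp add: uq_part_iff uq_twist_simps uq_twist_twist scaleQ_add_right
          qvec.scale_left_commute[of "sg p" "inverse 2"] add.commute)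
  have "x - inverse 2 *\<^sub>q (x + sg p *\<^sub>q uq_twist x) = inverse 2 *\<^sub>q (x + x) - inverse 2 *\<^sub>q (x + sg p *\<^sub>q uq_twist x)"
    by (simp only: half_sum_eq)
  also have "\<dots> = inverse 2 *\<^sub>q (x + sg (p + 1) *\<^sub>q uq_twist x)"
    by (simp only: scaleQ_add_right) (simp add: sg_add)
  also have "\<dots> \<in> uq_part (p + 1)"
    by (simp add: uq_part_iff uq_twist_simps uq_twist_twist scaleQ_add_right
          qvec.scale_left_commute[of "sg (p + 1)" "inverse 2"] add.commute del: sg_simps(1,2))
  finally show "x - inverse 2 *\<^sub>q (x + sg p *\<^sub>q uq_twist x) \<in> uq_part (p + 1)" .
qed

lemma
  shows uq_comp_in: "uq_comp p x \<in> uq_part p"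
    and uq_comp_sum: "uq_comp 0 x + uq_comp 1 x = x"
    and uq_comp_same: "y \<in> uq_part p \<Longrightarrow> uq_comp p y = y"
    and uq_comp_other: "y \<in> uq_part p \<Longrightarrow> r \<noteq> p \<Longrightarrow> uq_comp r y = 0"
    and qlinear_uq_comp: "qlinear (uq_comp p)"
    and uq_comp_comp: "uq_comp p (uq_comp r x) = (if p = r then uq_comp p x else 0)"
  by (simp_all add: hcomp_in[OF graded_uq_part] hcomp_sum[OF graded_uq_part]
      hcomp_same[OF graded_uq_part] hcomp_other[OF graded_uq_part] hcomp_hcomp[OF graded_uq_part]
      qlinear_on_hcomp[OF graded_uq_part, unfolded gsum_uq_part] gsum_uq_part qlinear_iff
      del: if_split)

lemma mult_as_components:
  fixes x y :: "('m::finite, 'n::finite) uq"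
  shows "x * y = (\<Sum>p\<in>{0, 1}. \<Sum>r\<in>{0, 1}. uq_comp p x * uq_comp r y)"
proof -
  have "x * y = (uq_comp 0 x + uq_comp 1 x) * (uq_comp 0 y + uq_comp 1 y)"
    by (simp only: uq_comp_sum)
  then show ?thesis by (simp add: algebra_simps)
qed

lemma antipode_comp: "antipode (uq_comp p x) = uq_comp p (antipode x)"
proof -
  have "antipode x - antipode (uq_comp p x) = antipode (x - uq_comp p x)"
    by (simp add: qlinearD[OF qlinear_antipode])
  also have "x - uq_comp p x = uq_comp (p + 1) x"
    using uq_comp_sum[of x] by (cases p) (simp_all add: algebra_simps)
  finally show ?thesis
    by (intro hcompI[OF graded_uq_part, symmetric] antipode_in_part uq_comp_in)
      (simp add: antipode_in_part uq_comp_in)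
qed

section \<open>Stability of the sub-superalgebras under parity and antipode\<close>

lemma subspace_uq_sub: "qvec.subspace (uq_sub \<Theta>)"
proof -
  have "0 \<in> uq_sub \<Theta>" using uq_sub.scale[OF uq_sub.one, of 0] by simp
  then show ?thesis by (simp add: qvec.subspace_def uq_sub.add uq_sub.scale)
qed

context
  fixes \<Theta> :: "nat set"
  assumes \<Theta>: "\<Theta> \<subseteq> {1..CARD('m::finite) + CARD('n::finite) - 1}"
begin

text \<open>Makes \<open>uq_sub \<Theta>\<close> a graded subspace. The hypothesis on \<Theta>
  ensures that its generators are valid letters, whose parity is known.\<close>

lemma uq_twist_sub: "(x :: ('m, 'n) uq) \<in> uq_sub \<Theta> \<Longrightarrow> uq_twist x \<in> uq_sub \<Theta>"
proof (induction rule: uq_sub.induct)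
  case (Up a)
  then have "valid_letter CARD('m) CARD('n) (Up a)" using \<Theta> by auto
  with Up show ?case by (simp only: uq_twist_gen) (intro uq_sub.scale uq_sub.Up)
next
  case (Down a)
  then have "valid_letter CARD('m) CARD('n) (Down a)" using \<Theta> by auto
  with Down show ?case by (simp only: uq_twist_gen) (intro uq_sub.scale uq_sub.Down)
qed (auto simp: uq_twist_simps uq_twist_gen scaleQ_one intro: uq_sub.intros)

lemma uq_comp_sub: "(x :: ('m, 'n) uq) \<in> uq_sub \<Theta> \<Longrightarrow> uq_comp p x \<in> uq_sub \<Theta>"
  unfolding uq_comp_eq by (intro uq_sub.scale uq_sub.add uq_twist_sub)

lemma antipode_sub: "(x :: ('m, 'n) uq) \<in> uq_sub \<Theta> \<Longrightarrow> antipode x \<in> uq_sub \<Theta>"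
proof (induction rule: uq_sub.induct)
  case (Up a)
  then have "a \<in> {1..CARD('m) + CARD('n) - 1}" using \<Theta> by blast
  then show ?case using Up
    by (subst antipode_gen) (auto intro!: uq_sub.intros qvec.subspace_neg[OF subspace_uq_sub])
next
  case (Down a)
  then have "a \<in> {1..CARD('m) + CARD('n) - 1}" using \<Theta> by blast
  then show ?case using Down
    by (subst antipode_gen) (auto intro!: uq_sub.intros qvec.subspace_neg[OF subspace_uq_sub])
next
  case (mult x y)
  have "antipode (x * y) = (\<Sum>p\<in>{0, 1}. \<Sum>r\<in>{0, 1}. antipode (uq_comp p x * uq_comp r y))"
    by (subst mult_as_components) (simp add: qlinearD[OF qlinear_antipode])
  also have "\<dots> = (\<Sum>p\<in>{0, 1}. \<Sum>r\<in>{0, 1}. sg (p * r) *\<^sub>q (uq_comp r (antipode y) * uq_comp p (antipode x)))"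
    by (simp only: antipode_mult[OF uq_comp_in uq_comp_in] antipode_comp)
  also have "\<dots> \<in> uq_sub \<Theta>"
    by (intro qvec.subspace_sum[OF subspace_uq_sub] uq_sub.scale uq_sub.mult uq_comp_sub mult)
  finally show ?case .
qed (auto simp: antipode_1 antipode_gen qlinearD[OF qlinear_antipode] intro: uq_sub.intros)

text \<open>The equations that define S contain S(x) in place of x. Surjectivity lets every element
  of the sub-superalgebra be written in that form, so that the equations yield the full homomorphism
  property.\<close>

lemma antipode_sub_surj: "(z :: ('m, 'n) uq) \<in> uq_sub \<Theta> \<Longrightarrow> \<exists>x\<in>uq_sub \<Theta>. antipode x = z"
proof (induction rule: uq_sub.induct)
  case one
  then show ?case by (intro bexI[of _ 1]) (auto simp: antipode_1 intro: uq_sub.intros)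
next
  case (Kp b)
  then show ?case by (intro bexI[of _ "uq_gen (Km b)"]) (auto simp: antipode_gen intro: uq_sub.intros)
next
  case (Km b)
  then show ?case by (intro bexI[of _ "uq_gen (Kp b)"]) (auto simp: antipode_gen intro: uq_sub.intros)
next
  case (Up a)
  have a: "a \<in> {1..CARD('m) + CARD('n) - 1}" using Up \<Theta> by blast
  then have a': "Suc a \<in> {1..CARD('m) + CARD('n)}" "a \<in> {1..CARD('m) + CARD('n)}" by auto
  have K: "antipode (uL a * uK (Suc a)) = (uL (Suc a) * uK a :: ('m, 'n) uq)"
    using a' antipode_mult[of "uL a :: ('m, 'n) uq" 0 "uK (Suc a)" 0]
    by (simp add: antipode_gen uq_part_iff uq_twist_gen scaleQ_one)
  have p: "uL a * uK (Suc a) \<in> (uq_part 0 :: ('m, 'n) uq set)"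
    using a' by (simp add: uq_part_iff uq_twist_gen uq_twist_simps scaleQ_one)
  \<comment> \<open>The preimage of E_a is obtained by cancelling the Cartan factor in S(E_a):
    reversal puts the antipode of K_a^(-1) K_(a+1) to the right of S(E_a), where it is inverse to
    that factor.\<close>
  have "antipode (uL a * uK (Suc a) * uE a) = antipode (uE a) * (uL (Suc a) * uK a :: ('m, 'n) uq)"
    using antipode_mult[OF p uq_gen_in_part[of "Up a"]] a by (simp add: K scaleQ_one)
  also have "uL (Suc a) * uK a = (uK a * uL (Suc a) :: ('m, 'n) uq)"
    by (rule uq_KK_commute) (use a' in auto)
  also have "antipode (uE a) * (uK a * uL (Suc a)) = (- uE a :: ('m, 'n) uq)"
  proof -
    have "uKappa' a * uKappa a = (1 :: ('m, 'n) uq)"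
      using uKappa_inverse[OF a a] uKappa_commute(3)[OF a a] by metis
    then show ?thesis using a by (simp add: antipode_gen mult.assoc)
  qed
  finally show ?case using Up a'
    by (intro bexI[of _ "- (uL a * uK (Suc a) * uE a)"])
      (auto simp: qlinearD[OF qlinear_antipode]
        intro!: uq_sub.intros qvec.subspace_neg[OF subspace_uq_sub])
next
  case (Down a)
  have a: "a \<in> {1..CARD('m) + CARD('n) - 1}" using Down \<Theta> by blast
  then have a': "Suc a \<in> {1..CARD('m) + CARD('n)}" "a \<in> {1..CARD('m) + CARD('n)}" by auto
  have K: "antipode (uK a * uL (Suc a)) = (uK (Suc a) * uL a :: ('m, 'n) uq)"
    using a' antipode_mult[of "uK a :: ('m, 'n) uq" 0 "uL (Suc a)" 0]
    by (simp add: antipode_gen uq_part_iff uq_twist_gen scaleQ_one)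
  have p: "uK a * uL (Suc a) \<in> (uq_part 0 :: ('m, 'n) uq set)"
    using a' by (simp add: uq_part_iff uq_twist_gen uq_twist_simps scaleQ_one)
  \<comment> \<open>For F_a the Cartan factor of the antipode stands on the left, so the correction
    is placed on the right of F_a before reversal.\<close>
  have "antipode (uF a * (uK a * uL (Suc a))) = (uK (Suc a) * uL a) * antipode (uF a :: ('m, 'n) uq)"
    using antipode_mult[OF uq_gen_in_part[of "Down a"] p] a by (simp add: K scaleQ_one)
  also have "uK (Suc a) * uL a = (uL a * uK (Suc a) :: ('m, 'n) uq)"
    by (rule uq_KK_commute) (use a' in auto)
  also have "(uL a * uK (Suc a)) * antipode (uF a) = (- uF a :: ('m, 'n) uq)"
  proof -
    have "uKappa' a * uKappa a * uF a = (uF a :: ('m, 'n) uq)"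
      using uKappa_inverse[OF a a] uKappa_commute(3)[OF a a] by (metis mult_1)
    then show ?thesis using a by (simp add: antipode_gen mult.assoc)
  qed
  finally show ?case using Down a'
    by (intro bexI[of _ "- (uF a * (uK a * uL (Suc a)))"])
      (auto simp: qlinearD[OF qlinear_antipode]
        intro!: uq_sub.intros qvec.subspace_neg[OF subspace_uq_sub])
next
  case (add x y)
  then show ?case by (metis qlinearD(1)[OF qlinear_antipode] uq_sub.add)
next
  case (scale x c)
  then show ?case by (metis qlinearD(2)[OF qlinear_antipode] uq_sub.scale)
next
  case (mult x y)
  then obtain u v where uv: "u \<in> uq_sub \<Theta>" "v \<in> uq_sub \<Theta>" "antipode u = x" "antipode v = y"
    by blast
  \<comment> \<open>The product of the preimages in the opposite order. Its signs cancel those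
    produced by the super antimultiplicativity of the antipode.\<close>
  let ?w = "\<Sum>p\<in>{0, 1}. \<Sum>r\<in>{0, 1}. sg (r * p) *\<^sub>q (uq_comp r v * uq_comp p u)"
  have "?w \<in> uq_sub \<Theta>"
    by (intro qvec.subspace_sum[OF subspace_uq_sub] uq_sub.scale uq_sub.mult uq_comp_sub uv)
  moreover have "antipode ?w = (\<Sum>p\<in>{0, 1}. \<Sum>r\<in>{0, 1}. uq_comp p x * uq_comp r y)"
    by (simp only: qpair.linear_sum[OF qlinear_antipode] qlinearD(2)[OF qlinear_antipode]
      antipode_mult[OF uq_comp_in uq_comp_in] sg_mult_scale antipode_comp uv)
  ultimately show ?case unfolding mult_as_components[of x y] by blast
qed

lemma antipode_sub_part_surj:
  assumes "(z :: ('m, 'n) uq) \<in> uq_sub \<Theta>" "z \<in> uq_part p"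
  shows "\<exists>x. x \<in> uq_sub \<Theta> \<and> x \<in> uq_part p \<and> antipode x = z"
proof -
  obtain x where x: "x \<in> uq_sub \<Theta>" "antipode x = z" using antipode_sub_surj assms(1) by blast
  then have "antipode (uq_comp p x) = z" using assms(2) by (simp add: antipode_comp uq_comp_same)
  then show ?thesis using x uq_comp_sub uq_comp_in by blast
qed

end

lemma uq_sub_UNIV: "uq_sub {1..CARD('m) + CARD('n) - 1} = (UNIV :: ('m::finite, 'n::finite) uq set)"
proof -
  have gen: "(uq_gen l :: ('m, 'n) uq) \<in> uq_sub {1..CARD('m) + CARD('n) - 1}"
    if "valid_letter CARD('m) CARD('n) l" for l
    using that by (cases l) (auto intro: uq_sub.intros)
  have "(uq_word gs :: ('m, 'n) uq) \<in> uq_sub {1..CARD('m) + CARD('n) - 1}" for gs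
  proof (induction gs)
    case Nil
    then show ?case by (simp only: uq_word_Nil uq_sub.one)
  next
    case (Cons g gs)
    then show ?case unfolding uq_word_Cons by (intro uq_sub.mult gen valid_Rep_gen)
  qed
  then have "qvec.span (range uq_word) \<subseteq> (uq_sub {1..CARD('m) + CARD('n) - 1} :: ('m, 'n) uq set)"
    by (intro qvec.span_minimal subspace_uq_sub) auto
  then show ?thesis using in_span_uq_words by blast
qed

section \<open>Supermodules\<close>

lemma qlinear_on_image_span:
  assumes "qlinear_on (qvec.span S) f"
  shows "f ` qvec.span S = qvec.span (f ` S)"
proof -
  obtain g where g: "qlinear g" "\<And>v. v \<in> qvec.span S \<Longrightarrow> g v = f v"
    using qlinear_on_extend[OF qvec.subspace_span assms] by metis
  have "g ` qvec.span S = qvec.span (g ` S)"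
    by (rule qpair.linear_span_image[symmetric, OF g(1)])
  moreover have "g ` qvec.span S = f ` qvec.span S" "g ` S = f ` S"
    using g(2) qvec.span_base by (auto simp: image_iff)
  ultimately show ?thesis by simp
qed

lemma qlinear_on_inv_into:
  assumes "qlinear_on D f" "inj_on f D" "qvec.subspace D"
  shows "qlinear_on (f ` D) (inv_into D f)"
proof (rule qlinear_onI)
  fix u v assume "u \<in> f ` D" "v \<in> f ` D"
  then obtain x y where xy: "x \<in> D" "y \<in> D" "u = f x" "v = f y" by blast
  have "f (x + y) = u + v" using xy qlinear_onD(1)[OF assms(1)] by simp
  then show "inv_into D f (u + v) = inv_into D f u + inv_into D f v"
    using xy assms(2) qvec.subspace_add[OF assms(3) xy(1,2)] by (metis inv_into_f_f)
next
  fix c v assume "v \<in> f ` D"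
  then obtain y where y: "y \<in> D" "v = f y" by blast
  have "f (c *\<^sub>q y) = c *\<^sub>q v" using y qlinear_onD(2)[OF assms(1)] by simp
  then show "inv_into D f (c *\<^sub>q v) = c *\<^sub>q inv_into D f v"
    using y assms(2) qvec.subspace_scale[OF assms(3) y(1)] by (metis inv_into_f_f)
qed

text \<open>Matrix elements refer only to modules inside \<open>nat \<Rightarrow> Cq\<close>. Here
  \<open>i\<close> numbers a basis of \<open>W\<close> and \<open>e\<close> lists coordinates; the
  expansion shows in particular that \<open>e\<close> is injective on \<open>W\<close>.\<close>

lemma finite_dim_coordinates:
  fixes W :: "'a::qvec set"
  assumes "qvec.subspace W" "finite_dim W"
  obtains e :: "'a \<Rightarrow> nat \<Rightarrow> Cq" and B i where "qlinear e" "finite B" "B \<subseteq> W"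
    "\<And>u. u \<in> W \<Longrightarrow> u = (\<Sum>b\<in>B. e u (i b) *\<^sub>q b)"
proof -
  obtain B where B: "B \<subseteq> W" "qvec.independent B" "W \<subseteq> qvec.span B"
    by (rule qvec.maximal_independent_subset[of W])
  obtain A where A: "finite A" "W \<subseteq> qvec.span A"
    using assms(2) unfolding finite_dim_def by (elim exE conjE)
  have fin: "finite B"
    using B(1) A qvec.independent_span_bound[OF _ B(2)] by (meson subset_trans)
  obtain i :: "'a \<Rightarrow> nat" where i: "inj_on i B"
    using finite_imp_inj_to_nat_seg[OF fin] by blast
  have "\<exists>e. qlinear e \<and> (\<forall>b\<in>B. e b = (\<lambda>j. if j = i b then 1 else 0 :: Cq))"
    by (rule qpair.linear_independent_extend[OF B(2)])
  then obtain e where e: "qlinear e" "\<And>b. b \<in> B \<Longrightarrow> e b = (\<lambda>j. if j = i b then 1 else 0 :: Cq)"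
    by blast
  have "u = (\<Sum>b\<in>B. e u (i b) *\<^sub>q b)" if u: "u \<in> W" for u
  proof -
    obtain r where r: "u = (\<Sum>b\<in>B. r b *\<^sub>q b)"
      using u B(3) unfolding qvec.span_finite[OF fin] by blast
    have "e u (i b) = r b" if b: "b \<in> B" for b
    proof -
      have "e u (i b) = (\<Sum>b'\<in>B. r b' * (if i b = i b' then 1 else 0))"
        unfolding r qpair.linear_sum[OF e(1)] qlinearD(2)[OF e(1)] sum_apply
        by (intro sum.cong refl) (simp add: e(2) scaleQ_fun_def scaleQ_Cq_def)
      also have "\<dots> = (\<Sum>b'\<in>B. if b' = b then r b else 0)"
        using i b by (intro sum.cong refl) (auto simp: inj_on_def)
      finally show ?thesis using fin b by simp
    qed
    then show ?thesis using r by simp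
  qed
  then show ?thesis using that e(1) fin B(1) by blast
qed

lemma
  assumes "supermodule U M"
  shows supermodule_graded: "graded (part M)"
    and supermodule_linear: "x \<in> U \<Longrightarrow> qlinear_on (scarrier M) (act M x)"
    and supermodule_linear': "v \<in> scarrier M \<Longrightarrow> qlinear_on U (\<lambda>x. act M x v)"
    and supermodule_1: "v \<in> scarrier M \<Longrightarrow> act M 1 v = v"
    and supermodule_mult: "x \<in> U \<Longrightarrow> y \<in> U \<Longrightarrow> v \<in> scarrier M \<Longrightarrow> act M (x * y) v = act M x (act M y v)"
    and supermodule_part: "x \<in> U \<Longrightarrow> x \<in> uq_part p \<Longrightarrow> v \<in> part M r \<Longrightarrow> act M x v \<in> part M (p + r)"
  using assms by (auto simp add: supermodule_def graded_def)

text \<open>Closure under the action is contained in \<open>supermodule\<close> only for homogeneous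
  operators and vectors. In general both are split into components, and those of \<open>x\<close>
  stay in the sub-superalgebra.\<close>

lemma supermodule_act_in:
  fixes M :: "('m::finite, 'n::finite, 'v::qvec) smod"
  assumes M: "supermodule (uq_sub \<Theta>) M" and \<Theta>: "\<Theta> \<subseteq> {1..CARD('m) + CARD('n) - 1}"
    and x: "x \<in> uq_sub \<Theta>" and v: "v \<in> scarrier M"
  shows "act M x v \<in> scarrier M"
proof -
  note G = supermodule_graded[OF M]
  note S = subspace_gsum[OF G, folded scarrier_eq_gsum]
  have xs: "uq_comp p x \<in> uq_sub \<Theta>" for p by (rule uq_comp_sub[OF \<Theta> x])
  have vs: "hcomp (part M) p v \<in> part M p" for p
    using hcomp_in[OF G] v by (simp add: scarrier_eq_gsum)
  then have vc: "hcomp (part M) p v \<in> scarrier M" for p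
    by (auto simp: scarrier_eq_gsum intro: graded_in_gsum[OF G])
  have *: "act M (uq_comp p x) (hcomp (part M) r v) \<in> scarrier M" for p r
    unfolding scarrier_eq_gsum
    by (rule graded_in_gsum[OF G supermodule_part[OF M xs uq_comp_in vs]])
  have "act M x v = act M (uq_comp 0 x + uq_comp 1 x) (hcomp (part M) 0 v + hcomp (part M) 1 v)"
    using hcomp_sum[OF G] v by (simp add: uq_comp_sum scarrier_eq_gsum)
  also have "\<dots> = act M (uq_comp 0 x) (hcomp (part M) 0 v) + act M (uq_comp 1 x) (hcomp (part M) 0 v)
      + (act M (uq_comp 0 x) (hcomp (part M) 1 v) + act M (uq_comp 1 x) (hcomp (part M) 1 v))"
    using qlinear_onD(1)[OF supermodule_linear[OF M uq_sub.add[OF xs xs]] vc vc]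
      qlinear_onD(1)[OF supermodule_linear'[OF M vc] xs xs] by simp
  also have "\<dots> \<in> scarrier M" by (intro qvec.subspace_add[OF S] *)
  finally show ?thesis .
qed

text \<open>The unit law and multiplicativity extend from homogeneous operators and vectors by
  linearity, so computations with signs can be confined to the homogeneous case.\<close>

lemma supermodule_UNIV_I:
  fixes M :: "('m::finite, 'n::finite, 'v::qvec) smod"
  assumes G: "graded (part M)"
    and lin: "\<And>x. qlinear_on (scarrier M) (act M x)"
    and lin': "\<And>v. v \<in> scarrier M \<Longrightarrow> qlinear (\<lambda>x. act M x v)"
    and one: "\<And>p v. v \<in> part M p \<Longrightarrow> act M 1 v = v"
    and mult: "\<And>x y v a d p. x \<in> uq_part a \<Longrightarrow> y \<in> uq_part d \<Longrightarrow> v \<in> part M p \<Longrightarrow>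
        act M (x * y) v = act M x (act M y v)"
    and part: "\<And>x v a p. x \<in> uq_part a \<Longrightarrow> v \<in> part M p \<Longrightarrow> act M x v \<in> part M (a + p)"
  shows "supermodule UNIV M"
proof -
  note S = subspace_gsum[OF G, folded scarrier_eq_gsum]
  have in_c: "v \<in> part M p \<Longrightarrow> v \<in> scarrier M" for v p
    by (simp add: scarrier_eq_gsum graded_in_gsum[OF G])
  have id: "qlinear_on A (\<lambda>x. x)" for A :: "'z::qvec set" by (simp add: qlinear_on_def)
  have ext: "f v = g v" if "qlinear_on (scarrier M) f" "qlinear_on (scarrier M) g"
    "\<And>p v. v \<in> part M p \<Longrightarrow> f v = g v" "v \<in> scarrier M" for f g :: "'v \<Rightarrow> 'v" and v
  proof -
    obtain u w where "v = u + w" "u \<in> part M 0" "w \<in> part M 1"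
      using \<open>v \<in> scarrier M\<close> unfolding scarrier_def by blast
    then show ?thesis
      using qlinear_onD(1)[OF that(1), of u w] qlinear_onD(1)[OF that(2), of u w] in_c that(3) by metis
  qed
  have ext': "f x = g x" if "qlinear f" "qlinear g"
    "\<And>p x. x \<in> uq_part p \<Longrightarrow> f x = g x" for f g :: "('m, 'n) uq \<Rightarrow> 'v" and x
  proof -
    have "f x = f (uq_comp 0 x) + f (uq_comp 1 x)" "g x = g (uq_comp 0 x) + g (uq_comp 1 x)"
      by (metis uq_comp_sum qlinearD(1)[OF that(1)]) (metis uq_comp_sum qlinearD(1)[OF that(2)])
    then show ?thesis using that(3) uq_comp_in by metis
  qed
  have act_in: "act M x v \<in> scarrier M" if "v \<in> part M p" for x v p
  proof -
    have "act M x v = act M (uq_comp 0 x) v + act M (uq_comp 1 x) v"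
      using qlinearD(1)[OF lin'[OF in_c[OF that]], of "uq_comp 0 x" "uq_comp 1 x"] by (simp add: uq_comp_sum)
    then show ?thesis
      using in_c[OF part[OF uq_comp_in that]] by (simp add: qvec.subspace_add[OF S])
  qed
  have act_in': "act M x v \<in> scarrier M" if v: "v \<in> scarrier M" for x v
  proof -
    obtain u w where "v = u + w" "u \<in> part M 0" "w \<in> part M 1"
      using v unfolding scarrier_def by blast
    then show ?thesis
      using qlinear_onD(1)[OF lin, of u w x] in_c act_in qvec.subspace_add[OF S] by metis
  qed
  have m1: "act M (x * y) v = act M x (act M y v)" if "v \<in> part M p" for x y v p
  proof (rule ext'[of "\<lambda>x. act M (x * y) v" "\<lambda>x. act M x (act M y v)"])
    note v = in_c[OF that]
    show "qlinear (\<lambda>x. act M (x * y) v)"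
      by (rule qlinearI) (simp_all add: distrib_right uq_scale_mult qlinearD[OF lin'[OF v]])
    show "qlinear (\<lambda>x. act M x (act M y v))" by (rule lin'[OF act_in[OF that]])
    fix a x assume x: "(x :: ('m, 'n) uq) \<in> uq_part a"
    show "act M (x * y) v = act M x (act M y v)"
    proof (rule ext'[of "\<lambda>y. act M (x * y) v" "\<lambda>y. act M x (act M y v)"])
      show "qlinear (\<lambda>y. act M (x * y) v)"
        by (rule qlinearI) (simp_all add: distrib_left uq_scale_mult qlinearD[OF lin'[OF v]])
      show "qlinear (\<lambda>y. act M x (act M y v))"
        by (rule qlinearI) (simp_all add: qlinearD[OF lin'[OF v]] qlinear_onD[OF lin] act_in[OF that])
    qed (rule mult[OF x _ that])
  qed
  have "act M (x * y) v = act M x (act M y v)" if "v \<in> scarrier M" for x y v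
    by (rule ext[OF lin qlinear_on_compose[OF lin _ lin] m1 that]) (auto intro: act_in')
  moreover have "act M 1 v = v" if "v \<in> scarrier M" for v
    by (rule ext[OF lin id one that])
  moreover have "qlinear_on UNIV (\<lambda>x. act M x v)" if "v \<in> scarrier M" for v
    using lin'[OF that] by (simp only: qlinear_iff)
  ultimately show ?thesis
    unfolding supermodule_def using G[unfolded graded_def] lin part by simp
qed

text \<open>The structure of \<open>N\<close> is pulled back along \<open>f\<close>. The subspace
  \<open>D\<close> may exceed the carrier of \<open>M\<close>, because the values of the action are
  at first only known to lie in \<open>D\<close>; that they lie in the carrier follows from
  \<open>N\<close>. The lemma serves to copy finite dimensional modules into
  \<open>nat \<Rightarrow> Cq\<close> and to pass from maps back to tensors.\<close>

lemma cat_obj_transport: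
  fixes M :: "('m::finite, 'n::finite, 'v::qvec) smod" and N :: "('m, 'n, 'w::qvec) smod"
  assumes N: "cat_obj \<Theta> N" and \<Theta>: "\<Theta> \<subseteq> {1..CARD('m) + CARD('n) - 1}"
    and f: "qlinear_on D f" "inj_on f D" "qvec.subspace D"
    and part: "\<And>p. part M p \<subseteq> D" "\<And>p. f ` part M p = part N p"
    and act: "\<And>x v. x \<in> uq_sub \<Theta> \<Longrightarrow> v \<in> scarrier M \<Longrightarrow> act M x v \<in> D"
      "\<And>x v. x \<in> uq_sub \<Theta> \<Longrightarrow> v \<in> scarrier M \<Longrightarrow> f (act M x v) = act N x (f v)"
  shows "cat_obj \<Theta> M"
proof -
  have smN: "supermodule (uq_sub \<Theta>) N" using N by (simp add: cat_obj_def)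
  note GN = supermodule_graded[OF smN]
  note f0 = qlinear_on_0[OF f(1,3)]
  have part_iff: "v \<in> part M p \<longleftrightarrow> v \<in> D \<and> f v \<in> part N p" for v p
  proof
    assume "v \<in> part M p"
    then show "v \<in> D \<and> f v \<in> part N p" using part(1) part(2)[of p] by blast
  next
    assume v: "v \<in> D \<and> f v \<in> part N p"
    then obtain u where u: "u \<in> part M p" "f u = f v" using part(2)[of p] by force
    then have "u = v" using inj_onD[OF f(2) u(2)] part(1) v by blast
    then show "v \<in> part M p" using u by simp
  qed
  have sub: "qvec.subspace (part M p)" for p
  proof -
    have *: "part M p = {v. v \<in> D \<and> f v \<in> part N p}" using part_iff by blast
    show ?thesis
      unfolding * using f0 f(3) graded_subspace[OF GN, of p]
      by (simp add: qvec.subspace_def qlinear_onD[OF f(1)])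
  qed
  have "part M 0 \<inter> part M 1 = {0}"
  proof -
    have "v = 0" if "v \<in> part M 0" "v \<in> part M 1" for v
    proof -
      have "f v = f 0" using that graded_disjoint[OF GN, of "f v" 0] by (simp add: part_iff f0)
      then show ?thesis using that inj_onD[OF f(2)] qvec.subspace_0[OF f(3)] by (simp add: part_iff)
    qed
    then show ?thesis using qvec.subspace_0[OF sub] by blast
  qed
  then have G: "graded (part M)" using sub by (simp add: graded_def)
  note S = subspace_gsum[OF G, folded scarrier_eq_gsum]
  note SN = subspace_gsum[OF GN, folded scarrier_eq_gsum]
  have inD: "v \<in> D" and fin: "f v \<in> scarrier N" if v: "v \<in> scarrier M" for v
  proof -
    obtain u w where "v = u + w" "u \<in> part M 0" "w \<in> part M 1"
      using v unfolding scarrier_def by blast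
    then have "u \<in> D" "w \<in> D" "f u \<in> part N 0" "f w \<in> part N 1" "v = u + w"
      by (simp_all add: part_iff)
    then show "v \<in> D" "f v \<in> scarrier N"
      using qvec.subspace_add[OF f(3)] unfolding scarrier_def
      by (simp, auto simp: qlinear_onD(1)[OF f(1)])
  qed
  have carrier: "v \<in> scarrier M" if v: "v \<in> D" "f v \<in> scarrier N" for v
  proof -
    obtain u w where uw: "f v = u + w" "u \<in> part N 0" "w \<in> part N 1"
      using v(2) unfolding scarrier_def by blast
    obtain u' where u': "u = f u'" "u' \<in> part M 0" using uw(2) unfolding part(2)[symmetric] by blast
    obtain w' where w': "w = f w'" "w' \<in> part M 1" using uw(3) unfolding part(2)[symmetric] by blast
    note uw' = u'(1) w'(1) u'(2) w'(2)
    have D: "u' \<in> D" "w' \<in> D" using uw' part_iff by simp_all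
    then have "f v = f (u' + w')" using uw uw' by (simp add: qlinear_onD(1)[OF f(1)])
    then have "v = u' + w'"
      by (rule inj_onD[OF f(2) _ v(1) qvec.subspace_add[OF f(3) D]])
    then show ?thesis using uw' unfolding scarrier_def by blast
  qed
  have surj: "\<exists>v\<in>scarrier M. f v = w" if w: "w \<in> scarrier N" for w
  proof -
    obtain u z where uw: "w = u + z" "u \<in> part N 0" "z \<in> part N 1"
      using w unfolding scarrier_def by blast
    obtain u' where u': "u = f u'" "u' \<in> part M 0" using uw(2) unfolding part(2)[symmetric] by blast
    obtain z' where z': "z = f z'" "z' \<in> part M 1" using uw(3) unfolding part(2)[symmetric] by blast
    have "u' \<in> D" "z' \<in> D" using u' z' part_iff by simp_all
    then have "f (u' + z') = w" using uw u' z' by (simp add: qlinear_onD(1)[OF f(1)])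
    then show ?thesis using u' z' unfolding scarrier_def by blast
  qed
  note inj = inj_onD[OF f(2)]
  have act_in: "act M x v \<in> scarrier M" if "x \<in> uq_sub \<Theta>" "v \<in> scarrier M" for x v
    by (rule carrier[OF act(1)[OF that]])
      (simp add: act(2)[OF that] supermodule_act_in[OF smN \<Theta> that(1) fin[OF that(2)]])
  have add: "u + v \<in> scarrier M" "c *\<^sub>q v \<in> scarrier M"
    if "u \<in> scarrier M" "v \<in> scarrier M" for u v c
    using that by (simp_all add: qvec.subspace_add[OF S] qvec.subspace_scale[OF S])
  have eqI: "u = v" if "u \<in> scarrier M" "v \<in> scarrier M" "f u = f v" for u v
    using inj[OF that(3) inD[OF that(1)] inD[OF that(2)]] .
  have flin: "f (u + v) = f u + f v" "f (c *\<^sub>q v) = c *\<^sub>q f v"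
    if "u \<in> scarrier M" "v \<in> scarrier M" for u v c
    by (simp_all add: qlinear_onD[OF f(1)] inD[OF that(1)] inD[OF that(2)])
  note simps = flin act act_in add fin
  have "supermodule (uq_sub \<Theta>) M"
    unfolding supermodule_def
  proof (intro conjI allI ballI)
    show "qvec.subspace (part M p)" for p by (rule sub)
    show "part M 0 \<inter> part M 1 = {0}" by fact
  next
    fix x :: "('m, 'n) uq" assume x: "x \<in> uq_sub \<Theta>"
    show "qlinear_on (scarrier M) (act M x)"
    proof (rule qlinear_onI)
      fix u v assume uv: "u \<in> scarrier M" "v \<in> scarrier M"
      show "act M x (u + v) = act M x u + act M x v"
        by (rule eqI) (use x uv in \<open>simp_all add: simps qlinear_onD[OF supermodule_linear[OF smN]]\<close>)
    next
      fix c v assume uv: "v \<in> scarrier M"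
      show "act M x (c *\<^sub>q v) = c *\<^sub>q act M x v"
        by (rule eqI) (use x uv in \<open>simp_all add: simps qlinear_onD[OF supermodule_linear[OF smN]]\<close>)
    qed
  next
    fix v assume v: "v \<in> scarrier M"
    show "qlinear_on (uq_sub \<Theta>) (\<lambda>x. act M x v)"
    proof (rule qlinear_onI)
      fix x y :: "('m, 'n) uq" assume xy: "x \<in> uq_sub \<Theta>" "y \<in> uq_sub \<Theta>"
      show "act M (x + y) v = act M x v + act M y v"
        by (rule eqI) (use v xy in \<open>simp_all add: simps uq_sub.add qlinear_onD[OF supermodule_linear'[OF smN]]\<close>)
    next
      fix c and x :: "('m, 'n) uq" assume xy: "x \<in> uq_sub \<Theta>"
      show "act M (c *\<^sub>q x) v = c *\<^sub>q act M x v"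
        by (rule eqI) (use v xy in \<open>simp_all add: simps uq_sub.scale qlinear_onD[OF supermodule_linear'[OF smN]]\<close>)
    qed
    show "act M 1 v = v"
      by (rule eqI) (use v in \<open>simp_all add: simps uq_sub.one supermodule_1[OF smN]\<close>)
  next
    fix x y :: "('m, 'n) uq" and v assume "x \<in> uq_sub \<Theta>" "y \<in> uq_sub \<Theta>" "v \<in> scarrier M"
    then show "act M (x * y) v = act M x (act M y v)"
      by (intro eqI) (simp_all add: simps uq_sub.mult supermodule_mult[OF smN])
  next
    fix p r and x :: "('m, 'n) uq" and v assume x: "x \<in> uq_sub \<Theta> \<inter> uq_part p" and v: "v \<in> part M r"
    have vc: "v \<in> scarrier M" using v graded_in_gsum[OF G] by (simp add: scarrier_eq_gsum)
    have "f v \<in> part N r" using v by (simp add: part_iff)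
    then show "act M x v \<in> part M (p + r)"
      unfolding part_iff using x supermodule_part[OF smN _ _ \<open>f v \<in> part N r\<close>, of x p] act vc by auto
  qed
  moreover have "scarrier M = qvec.span {v. (\<exists>\<mu>. integral_weight_vec M \<mu> v) \<and>
      finite_dim ((\<lambda>x. act M x v) ` uq_sub \<Theta>)}" (is "_ = qvec.span ?G")
  proof
    have Gs: "?G \<subseteq> scarrier M" by (auto simp: integral_weight_vec_def)
    then show "qvec.span ?G \<subseteq> scarrier M" by (rule qvec.span_minimal[OF _ S])
    have GsD: "qvec.span ?G \<subseteq> D" using qvec.span_minimal[OF Gs S] inD by blast
    let ?H = "{v. (\<exists>\<mu>. integral_weight_vec N \<mu> v) \<and>
      finite_dim ((\<lambda>x. act N x v) ` uq_sub \<Theta>)}"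
    have HG: "?H \<subseteq> f ` ?G"
    proof
      fix w assume w: "w \<in> ?H"
      then obtain \<mu> where \<mu>: "integral_weight_vec N \<mu> w" by blast
      then obtain v where v: "v \<in> scarrier M" "f v = w"
        using surj by (auto simp: integral_weight_vec_def)
      have "act M (uq_gen (Kp a)) v = power_int qq (wform CARD('m) CARD('n) \<mu> (eps a)) *\<^sub>q v"
        if "a \<in> {1..CARD('m) + CARD('n)}" for a
        by (rule eqI) (use \<mu> v that uq_sub.Kp[OF that] in \<open>simp_all add: simps integral_weight_vec_def\<close>)
      then have "integral_weight_vec M \<mu> v" using v by (simp add: integral_weight_vec_def)
      moreover have "finite_dim ((\<lambda>x. act M x v) ` uq_sub \<Theta>)"
      proof -
        have *: "(\<lambda>x. act N x w) ` uq_sub \<Theta> \<subseteq> f ` D"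
          using v act(1)[OF _ v(1)] act(2)[OF _ v(1)] by force
        have "finite_dim (inv_into D f ` (\<lambda>x. act N x w) ` uq_sub \<Theta>)"
          by (rule finite_dim_image[OF _ qlinear_on_inv_into[OF f] * qlinear_on_image_subspace[OF f(1,3)]])
            (use w in simp)
        moreover have "inv_into D f (act N x w) = act M x v" if "x \<in> uq_sub \<Theta>" for x
          using act[OF that v(1)] v(2) inv_into_f_f[OF f(2), of "act M x v"] by simp
        ultimately show ?thesis by (simp add: image_image)
      qed
      ultimately show "w \<in> f ` ?G" using v(2) by blast
    qed
    have N_span: "scarrier N = qvec.span ?H" using N by (simp add: cat_obj_def)
    have "scarrier N \<subseteq> qvec.span (f ` ?G)" unfolding N_span by (rule qvec.span_mono[OF HG])
    also have "\<dots> = f ` qvec.span ?G"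
      by (rule qlinear_on_image_span[symmetric]) (rule qlinear_on_subset[OF f(1) GsD])
    finally have sub: "scarrier N \<subseteq> f ` qvec.span ?G" .
    show "scarrier M \<subseteq> qvec.span ?G"
    proof
      fix v assume v: "v \<in> scarrier M"
      then obtain u where u: "u \<in> qvec.span ?G" "f v = f u" using sub fin by blast
      then have "v = u" using inj[OF u(2) inD[OF v]] GsD by blast
      then show "v \<in> qvec.span ?G" using u(1) by simp
    qed
  qed
  ultimately show ?thesis by (simp only: cat_obj_def)
qed

section \<open>The coordinate algebra\<close>

lemma qlinear_precomp: "qlinear (\<lambda>f. \<lambda>x. f (h x))"
  by (rule qlinearI) (simp_all add: fun_eq_iff scaleQ_fun_def)

lemma Ag_closed:
  assumes "qlinear T" "\<And>f. f \<in> matrix_elements \<Longrightarrow> T f \<in> Ag" "f \<in> Ag"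
  shows "T f \<in> Ag"
  using qlinear_on_image_span_subset[OF qlinear_imp_on[OF assms(1)], of matrix_elements Ag f] assms(2,3)
  by (simp add: Ag_def)

lemma subspace_Ag: "qvec.subspace Ag"
  unfolding Ag_def by (rule qvec.subspace_span)

lemma matrix_elementI:
  fixes M :: "('m::finite, 'n::finite, nat \<Rightarrow> Cq) smod"
  assumes "cat_obj {1..CARD('m) + CARD('n) - 1} M" "finite_dim (scarrier M)" "v \<in> scarrier M"
    "qlinear w"
  shows "(\<lambda>x. w (act M x v)) \<in> matrix_elements"
  unfolding matrix_elements_def using assms by blast

lemma matrix_elementE:
  assumes "f \<in> matrix_elements"
  obtains M :: "('m::finite, 'n::finite, nat \<Rightarrow> Cq) smod" and v w where
    "cat_obj {1..CARD('m) + CARD('n) - 1} M" "finite_dim (scarrier M)" "v \<in> scarrier M" "qlinear w"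
    "f = (\<lambda>x. w (act M x v))" "supermodule UNIV M" "qvec.subspace (scarrier M)"
    "\<And>x v. v \<in> scarrier M \<Longrightarrow> act M x v \<in> scarrier M"
proof -
  obtain M :: "('m::finite, 'n::finite, nat \<Rightarrow> Cq) smod" and v w where
    M: "cat_obj {1..CARD('m) + CARD('n) - 1} M" "finite_dim (scarrier M)" "v \<in> scarrier M" "qlinear w"
    "f = (\<lambda>x. w (act M x v))"
    using assms unfolding matrix_elements_def by blast
  have sm: "supermodule UNIV M" using M(1) unfolding cat_obj_def uq_sub_UNIV by blast
  show thesis
  proof (rule that[OF M sm])
    show "qvec.subspace (scarrier M)"
      unfolding scarrier_eq_gsum by (rule subspace_gsum[OF supermodule_graded[OF sm]])
    show "act M x v \<in> scarrier M" if "v \<in> scarrier M" for x v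
      by (rule supermodule_act_in[where \<Theta> = "{1..CARD('m) + CARD('n) - 1}"])
        (use sm that in \<open>simp_all add: uq_sub_UNIV del: One_nat_def\<close>)
  qed
qed

lemma matrix_element_in_Ag: "f \<in> matrix_elements \<Longrightarrow> f \<in> Ag"
  unfolding Ag_def by (rule qvec.span_base)

lemma qlinear_Ag:
  fixes f :: "('a::finite, 'b::finite) uq \<Rightarrow> Cq"
  assumes "f \<in> Ag" shows "qlinear f"
proof -
  have "matrix_elements \<subseteq> {f :: ('a, 'b) uq \<Rightarrow> Cq. qlinear f}"
  proof
    fix f :: "('a, 'b) uq \<Rightarrow> Cq" assume "f \<in> matrix_elements"
    then show "f \<in> {f. qlinear f}"
    proof (rule matrix_elementE)
      fix M :: "('a, 'b, nat \<Rightarrow> Cq) smod" and v w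
      assume "qlinear w" "f = (\<lambda>x. w (act M x v))" "supermodule UNIV M" "v \<in> scarrier M"
      then show ?thesis
        using qlinear_on_compose[OF supermodule_linear' _ qlinear_imp_on, of UNIV M v UNIV w]
        by (simp add: qlinear_iff)
    qed
  qed
  moreover have "qvec.subspace {f :: ('a, 'b) uq \<Rightarrow> Cq. qlinear f}"
    by (auto simp: qvec.subspace_def scaleQ_fun_def algebra_simps scaleQ_Cq_def qlinearD
        intro!: qlinearI)
  ultimately show ?thesis using assms qvec.span_minimal unfolding Ag_def by blast
qed

text \<open>Left translation by \<open>z\<close> replaces the functional \<open>w\<close> by w after
  z. The latter is linear only on the carrier, hence the extension \<open>w'\<close>.\<close>

lemma Ag_left_mult:
  fixes f :: "('a::finite, 'b::finite) uq \<Rightarrow> Cq"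
  assumes "f \<in> Ag" shows "(\<lambda>x. f (z * x)) \<in> Ag"
proof (rule Ag_closed[OF qlinear_precomp _ assms])
  fix f :: "('a, 'b) uq \<Rightarrow> Cq" assume "f \<in> matrix_elements"
  then show "(\<lambda>x. f (z * x)) \<in> Ag"
  proof (rule matrix_elementE)
    fix M :: "('a, 'b, nat \<Rightarrow> Cq) smod" and v w
    assume M: "cat_obj {1..CARD('a) + CARD('b) - 1} M" "finite_dim (scarrier M)" "v \<in> scarrier M"
      "qlinear w" "f = (\<lambda>x. w (act M x v))" "supermodule UNIV M" "qvec.subspace (scarrier M)"
      "\<And>x v. v \<in> scarrier M \<Longrightarrow> act M x v \<in> scarrier M"
    have "qlinear_on (scarrier M) (\<lambda>u. w (act M z u))"
      using qlinear_on_compose[OF supermodule_linear[OF M(6)] _ qlinear_imp_on[OF M(4)], of z UNIV]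
      by simp
    then obtain w' where w': "qlinear w'" "\<And>u. u \<in> scarrier M \<Longrightarrow> w' u = w (act M z u)"
      using qlinear_on_extend[OF M(7)] by metis
    have "(\<lambda>x. f (z * x)) = (\<lambda>x. w' (act M x v))"
      using M(3,8) by (simp add: fun_eq_iff M(5) w'(2) supermodule_mult[OF M(6)])
    then show ?thesis
      using matrix_elementI[OF M(1-3) w'(1)] by (simp add: matrix_element_in_Ag)
  qed
qed

text \<open>Right translation by \<open>z\<close> replaces the vector \<open>v\<close> by its image
  under \<open>z\<close>.\<close>

lemma Ag_right_mult:
  fixes f :: "('a::finite, 'b::finite) uq \<Rightarrow> Cq"
  assumes "f \<in> Ag" shows "(\<lambda>x. f (x * z)) \<in> Ag"
proof (rule Ag_closed[OF qlinear_precomp _ assms])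
  fix f :: "('a, 'b) uq \<Rightarrow> Cq" assume "f \<in> matrix_elements"
  then show "(\<lambda>x. f (x * z)) \<in> Ag"
  proof (rule matrix_elementE)
    fix M :: "('a, 'b, nat \<Rightarrow> Cq) smod" and v w
    assume M: "cat_obj {1..CARD('a) + CARD('b) - 1} M" "finite_dim (scarrier M)" "v \<in> scarrier M"
      "qlinear w" "f = (\<lambda>x. w (act M x v))" "supermodule UNIV M" "qvec.subspace (scarrier M)"
      "\<And>x v. v \<in> scarrier M \<Longrightarrow> act M x v \<in> scarrier M"
    have "(\<lambda>x. f (x * z)) = (\<lambda>x. w (act M x (act M z v)))"
      using M(3) by (simp add: fun_eq_iff M(5) supermodule_mult[OF M(6)])
    then show ?thesis
      using matrix_elementI[OF M(1,2) M(8)[OF M(3)] M(4)] by (simp add: matrix_element_in_Ag)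
  qed
qed

text \<open>Precomposing the action with the parity automorphism gives a module on the same graded
  space. Every K_a is even, so weights do not change, and \<open>uq_twist\<close> is onto, so orbits
  do not change either.\<close>

lemma Ag_twist:
  fixes f :: "('a::finite, 'b::finite) uq \<Rightarrow> Cq"
  assumes "f \<in> Ag" shows "(\<lambda>x. f (uq_twist x)) \<in> Ag"
proof (rule Ag_closed[OF qlinear_precomp _ assms])
  fix f :: "('a, 'b) uq \<Rightarrow> Cq" assume "f \<in> matrix_elements"
  then show "(\<lambda>x. f (uq_twist x)) \<in> Ag"
  proof (rule matrix_elementE)
    fix M :: "('a, 'b, nat \<Rightarrow> Cq) smod" and v w
    assume M: "cat_obj {1..CARD('a) + CARD('b) - 1} M" "finite_dim (scarrier M)" "v \<in> scarrier M"
      "qlinear w" "f = (\<lambda>x. w (act M x v))" "supermodule UNIV M" "qvec.subspace (scarrier M)"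
      "\<And>x v. v \<in> scarrier M \<Longrightarrow> act M x v \<in> scarrier M"
    define M' where "M' = M \<lparr> act := (\<lambda>x. act M (uq_twist x)) \<rparr>"
    have sc: "scarrier M' = scarrier M" by (simp add: scarrier_eq_gsum M'_def)
    have act': "act M' x = act M (uq_twist x)" for x by (simp add: M'_def)
    have part': "part M' = part M" by (simp add: M'_def)
    have "supermodule UNIV M'"
    proof (rule supermodule_UNIV_I, unfold part' act' sc)
      show "graded (part M)" by (rule supermodule_graded[OF M(6)])
      show "qlinear_on (scarrier M) (act M (uq_twist x))" for x
        by (rule supermodule_linear[OF M(6)]) simp
      show "qlinear (\<lambda>x. act M (uq_twist x) v)" if "v \<in> scarrier M" for v
        using qlinear_on_compose[OF qlinear_imp_on[OF qlinear_uq_twist] _ supermodule_linear'[OF M(6) that], of UNIV]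
        by (simp add: qlinear_iff)
      have sc: "v \<in> part M p \<Longrightarrow> v \<in> scarrier M" for v p
        by (simp add: scarrier_eq_gsum graded_in_gsum[OF supermodule_graded[OF M(6)]])
      then show "v \<in> part M p \<Longrightarrow> act M (uq_twist 1) v = v" for v p
        using supermodule_1[OF M(6)] by (simp add: uq_twist_1)
      show "act M (uq_twist (x * y)) v = act M (uq_twist x) (act M (uq_twist y) v)"
        if "v \<in> part M p" for x y v p
        using sc[OF that] by (simp add: uq_twist_mult supermodule_mult[OF M(6)])
      show "act M (uq_twist x) v \<in> part M (a + p)" if "x \<in> uq_part a" "v \<in> part M p" for x v a p
        using that by (intro supermodule_part[OF M(6)]) (auto simp: uq_part_iff uq_twist_twist uq_twist_simps)
    qed
    moreover have "range (\<lambda>x. act M (uq_twist x) v) = range (\<lambda>x. act M x v)" for v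
    proof -
      have "(\<lambda>x. act M x v) ` range uq_twist = range (\<lambda>x. act M x v)"
        by (simp only: surjI[of "uq_twist :: ('a, 'b) uq \<Rightarrow> _", OF uq_twist_twist])
      then show ?thesis by (simp only: image_image)
    qed
    moreover have "integral_weight_vec M' \<mu> v \<longleftrightarrow> integral_weight_vec M \<mu> v" for \<mu> v
      unfolding integral_weight_vec_def sc act' by (simp add: uq_twist_gen scaleQ_one)
    ultimately have "cat_obj {1..CARD('a) + CARD('b) - 1} M'"
      using M(1) unfolding cat_obj_def sc act' uq_sub_UNIV by simp
    then have "(\<lambda>x. w (act M' x v)) \<in> matrix_elements"
      by (rule matrix_elementI) (simp_all add: sc M)
    moreover have "(\<lambda>x. f (uq_twist x)) = (\<lambda>x. w (act M' x v))"
      by (simp add: M(5) act')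
    ultimately show ?thesis by (simp add: matrix_element_in_Ag)
  qed
qed

lemma Ag_comp: assumes "f \<in> Ag" shows "(\<lambda>x. f (uq_comp p x)) \<in> Ag"
proof -
  have "(\<lambda>x. f (uq_comp p x)) = inverse 2 *\<^sub>q (f + sg p *\<^sub>q (\<lambda>x. f (uq_twist x)))"
    by (simp add: fun_eq_iff uq_comp_eq qlinearD[OF qlinear_Ag[OF assms]] scaleQ_fun_def)
  then show ?thesis
    by (simp add: qvec.subspace_scale[OF subspace_Ag] qvec.subspace_add[OF subspace_Ag] assms
        Ag_twist[OF assms])
qed

text \<open>By \<open>Ag_comp\<close> the functions in \<open>Ag\<close> split by the parity of
  their argument. This makes \<open>dL\<close>, which is defined through components of
  \<open>f\<close>, computable by components in the algebra.\<close>

lemma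
  fixes f :: "('a::finite, 'b::finite) uq \<Rightarrow> Cq"
  shows graded_Ag_part: "graded (Ag_part :: bit \<Rightarrow> (('a, 'b) uq \<Rightarrow> Cq) set)"
    and gsum_Ag_part: "gsum Ag_part = (Ag :: (('a, 'b) uq \<Rightarrow> Cq) set)"
    and hcomp_Ag_part: "f \<in> Ag \<Longrightarrow> hcomp Ag_part p f = (\<lambda>x. f (uq_comp p x))"
proof -
  have sub: "qvec.subspace (Ag_part p)" for p
    using subspace_Ag unfolding qvec.subspace_def Ag_part_def
    by (auto simp: scaleQ_fun_def scaleQ_Cq_def)
  have "f = 0" if "f \<in> Ag_part 0" "f \<in> Ag_part 1" for f :: "('a, 'b) uq \<Rightarrow> Cq"
  proof
    fix x
    have "f x = f (uq_comp 0 x) + f (uq_comp 1 x)"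
      using qlinearD(1)[OF qlinear_Ag, of f "uq_comp 0 x" "uq_comp 1 x"] that
      by (simp add: uq_comp_sum Ag_part_def)
    then show "f x = 0 x" using that uq_comp_in[of 0 x] uq_comp_in[of 1 x] by (simp add: Ag_part_def)
  qed
  then show G: "graded (Ag_part :: bit \<Rightarrow> (('a, 'b) uq \<Rightarrow> Cq) set)"
    using sub by (auto simp: graded_def qvec.subspace_0)
  have c: "(\<lambda>x. f (uq_comp p x)) \<in> Ag_part p" if "f \<in> Ag" for f :: "('a, 'b) uq \<Rightarrow> Cq" and p
    using Ag_comp[OF that] by (auto simp: Ag_part_def uq_comp_other qlinearD[OF qlinear_Ag[OF that]])
  have s: "f - (\<lambda>x. f (uq_comp p x)) = (\<lambda>x. f (uq_comp (p + 1) x))"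
    if "f \<in> Ag" for f :: "('a, 'b) uq \<Rightarrow> Cq" and p
  proof
    fix x
    have "f x = f (uq_comp 0 x) + f (uq_comp 1 x)"
      using qlinearD(1)[OF qlinear_Ag[OF that], of "uq_comp 0 x" "uq_comp 1 x"] by (simp add: uq_comp_sum)
    then show "(f - (\<lambda>x. f (uq_comp p x))) x = f (uq_comp (p + 1) x)" by (cases p) simp_all
  qed
  show "hcomp Ag_part p f = (\<lambda>x. f (uq_comp p x))" if "f \<in> Ag"
    by (rule hcompI[OF G c[OF that]]) (simp only: s[OF that] c[OF that])
  show "gsum Ag_part = (Ag :: (('a, 'b) uq \<Rightarrow> Cq) set)"
  proof
    show "gsum Ag_part \<subseteq> (Ag :: (('a, 'b) uq \<Rightarrow> Cq) set)"
      using qvec.subspace_add[OF subspace_Ag] by (auto simp: gsum_def Ag_part_def)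
    show "(Ag :: (('a, 'b) uq \<Rightarrow> Cq) set) \<subseteq> gsum Ag_part"
    proof
      fix f :: "('a, 'b) uq \<Rightarrow> Cq" assume f: "f \<in> Ag"
      have "f = (\<lambda>x. f (uq_comp 0 x)) + (\<lambda>x. f (uq_comp 1 x))"
        using s[OF f, of 0] by (metis add_0 add_diff_cancel_left' diff_add_cancel add.commute)
      then show "f \<in> gsum Ag_part" unfolding gsum_def using c[OF f] by blast
    qed
  qed
qed

section \<open>Simultaneous eigenvectors\<close>

declare add_bit_eq_xor [simp del] mult_bit_eq_and [simp del]

definition eigenspace :: "('k \<Rightarrow> 'v \<Rightarrow> 'v) \<Rightarrow> 'k set \<Rightarrow> ('k \<Rightarrow> Cq) \<Rightarrow> 'v::qvec set" where
  "eigenspace T J \<chi> = {v. \<forall>k\<in>J. T k v = \<chi> k *\<^sub>q v}"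

lemma subspace_eigenspace:
  assumes "\<And>k. qlinear (T k)" shows "qvec.subspace (eigenspace T J \<chi>)"
  by (simp add: qvec.subspace_def eigenspace_def qlinearD[OF assms] scaleQ_add_right
      qvec.scale_left_commute)

text \<open>Eigenvectors with the same character are merged, so that the remaining summands have
  pairwise different characters.\<close>

lemma eigenvector_sum:
  assumes T: "\<And>k. qlinear (T k)"
    and v: "v \<in> qvec.span (\<Union>\<chi>\<in>C. eigenspace T J \<chi>)"
  shows "\<exists>F w. finite F \<and> F \<subseteq> C \<and> (\<forall>\<chi>\<in>F. w \<chi> \<in> eigenspace T J \<chi>) \<and> v = (\<Sum>\<chi>\<in>F. w \<chi>)"
  using v
proof (induction rule: qvec.span_induct_alt)
  case base
  then show ?case by (intro exI[of _ "{}"]) simp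
next
  case (step c x y)
  obtain F w where w: "finite F" "F \<subseteq> C" "\<forall>\<chi>\<in>F. w \<chi> \<in> eigenspace T J \<chi>" "y = (\<Sum>\<chi>\<in>F. w \<chi>)"
    using step by blast
  obtain \<chi>\<^sub>0 where \<chi>\<^sub>0: "\<chi>\<^sub>0 \<in> C" "x \<in> eigenspace T J \<chi>\<^sub>0" using step by blast
  note S = subspace_eigenspace[OF T]
  define w' where "w' = (\<lambda>\<chi>. (if \<chi> \<in> F then w \<chi> else 0) + (if \<chi> = \<chi>\<^sub>0 then c *\<^sub>q x else 0))"
  have "w' \<chi> \<in> eigenspace T J \<chi>" for \<chi>
    unfolding w'_def using w(3) \<chi>\<^sub>0(2)
    by (auto intro!: qvec.subspace_add[OF S] qvec.subspace_scale[OF S] qvec.subspace_0[OF S])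
  moreover have "c *\<^sub>q x + y = (\<Sum>\<chi>\<in>insert \<chi>\<^sub>0 F. w' \<chi>)"
  proof -
    have "(\<Sum>\<chi>\<in>insert \<chi>\<^sub>0 F. if \<chi> \<in> F then w \<chi> else 0) = y"
      unfolding w(4) using w(1) by (intro sum.mono_neutral_cong_right) auto
    then show ?thesis using w(1) by (simp add: w'_def sum.distrib del: sum.insert)
  qed
  ultimately show ?case using w(1,2) \<chi>\<^sub>0(1)
    by (intro exI[of _ "insert \<chi>\<^sub>0 F"] exI[of _ w']) auto
qed

text \<open>A sum of eigenvectors with pairwise different eigencharacters lies in an invariant subspace only
  if all summands do: applying \<open>T k - \<chi> k\<close> removes the summand with character \<open>\<chi>\<close>.\<close>

lemma eigenvector_sum_in_subspace:
  assumes T: "\<And>k. qlinear (T k)" and L: "qvec.subspace L" "\<And>k v. k \<in> J \<Longrightarrow> v \<in> L \<Longrightarrow> T k v \<in> L"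
    and "finite F" "\<And>\<chi> k. \<chi> \<in> F \<Longrightarrow> k \<notin> J \<Longrightarrow> \<chi> k = 0"
    "\<And>\<chi>. \<chi> \<in> F \<Longrightarrow> w \<chi> \<in> eigenspace T J \<chi>" "(\<Sum>\<chi>\<in>F. w \<chi>) \<in> L"
    "\<chi> \<in> F"
  shows "w \<chi> \<in> L"
  using assms(4-8)
proof (induction F arbitrary: w \<chi> rule: finite_induct)
  case (insert \<chi>\<^sub>0 F)
  let ?s = "\<Sum>\<chi>\<in>insert \<chi>\<^sub>0 F. w \<chi>"
  have F: "w \<chi> \<in> L" if \<chi>: "\<chi> \<in> F" for \<chi>
  proof -
    have "\<chi> \<noteq> \<chi>\<^sub>0" using \<chi> insert.hyps by blast
    \<comment> \<open>Different characters differ at some index; since both vanish off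
      \<open>J\<close>, this index lies in \<open>J\<close> and its operator preserves
      \<open>L\<close>.\<close>
    then obtain k where k: "\<chi> k \<noteq> \<chi>\<^sub>0 k" by blast
    then have kJ: "k \<in> J" using insert.prems(1) \<chi> by (metis insertCI)
    define u where "u = (\<lambda>\<psi>. (\<psi> k - \<chi>\<^sub>0 k) *\<^sub>q w \<psi>)"
    have ev: "T k (w \<psi>) = \<psi> k *\<^sub>q w \<psi>" if "\<psi> \<in> insert \<chi>\<^sub>0 F" for \<psi>
      using insert.prems(2)[OF that] kJ by (simp add: eigenspace_def)
    have "T k ?s - \<chi>\<^sub>0 k *\<^sub>q ?s = (\<Sum>\<psi>\<in>insert \<chi>\<^sub>0 F. u \<psi>)"
      unfolding qpair.linear_sum[OF T] qvec.scale_sum_right sum_subtractf[symmetric] u_def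
      by (intro sum.cong refl) (simp add: ev qvec.scale_left_diff_distrib)
    also have "\<dots> = (\<Sum>\<psi>\<in>F. u \<psi>)" using insert.hyps by (simp add: u_def)
    finally have "(\<Sum>\<psi>\<in>F. u \<psi>) \<in> L"
      using insert.prems(3) kJ by (metis L qvec.subspace_diff qvec.subspace_scale)
    then have "u \<chi> \<in> L"
    proof (intro insert.IH[of u \<chi>])
      show "u \<psi> \<in> eigenspace T J \<psi>" if "\<psi> \<in> F" for \<psi>
        unfolding u_def using insert.prems(2) that
        by (intro qvec.subspace_scale[OF subspace_eigenspace[OF T]]) simp
    qed (use insert.prems(1) \<chi> in auto)
    then have "inverse (\<chi> k - \<chi>\<^sub>0 k) *\<^sub>q u \<chi> \<in> L" by (rule qvec.subspace_scale[OF L(1)])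
    then show ?thesis using k by (simp add: u_def scaleQ_scaleQ scaleQ_one)
  qed
  have "?s - (\<Sum>\<psi>\<in>F. w \<psi>) \<in> L"
    by (intro qvec.subspace_diff[OF L(1)] insert.prems(3) qvec.subspace_sum[OF L(1)] F)
  then have "w \<chi>\<^sub>0 \<in> L" using insert.hyps by simp
  then show ?case using F insert.prems(4) by blast
qed simp

lemma invariant_subspace_eigen_span:
  assumes T: "\<And>k. qlinear (T k)" and L: "qvec.subspace L" "\<And>k v. k \<in> J \<Longrightarrow> v \<in> L \<Longrightarrow> T k v \<in> L"
    and C: "\<And>\<chi> k. \<chi> \<in> C \<Longrightarrow> k \<notin> J \<Longrightarrow> \<chi> k = 0"
    and v: "v \<in> L" "v \<in> qvec.span (\<Union>\<chi>\<in>C. eigenspace T J \<chi>)"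
  shows "v \<in> qvec.span (L \<inter> (\<Union>\<chi>\<in>C. eigenspace T J \<chi>))"
proof -
  obtain F w where w: "finite F" "F \<subseteq> C" "\<forall>\<chi>\<in>F. w \<chi> \<in> eigenspace T J \<chi>" "v = (\<Sum>\<chi>\<in>F. w \<chi>)"
    using eigenvector_sum[where T = T, OF T v(2)] by blast
  have "w \<chi> \<in> L" if "\<chi> \<in> F" for \<chi>
    by (rule eigenvector_sum_in_subspace[where T = T and J = J, OF T L w(1) _ _ _ that])
      (use C w v(1) in auto)
  then show ?thesis unfolding w(4) using w(2,3)
    by (intro qvec.span_sum qvec.span_base) blast
qed


section \<open>The space of linear maps\<close>

text \<open>The power \<open>a\<close> of the parity automorphism, that is x -> (-1)^(a [x]) x.
  Being an algebra map, it carries the sign of an operator of parity \<open>a\<close> through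
  products.\<close>

definition par_twist :: "bit \<Rightarrow> ('m::finite, 'n::finite) uq \<Rightarrow> ('m, 'n) uq" where
  "par_twist a x = (if a = 0 then x else uq_twist x)"

lemma par_twist_simps:
  "par_twist 0 x = x" "par_twist a (x + y) = par_twist a x + par_twist a y"
  "par_twist a (c *\<^sub>q x) = c *\<^sub>q par_twist a x" "par_twist a (x * y) = par_twist a x * par_twist a y"
  "par_twist a 1 = 1" "par_twist a (par_twist d x) = par_twist (a + d) x"
  by (cases a; cases d; simp add: par_twist_def uq_twist_simps uq_twist_twist)+

lemma par_twist_homogeneous: "x \<in> uq_part b \<Longrightarrow> par_twist a x = sg (a * b) *\<^sub>q x"
  by (cases a) (simp_all add: par_twist_def uq_part_iff scaleQ_one)

lemma par_twist_in_part: "x \<in> uq_part b \<Longrightarrow> par_twist a x \<in> uq_part b"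
  by (simp add: par_twist_homogeneous qvec.subspace_scale[OF subspace_uq_part])

lemma par_twist_eq_sum: "par_twist a x = (\<Sum>b\<in>{0, 1}. sg (a * b) *\<^sub>q uq_comp b x)"
proof -
  have "par_twist a x = par_twist a (uq_comp 0 x) + par_twist a (uq_comp 1 x)"
    by (simp add: uq_comp_sum flip: par_twist_simps(2))
  then show ?thesis by (simp add: par_twist_homogeneous[OF uq_comp_in])
qed

lemma par_twist_comp: "par_twist a (uq_comp b x) = uq_comp b (par_twist a x)"
proof -
  have "par_twist a (uq_comp b x) = sg (a * b) *\<^sub>q uq_comp b x"
    by (rule par_twist_homogeneous[OF uq_comp_in])
  then show ?thesis
    by (cases b) (simp_all add: par_twist_eq_sum qlinearD[OF qlinear_uq_comp] uq_comp_comp scaleQ_one)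
qed

lemma Ag_par_twist: "f \<in> Ag \<Longrightarrow> (\<lambda>x. f (par_twist a x)) \<in> Ag"
  by (cases a) (simp_all add: par_twist_def Ag_twist)

text \<open>The ambient grading: homogeneous linear maps with no homomorphism condition. Components
  are taken here so that maps from different subspaces can be compared.\<close>

definition lin_part ::
  "('m::finite, 'n::finite, 'v::qvec) smod \<Rightarrow> bit \<Rightarrow> (('m, 'n) uq \<Rightarrow> 'v) set" where
  "lin_part V p = {\<zeta>. qlinear \<zeta> \<and> (\<forall>r. \<zeta> ` uq_part r \<subseteq> part V (p + r))}"

text \<open>The image of \<Xi> \<otimes> A(g) among the maps, described without tensors; see
  \<open>ident_image_VA\<close>.\<close>

definition fin_maps :: "('m::finite, 'n::finite, 'v::qvec) smod \<Rightarrow> (('m, 'n) uq \<Rightarrow> 'v) set" where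
  "fin_maps V = qvec.span {(\<lambda>x. f x *\<^sub>q \<xi>) | f \<xi>. f \<in> Ag \<and> \<xi> \<in> scarrier V}"

lemma subspace_fin_maps: "qvec.subspace (fin_maps V)"
  unfolding fin_maps_def by (rule qvec.subspace_span)

lemma fin_maps_base: "f \<in> Ag \<Longrightarrow> \<xi> \<in> scarrier V \<Longrightarrow> (\<lambda>x. f x *\<^sub>q \<xi>) \<in> fin_maps V"
  unfolding fin_maps_def by (rule qvec.span_base) blast

lemma fin_maps_image:
  assumes "qlinear_on (fin_maps V) T" "qvec.subspace W" "h \<in> fin_maps V"
    "\<And>f \<xi>. f \<in> Ag \<Longrightarrow> \<xi> \<in> scarrier V \<Longrightarrow> T (\<lambda>x. f x *\<^sub>q \<xi>) \<in> W"
  shows "T h \<in> W"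
  by (rule qlinear_on_image_span_subset[OF assms(1)[unfolded fin_maps_def] _ assms(2)
        assms(3)[unfolded fin_maps_def]]) (use assms(4) in blast)

lemma fin_maps_precomp:
  assumes "\<And>f. f \<in> Ag \<Longrightarrow> (\<lambda>x. f (k x)) \<in> Ag" "h \<in> fin_maps V"
  shows "(\<lambda>x. h (k x)) \<in> fin_maps V"
  by (rule fin_maps_image[OF qlinear_imp_on[OF qlinear_precomp] subspace_fin_maps assms(2)])
    (rule fin_maps_base[OF assms(1)])

definition right_K :: "nat \<Rightarrow> (('m::finite, 'n::finite) uq \<Rightarrow> 'v) \<Rightarrow> ('m, 'n) uq \<Rightarrow> 'v" where
  "right_K a h = (\<lambda>x. h (x * uq_gen (Kp a)))"

lemma qlinear_right_K: "qlinear (right_K a)"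
  unfolding right_K_def by (rule qlinear_precomp)

text \<open>The default value 0 outside the index range makes two characters equal as functions as
  soon as they agree on the range.\<close>

definition weight_chars :: "nat \<Rightarrow> nat \<Rightarrow> (nat \<Rightarrow> Cq) set" where
  "weight_chars m n = range (\<lambda>\<mu> a. if a \<in> {1..m + n} then power_int qq (wform m n \<mu> (eps a)) else 0)"

definition weight_maps :: "(('m::finite, 'n::finite) uq \<Rightarrow> 'v::qvec) set" where
  "weight_maps = (\<Union>\<chi>\<in>weight_chars CARD('m) CARD('n).
     eigenspace right_K {1..CARD('m) + CARD('n)} \<chi>)"

lemma weight_maps_iff:
  fixes h :: "('m::finite, 'n::finite) uq \<Rightarrow> 'v::qvec"
  shows "h \<in> weight_maps \<longleftrightarrow> (\<exists>\<mu>. \<forall>a\<in>{1..CARD('m) + CARD('n)}.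
    (\<lambda>x. h (x * uq_gen (Kp a))) = power_int qq (wform CARD('m) CARD('n) \<mu> (eps a)) *\<^sub>q h)"
  by (auto simp: weight_maps_def weight_chars_def eigenspace_def right_K_def)

lemma invariant_weight_span:
  fixes h :: "('m::finite, 'n::finite) uq \<Rightarrow> 'v::qvec"
  assumes "qvec.subspace L" "\<And>h a. a \<in> {1..CARD('m) + CARD('n)} \<Longrightarrow> h \<in> L \<Longrightarrow> (\<lambda>x. h (x * uq_gen (Kp a))) \<in> L"
    and "h \<in> L" "h \<in> qvec.span weight_maps"
  shows "h \<in> qvec.span (L \<inter> weight_maps)"
  unfolding weight_maps_def
  by (rule invariant_subspace_eigen_span[where T = right_K, OF qlinear_right_K assms(1)])
    (use assms in \<open>auto simp: right_K_def weight_maps_def weight_chars_def\<close>)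

lemma qlinear_on_matrix_map:
  assumes "supermodule UNIV M" "qlinear w"
  shows "qlinear_on (scarrier M) (\<lambda>v x. w (act M x v) *\<^sub>q \<xi>)"
proof (rule qlinear_onI)
  fix u v assume "u \<in> scarrier M" "v \<in> scarrier M"
  then show "(\<lambda>x. w (act M x (u + v)) *\<^sub>q \<xi>) = (\<lambda>x. w (act M x u) *\<^sub>q \<xi>) + (\<lambda>x. w (act M x v) *\<^sub>q \<xi>)"
    by (simp add: fun_eq_iff qlinear_onD[OF supermodule_linear[OF assms(1)]] qlinearD[OF assms(2)]
        scaleQ_add_left)
next
  fix c v assume "v \<in> scarrier M"
  then have "w (act M x (c *\<^sub>q v)) *\<^sub>q \<xi> = c *\<^sub>q w (act M x v) *\<^sub>q \<xi>" for x
    by (simp add: qlinear_onD[OF supermodule_linear[OF assms(1)]] qlinearD[OF assms(2)]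
        scaleQ_Cq_def scaleQ_scaleQ)
  then show "(\<lambda>x. w (act M x (c *\<^sub>q v)) *\<^sub>q \<xi>) = c *\<^sub>q (\<lambda>x. w (act M x v) *\<^sub>q \<xi>)"
    by (simp only: scaleQ_fun_def)
qed

text \<open>A module that yields a matrix element is spanned by weight vectors, and for a weight
  vector u the map x -> w(x u) \<xi> is an eigenvector of right translation by each K_a, with the
  weight of u.\<close>

lemma fin_maps_weights: "h \<in> fin_maps V \<Longrightarrow> h \<in> qvec.span weight_maps"
proof (rule fin_maps_image[of V "\<lambda>h. h"])
  show "qlinear_on (fin_maps V) (\<lambda>h. h)" by (simp add: qlinear_on_def)
  fix f :: "('a, 'b) uq \<Rightarrow> Cq" and \<xi> :: 'c
  assume "f \<in> Ag"
  let ?T = "\<lambda>f x. f x *\<^sub>q \<xi> :: 'c"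
  have T: "qlinear ?T" by (rule qlinearI) (simp_all add: fun_eq_iff scaleQ_add_left scaleQ_fun_def scaleQ_Cq_def scaleQ_scaleQ)
  show "?T f \<in> qvec.span weight_maps"
  proof (rule qlinear_on_image_span_subset[OF qlinear_imp_on[OF T] _ qvec.subspace_span])
    show "f \<in> qvec.span matrix_elements" using \<open>f \<in> Ag\<close> by (simp add: Ag_def)
    fix f :: "('a, 'b) uq \<Rightarrow> Cq" assume "f \<in> matrix_elements"
    then show "?T f \<in> qvec.span weight_maps"
    proof (rule matrix_elementE)
      fix M :: "('a, 'b, nat \<Rightarrow> Cq) smod" and v w
      assume M: "cat_obj {1..CARD('a) + CARD('b) - 1} M" "v \<in> scarrier M"
        "qlinear w" "f = (\<lambda>x. w (act M x v))" "supermodule UNIV M"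
      let ?W = "{v. (\<exists>\<mu>. integral_weight_vec M \<mu> v) \<and> finite_dim (range (\<lambda>x. act M x v))}"
      have sp: "scarrier M = qvec.span ?W"
        using M(1) unfolding cat_obj_def uq_sub_UNIV by blast
      let ?R = "\<lambda>v x. w (act M x v) *\<^sub>q \<xi>"
      have R: "qlinear_on (scarrier M) ?R"
        by (rule qlinear_on_matrix_map[OF M(5,3)])
      have "?R v \<in> qvec.span weight_maps"
      proof (rule qlinear_on_image_span_subset[OF R[unfolded sp] _ qvec.subspace_span M(2)[unfolded sp]])
        fix u assume "u \<in> ?W"
        then obtain \<mu> where \<mu>: "integral_weight_vec M \<mu> u" by blast
        then have "u \<in> scarrier M" by (simp add: integral_weight_vec_def)
        then have "w (act M (x * uq_gen (Kp a)) u) *\<^sub>q \<xi>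
            = power_int qq (wform CARD('a) CARD('b) \<mu> (eps a)) *\<^sub>q w (act M x u) *\<^sub>q \<xi>"
          if "a \<in> {1..CARD('a) + CARD('b)}" for a x
          using \<mu> that
          by (simp add: integral_weight_vec_def supermodule_mult[OF M(5)] scaleQ_Cq_def scaleQ_scaleQ
              qlinear_onD[OF supermodule_linear[OF M(5)]] qlinearD[OF M(3)])
        then have "?R u \<in> weight_maps"
          unfolding weight_maps_iff by (intro exI[of _ \<mu>] ballI) (simp only: scaleQ_fun_def)
        then show "?R u \<in> qvec.span weight_maps" by (rule qvec.span_base)
      qed
      then show ?thesis by (simp add: M(4))
    qed
  qed
qed (auto intro: qvec.subspace_span)

definition locally_finite :: "(('m::finite, 'n::finite) uq \<Rightarrow> 'v::qvec) \<Rightarrow> bool" where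
  "locally_finite h \<longleftrightarrow> finite_dim (range (\<lambda>z x. h (x * z)))"

lemma subspace_locally_finite: "qvec.subspace {h. locally_finite h}"
  unfolding qvec.subspace_def
proof (intro conjI ballI allI)
  show "0 \<in> {h. locally_finite h}"
    by (auto simp: locally_finite_def finite_dim_def fun_eq_iff intro!: exI[of _ "{}"])
next
  fix g h :: "('a, 'b) uq \<Rightarrow> 'c" assume "g \<in> {h. locally_finite h}" "h \<in> {h. locally_finite h}"
  then have "finite_dim (qvec.span (range (\<lambda>z x. g (x * z)) \<union> range (\<lambda>z x. h (x * z))))"
    by (auto simp: locally_finite_def intro: finite_dim_span finite_dim_Un)
  moreover have "range (\<lambda>z x. (g + h) (x * z))
      \<subseteq> qvec.span (range (\<lambda>z x. g (x * z)) \<union> range (\<lambda>z x. h (x * z)))"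
  proof clarify
    fix z
    have "(\<lambda>x. (g + h) (x * z)) = (\<lambda>x. g (x * z)) + (\<lambda>x. h (x * z))" by (simp add: fun_eq_iff)
    then show "(\<lambda>x. (g + h) (x * z)) \<in> qvec.span (range (\<lambda>z x. g (x * z)) \<union> range (\<lambda>z x. h (x * z)))"
      by (simp only:) (intro qvec.span_add qvec.span_base, auto)
  qed
  ultimately show "g + h \<in> {h. locally_finite h}"
    unfolding locally_finite_def mem_Collect_eq by (rule finite_dim_mono)
next
  fix c and h :: "('a, 'b) uq \<Rightarrow> 'c" assume "h \<in> {h. locally_finite h}"
  then have "finite_dim ((\<lambda>h. c *\<^sub>q h) ` range (\<lambda>z x. h (x * z)))"
    by (intro finite_dim_image[where W = UNIV and f = "\<lambda>h. c *\<^sub>q h"])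
      (simp_all add: locally_finite_def qlinear_on_def scaleQ_add_right qvec.scale_left_commute)
  then show "c *\<^sub>q h \<in> {h. locally_finite h}"
    by (simp add: locally_finite_def image_image scaleQ_fun_def)
qed

text \<open>The right translates of x -> w(x v) \<xi> are the maps x -> w(x u) \<xi> with u in the
  orbit of v, so they lie in a linear image of the finite dimensional carrier.\<close>

lemma fin_maps_locally_finite: "h \<in> fin_maps V \<Longrightarrow> locally_finite h"
proof -
  assume "h \<in> fin_maps V"
  have "(\<lambda>h. h) h \<in> {h. locally_finite h}"
  proof (rule fin_maps_image[OF _ subspace_locally_finite \<open>h \<in> fin_maps V\<close>])
    show "qlinear_on (fin_maps V) (\<lambda>h. h)" by (simp add: qlinear_on_def)
    fix f :: "('a, 'b) uq \<Rightarrow> Cq" and \<xi> :: 'c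
    assume "f \<in> Ag"
    let ?T = "\<lambda>f x. f x *\<^sub>q \<xi> :: 'c"
    have T: "qlinear ?T" by (rule qlinearI) (simp_all add: fun_eq_iff scaleQ_add_left scaleQ_fun_def scaleQ_Cq_def scaleQ_scaleQ)
    show "?T f \<in> {h. locally_finite h}"
    proof (rule qlinear_on_image_span_subset[OF qlinear_imp_on[OF T] _ subspace_locally_finite])
      show "f \<in> qvec.span matrix_elements" using \<open>f \<in> Ag\<close> by (simp add: Ag_def)
      fix f :: "('a, 'b) uq \<Rightarrow> Cq" assume "f \<in> matrix_elements"
      then show "?T f \<in> {h. locally_finite h}"
      proof (rule matrix_elementE)
        fix M :: "('a, 'b, nat \<Rightarrow> Cq) smod" and v w
        assume M: "finite_dim (scarrier M)" "v \<in> scarrier M"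
          "qlinear w" "f = (\<lambda>x. w (act M x v))" "supermodule UNIV M" "qvec.subspace (scarrier M)"
          "\<And>x v. v \<in> scarrier M \<Longrightarrow> act M x v \<in> scarrier M"
        let ?R = "\<lambda>v x. w (act M x v) *\<^sub>q \<xi>"
        have R: "qlinear_on (scarrier M) ?R"
          by (rule qlinear_on_matrix_map[OF M(5,3)])
        have "finite_dim (?R ` scarrier M)"
          by (rule finite_dim_image[OF M(1) R _ M(6)]) simp
        moreover have "range (\<lambda>z x. ?T f (x * z)) \<subseteq> ?R ` scarrier M"
          using M(2,7) by (auto simp: M(4) supermodule_mult[OF M(5)])
        ultimately show ?thesis
          unfolding locally_finite_def mem_Collect_eq by (rule finite_dim_mono)
      qed
    qed
  qed
  then show ?thesis by simp
qed

lemma subspace_qlinear_maps: "qvec.subspace {h :: ('m::finite, 'n::finite) uq \<Rightarrow> 'v::qvec. qlinear h}"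
proof -
  have "qlinear (0 :: ('m, 'n) uq \<Rightarrow> 'v)" by (rule qlinearI) simp_all
  moreover have "qlinear (g + h)" if "qlinear g" "qlinear h" for g h :: "('m, 'n) uq \<Rightarrow> 'v"
    by (rule qlinearI) (simp_all add: qlinearD[OF that(1)] qlinearD[OF that(2)] scaleQ_add_right algebra_simps)
  moreover have "qlinear (c *\<^sub>q h)" if "qlinear h" for c and h :: "('m, 'n) uq \<Rightarrow> 'v"
    by (rule qlinearI) (simp_all add: scaleQ_fun_def qlinearD[OF that] scaleQ_add_right qvec.scale_left_commute)
  ultimately show ?thesis by (simp add: qvec.subspace_def)
qed

section \<open>The graded space of homomorphisms and its module structure\<close>

context
  fixes \<Theta> :: "nat set" and V :: "('m::finite, 'n::finite, 'v::qvec) smod"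
  assumes V: "supermodule (uq_sub \<Theta>) V"
begin

lemmas part_graded = supermodule_graded[OF V]
lemmas part_subspace = graded_subspace[OF part_graded]

lemma scarrier_subspace: "qvec.subspace (scarrier V)"
  unfolding scarrier_eq_gsum by (rule subspace_gsum[OF part_graded])

lemma part_in_scarrier: "v \<in> part V p \<Longrightarrow> v \<in> scarrier V"
  by (simp add: scarrier_eq_gsum graded_in_gsum[OF part_graded])

lemma graded_lin_part: "graded (lin_part V)"
proof -
  have sub: "qvec.subspace (lin_part V p)" for p
    using subspace_qlinear_maps[where 'm = 'm and 'n = 'n and 'v = 'v] part_subspace
    unfolding qvec.subspace_def lin_part_def
    by (simp add: image_subset_iff scaleQ_fun_def)
  have "h = 0" if h: "h \<in> lin_part V 0" "h \<in> lin_part V 1" for h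
  proof
    fix x
    have "h (uq_comp r x) \<in> part V (0 + r)" "h (uq_comp r x) \<in> part V (1 + r)" for r
      using h uq_comp_in[of r x] unfolding lin_part_def by blast+
    then have "h (uq_comp r x) = 0" for r
      using graded_disjoint[OF part_graded, of "h (uq_comp r x)" r]
      by (simp only: add_0 add.commute[of 1])
    moreover have "h x = h (uq_comp 0 x) + h (uq_comp 1 x)"
      using h(1) qlinearD(1)[of h "uq_comp 0 x" "uq_comp 1 x"] by (simp add: uq_comp_sum lin_part_def)
    ultimately show "h x = 0 x" by simp
  qed
  then show ?thesis using sub qvec.subspace_0[OF sub] by (auto simp: graded_def)
qed

abbreviation "lin_comp \<equiv> hcomp (lin_part V)"

lemma lin_part_qlinear: "h \<in> lin_part V p \<Longrightarrow> qlinear h"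
  by (simp add: lin_part_def)

lemma lin_part_in: "h \<in> lin_part V p \<Longrightarrow> x \<in> uq_part r \<Longrightarrow> h x \<in> part V (p + r)"
  by (simp add: lin_part_def image_subset_iff)

lemma gsum_lin_partD:
  assumes "h \<in> gsum (lin_part V)"
  shows "qlinear h" "h x \<in> scarrier V"
proof -
  obtain g k where gk: "h = g + k" "g \<in> lin_part V 0" "k \<in> lin_part V 1"
    using assms by (auto simp: gsum_def)
  show "qlinear h"
    using qvec.subspace_add[OF subspace_qlinear_maps, of g k] gk lin_part_qlinear by simp
  have *: "f x \<in> scarrier V" if f: "f \<in> lin_part V p" for f p
  proof -
    have "f x = f (uq_comp 0 x) + f (uq_comp 1 x)"
      using qlinearD(1)[OF lin_part_qlinear[OF f], of "uq_comp 0 x" "uq_comp 1 x"] by (simp add: uq_comp_sum)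
    then show ?thesis
      using part_in_scarrier[OF lin_part_in[OF f uq_comp_in]] qvec.subspace_add[OF scarrier_subspace] by simp
  qed
  show "h x \<in> scarrier V"
    using gk * qvec.subspace_add[OF scarrier_subspace] by simp
qed

text \<open>The component of degree \<open>p\<close> sends an argument of parity \<open>r\<close> to
  the component of degree \<open>p + r\<close> of its value. The two maps obtained in this way are
  homogeneous and add up to \<open>h\<close>.\<close>

lemma
  assumes "qlinear h" "\<And>x. h x \<in> scarrier V"
  shows gsum_lin_partI: "h \<in> gsum (lin_part V)"
    and lin_comp_eq: "lin_comp p h = (\<lambda>x. \<Sum>r\<in>{0, 1}. hcomp (part V) (p + r) (h (uq_comp r x)))"
proof -
  define k where "k p x = (\<Sum>r\<in>{0, 1}. hcomp (part V) (p + r) (h (uq_comp r x)))" for p x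
  have h_in: "h x \<in> gsum (part V)" for x using assms(2) by (simp add: scarrier_eq_gsum)
  note H = qlinear_onD[OF qlinear_on_hcomp[OF part_graded]]
  have k: "k p \<in> lin_part V p" for p
    unfolding lin_part_def
  proof (intro CollectI conjI allI)
    show "qlinear (k p)"
      by (rule qlinearI) (simp_all add: k_def qlinearD[OF assms(1)] qlinearD[OF qlinear_uq_comp]
          H h_in scaleQ_add_right)
    show "k p ` uq_part r \<subseteq> part V (p + r)" for r
    proof clarify
      fix x :: "('m, 'n) uq" assume x: "x \<in> uq_part r"
      have "k p x = hcomp (part V) (p + r) (h x)"
        using x uq_comp_same[OF x] uq_comp_other[OF x] qlinear_on_0[OF qlinear_on_hcomp[OF part_graded]
          subspace_gsum[OF part_graded]]
        by (cases r) (simp_all add: k_def qlinearD[OF assms(1)])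
      then show "k p x \<in> part V (p + r)" using hcomp_in[OF part_graded h_in] by simp
    qed
  qed
  have hk: "h = k p + k (p + 1)" for p
  proof
    fix x
    have "h x = h (uq_comp 0 x) + h (uq_comp 1 x)"
      using qlinearD(1)[OF assms(1), of "uq_comp 0 x" "uq_comp 1 x"] by (simp add: uq_comp_sum)
    also have "\<dots> = (hcomp (part V) 0 (h (uq_comp 0 x)) + hcomp (part V) 1 (h (uq_comp 0 x)))
        + (hcomp (part V) 0 (h (uq_comp 1 x)) + hcomp (part V) 1 (h (uq_comp 1 x)))"
      by (simp only: hcomp_sum[OF part_graded h_in])
    also have "\<dots> = (k p + k (p + 1)) x"
      by (cases p) (simp_all add: k_def algebra_simps)
    finally show "h x = (k p + k (p + 1)) x" .
  qed
  show "h \<in> gsum (lin_part V)" using hk[of 0] k unfolding gsum_def by force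
  have "lin_comp p h = k p"
    by (rule hcompI[OF graded_lin_part k]) (use hk[of p] k in simp)
  then show "lin_comp p h = (\<lambda>x. \<Sum>r\<in>{0, 1}. hcomp (part V) (p + r) (h (uq_comp r x)))"
    by (simp add: fun_eq_iff k_def)
qed

lemma generator_in_lin_part:
  assumes "f \<in> Ag" "\<xi> \<in> scarrier V"
  shows "(\<lambda>x. f x *\<^sub>q \<xi>) \<in> gsum (lin_part V)"
  using qlinearD[OF qlinear_Ag[OF assms(1)]] assms(2)
  by (intro gsum_lin_partI qlinearI)
    (simp_all add: scaleQ_add_left scaleQ_Cq_def scaleQ_scaleQ qvec.subspace_scale[OF scarrier_subspace])

lemma lin_comp_generator:
  assumes "f \<in> Ag" "\<xi> \<in> scarrier V"
  shows "lin_comp p (\<lambda>x. f x *\<^sub>q \<xi>) = (\<lambda>x. \<Sum>r\<in>{0, 1}. f (uq_comp r x) *\<^sub>q hcomp (part V) (p + r) \<xi>)"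
  using qlinear_onD(2)[OF qlinear_on_hcomp[OF part_graded]] assms(2)
  unfolding lin_comp_eq[OF gsum_lin_partD[OF generator_in_lin_part[OF assms]]]
  by (simp add: scarrier_eq_gsum)

lemma fin_maps_subset: "fin_maps V \<subseteq> gsum (lin_part V)"
  unfolding fin_maps_def
  by (rule qvec.span_minimal[OF _ subspace_gsum[OF graded_lin_part]])
    (auto intro: generator_in_lin_part)

lemma lin_comp_fin_maps:
  assumes "h \<in> fin_maps V" shows "lin_comp p h \<in> fin_maps V"
proof (rule fin_maps_image[OF _ subspace_fin_maps assms])
  show "qlinear_on (fin_maps V) (lin_comp p)"
    by (rule qlinear_on_subset[OF qlinear_on_hcomp[OF graded_lin_part] fin_maps_subset])
  fix f :: "('m, 'n) uq \<Rightarrow> Cq" and \<xi> assume f: "f \<in> Ag" and \<xi>: "\<xi> \<in> scarrier V"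
  have *: "lin_comp p (\<lambda>x. f x *\<^sub>q \<xi>)
      = (\<lambda>x. f (uq_comp 0 x) *\<^sub>q hcomp (part V) p \<xi>) + (\<lambda>x. f (uq_comp 1 x) *\<^sub>q hcomp (part V) (p + 1) \<xi>)"
    by (simp add: lin_comp_generator[OF f \<xi>] fun_eq_iff)
  have "hcomp (part V) r \<xi> \<in> scarrier V" for r
    using \<xi> by (intro part_in_scarrier[OF hcomp_in[OF part_graded]]) (simp add: scarrier_eq_gsum)
  then show "lin_comp p (\<lambda>x. f x *\<^sub>q \<xi>) \<in> fin_maps V"
    unfolding * by (intro qvec.subspace_add[OF subspace_fin_maps] fin_maps_base Ag_comp f)
qed

lemma hom_part_subset: "hom_part \<Theta> V p \<subseteq> lin_part V p"
  by (auto simp: hom_part_def lin_part_def)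

lemma graded_hom_part: "graded (hom_part \<Theta> V)"
proof -
  have "qvec.subspace (hom_part \<Theta> V p)" for p
    unfolding qvec.subspace_def
  proof (intro conjI ballI allI)
    note L = qvec.subspace_0[OF graded_subspace[OF graded_lin_part, of p]]
      qvec.subspace_add[OF graded_subspace[OF graded_lin_part, of p]]
      qvec.subspace_scale[OF graded_subspace[OF graded_lin_part, of p]]
    have iff: "h \<in> hom_part \<Theta> V p \<longleftrightarrow> h \<in> lin_part V p \<and>
      (\<forall>r. \<forall>x\<in>uq_sub \<Theta> \<inter> uq_part r. \<forall>y. h (x * y) = sg (r * p) *\<^sub>q act V x (h y))" for h
      by (auto simp: hom_part_def lin_part_def)
    have A: "act V x 0 = 0" "u \<in> scarrier V \<Longrightarrow> v \<in> scarrier V \<Longrightarrow> act V x (u + v) = act V x u + act V x v"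
      "u \<in> scarrier V \<Longrightarrow> act V x (c *\<^sub>q u) = c *\<^sub>q act V x u" if "x \<in> uq_sub \<Theta>" for x u v c
      using qlinear_on_0[OF supermodule_linear[OF V that] scarrier_subspace]
        qlinear_onD[OF supermodule_linear[OF V that]] by auto
    have in_c: "h x \<in> scarrier V" if "h \<in> lin_part V p" for h x
      by (rule gsum_lin_partD(2)[OF graded_in_gsum[OF graded_lin_part that]])
    show "0 \<in> hom_part \<Theta> V p"
      unfolding iff using L(1) by (simp add: A)
    show "g + h \<in> hom_part \<Theta> V p" if "g \<in> hom_part \<Theta> V p" "h \<in> hom_part \<Theta> V p" for g h
      using that L(2)[of g h] unfolding iff by (clarsimp simp: A in_c scaleQ_add_right)
    show "c *\<^sub>q h \<in> hom_part \<Theta> V p" if "h \<in> hom_part \<Theta> V p" for c h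
      using that L(3)[of h c] unfolding iff
      by (clarsimp simp: A in_c scaleQ_fun_def scaleQ_scaleQ mult.commute)
  qed
  moreover have "hom_part \<Theta> V 0 \<inter> hom_part \<Theta> V 1 \<subseteq> {0}"
    using hom_part_subset graded_lin_part unfolding graded_def by blast
  ultimately show ?thesis
    unfolding graded_def using qvec.subspace_0 by blast
qed

lemma gsum_hom_part_subset: "gsum (hom_part \<Theta> V) \<subseteq> gsum (lin_part V)"
  by (rule gsum_mono) (rule hom_part_subset)

text \<open>Replaces the components used in \<open>hom_mod\<close> by those in the ambient
  grading.\<close>

lemma hcomp_hom_part: "h \<in> gsum (hom_part \<Theta> V) \<Longrightarrow> hcomp (hom_part \<Theta> V) p h = lin_comp p h"
  using hcomp_in_diff[OF graded_hom_part, of h p] hom_part_subset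
  by (intro hcompI[OF graded_lin_part, symmetric]) blast+

text \<open>The sign (-1)^([y]([x]+[\<zeta>])) is the product of (-1)^([y][\<zeta>]) and
  (-1)^([y][x]); summed over the components of \<open>x\<close>, the second factor is
  \<open>par_twist\<close>.\<close>

lemma act_hom_mod:
  assumes "h \<in> gsum (hom_part \<Theta> V)"
  shows "act (hom_mod \<Theta> V) y h = (\<lambda>x. \<Sum>a\<in>{0, 1}. \<Sum>c\<in>{0, 1}.
    sg (a * c) *\<^sub>q lin_comp c h (par_twist a x * uq_comp a y))"
proof
  fix x
  have L: "qlinear (lin_comp c h)" for c
    using hcomp_in[OF graded_lin_part, of h c] gsum_hom_part_subset assms lin_part_qlinear by blast
  have "(\<Sum>b\<in>{0, 1}. sg (a * (b + c)) *\<^sub>q lin_comp c h (uq_comp b x * uq_comp a y))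
      = sg (a * c) *\<^sub>q lin_comp c h (par_twist a x * uq_comp a y)" for a c
    unfolding par_twist_eq_sum sum_distrib_right uq_scale_mult qpair.linear_sum[OF L] qlinearD(2)[OF L]
      qvec.scale_sum_right scaleQ_scaleQ
    by (intro sum.cong refl) (simp add: distrib_left sg_add mult.commute)
  then show "act (hom_mod \<Theta> V) y h x = (\<Sum>a\<in>{0, 1}. \<Sum>c\<in>{0, 1}.
    sg (a * c) *\<^sub>q lin_comp c h (par_twist a x * uq_comp a y))"
    unfolding hom_mod_def smod.simps hcomp_hom_part[OF assms]
    by (subst sum.swap[of _ "{0, 1 :: bit}" "{0, 1 :: bit}"]) simp
qed

lemma act_hom_mod_part:
  assumes "h \<in> hom_part \<Theta> V p"
  shows "act (hom_mod \<Theta> V) y h = (\<lambda>x. \<Sum>a\<in>{0, 1}. sg (a * p) *\<^sub>q h (par_twist a x * uq_comp a y))"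
proof -
  have h: "h \<in> gsum (hom_part \<Theta> V)" by (rule graded_in_gsum[OF graded_hom_part assms])
  have l: "h \<in> lin_part V p" using hom_part_subset assms by blast
  show ?thesis unfolding act_hom_mod[OF h]
    using hcomp_same[OF graded_lin_part l] hcomp_other[OF graded_lin_part l]
    by (cases p) simp_all
qed

lemma act_hom_mod_homogeneous:
  assumes "h \<in> hom_part \<Theta> V p" "y \<in> uq_part a"
  shows "act (hom_mod \<Theta> V) y h = (\<lambda>x. sg (a * p) *\<^sub>q h (par_twist a x * y))"
  using uq_comp_same[OF assms(2)] uq_comp_other[OF assms(2)]
    qlinearD(3)[OF lin_part_qlinear[OF subsetD[OF hom_part_subset assms(1)]]]
  unfolding act_hom_mod_part[OF assms(1)] by (cases a) simp_all

lemma act_hom_part: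
  assumes "h \<in> hom_part \<Theta> V p" "y \<in> uq_part a"
  shows "act (hom_mod \<Theta> V) y h \<in> hom_part \<Theta> V (a + p)"
  unfolding act_hom_mod_homogeneous[OF assms] hom_part_def
proof (intro CollectI conjI allI ballI)
  have l: "h \<in> lin_part V p" using assms(1) hom_part_subset by blast
  note L = qlinearD[OF lin_part_qlinear[OF l]]
  show "qlinear (\<lambda>x. sg (a * p) *\<^sub>q h (par_twist a x * y))"
    by (rule qlinearI) (simp_all add: L par_twist_simps distrib_right uq_scale_mult scaleQ_add_right
        qvec.scale_left_commute)
  show "(\<lambda>x. sg (a * p) *\<^sub>q h (par_twist a x * y)) ` uq_part r \<subseteq> part V (a + p + r)" for r
  proof clarify
    fix x :: "('m, 'n) uq" assume "x \<in> uq_part r"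
    then have "h (par_twist a x * y) \<in> part V (p + (r + a))"
      by (intro lin_part_in[OF l] uq_part_mult par_twist_in_part assms(2))
    then show "sg (a * p) *\<^sub>q h (par_twist a x * y) \<in> part V (a + p + r)"
      by (intro qvec.subspace_scale[OF part_subspace]) (simp add: add_ac)
  qed
  fix r x z assume x: "x \<in> uq_sub \<Theta> \<inter> (uq_part r :: ('m, 'n) uq set)"
  \<comment> \<open>The twist belonging to \<open>y\<close> gives (-1)^(a r) on \<open>x\<close>;
    this is the change of sign in the homomorphism condition when the parity of the map passes from
    \<open>p\<close> to \<open>a + p\<close>.\<close>
  have "h (par_twist a (x * z) * y) = sg (a * r) *\<^sub>q h (x * (par_twist a z * y))"
    using x by (simp add: par_twist_simps par_twist_homogeneous[of x r] uq_scale_mult mult.assoc L)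
  also have "h (x * (par_twist a z * y)) = sg (r * p) *\<^sub>q act V x (h (par_twist a z * y))"
    using assms(1) x unfolding hom_part_def by blast
  finally have "h (par_twist a (x * z) * y) = sg (a * r) *\<^sub>q sg (r * p) *\<^sub>q act V x (h (par_twist a z * y))" .
  moreover have "act V x (sg (a * p) *\<^sub>q h (par_twist a z * y)) = sg (a * p) *\<^sub>q act V x (h (par_twist a z * y))"
    using x gsum_lin_partD(2)[OF graded_in_gsum[OF graded_lin_part l]]
    by (intro qlinear_onD(2)[OF supermodule_linear[OF V]]) auto
  ultimately show "sg (a * p) *\<^sub>q h (par_twist a (x * z) * y)
      = sg (r * (a + p)) *\<^sub>q act V x (sg (a * p) *\<^sub>q h (par_twist a z * y))"
    by (simp add: scaleQ_scaleQ distrib_left sg_add mult_ac)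
qed

text \<open>Every K_a is even, so all signs disappear. Weight vectors for the action are therefore
  the eigenvectors collected in \<open>weight_maps\<close>.\<close>

lemma act_hom_mod_K:
  assumes "h \<in> gsum (hom_part \<Theta> V)" "a \<in> {1..CARD('m) + CARD('n)}"
  shows "act (hom_mod \<Theta> V) (uq_gen (Kp a)) h = (\<lambda>x. h (x * uq_gen (Kp a)))"
proof
  fix x
  have K: "(uq_gen (Kp a) :: ('m, 'n) uq) \<in> uq_part 0"
    using uq_gen_in_part[where 'm = 'm and 'n = 'n, of "Kp a"] assms(2) by simp
  have h: "h \<in> gsum (lin_part V)" using assms(1) gsum_hom_part_subset by blast
  have "lin_comp c h \<in> lin_part V c" for c by (rule hcomp_in[OF graded_lin_part h])
  note L = qlinearD(3)[OF lin_part_qlinear[OF this]]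
  have "lin_comp 0 h z + lin_comp 1 h z = h z" for z
    using hcomp_sum[OF graded_lin_part h] by (metis plus_fun_apply)
  then show "act (hom_mod \<Theta> V) (uq_gen (Kp a)) h x = h (x * uq_gen (Kp a))"
    unfolding act_hom_mod[OF assms(1)]
    by (simp add: uq_comp_same[OF K] uq_comp_other[OF K] L scaleQ_one par_twist_simps)
qed

lemma qlinear_act_hom_mod:
  "h \<in> gsum (hom_part \<Theta> V) \<Longrightarrow> qlinear (\<lambda>y. act (hom_mod \<Theta> V) y h)"
  "qlinear_on (gsum (hom_part \<Theta> V)) (act (hom_mod \<Theta> V) y)"
proof -
  note sub = gsum_hom_part_subset
  have L: "qlinear (lin_comp c h)" if "h \<in> gsum (hom_part \<Theta> V)" for c h
    using hcomp_in[OF graded_lin_part, of h c] sub that lin_part_qlinear by blast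
  note LD = qlinearD[OF L]
  show "qlinear (\<lambda>y. act (hom_mod \<Theta> V) y h)" if h: "h \<in> gsum (hom_part \<Theta> V)"
    by (rule qlinearI; rule ext)
      (simp_all add: act_hom_mod[OF h] qlinearD[OF qlinear_uq_comp] distrib_left LD[OF h] uq_scale_mult
        scaleQ_add_right scaleQ_fun_def qvec.scale_left_commute qvec.scale_right_diff_distrib)
  note S = subspace_gsum[OF graded_hom_part]
  note H = qlinear_onD[OF qlinear_on_hcomp[OF graded_lin_part]]
  show "qlinear_on (gsum (hom_part \<Theta> V)) (act (hom_mod \<Theta> V) y)"
  proof (rule qlinear_onI)
    fix g h assume gh: "g \<in> gsum (hom_part \<Theta> V)" "h \<in> gsum (hom_part \<Theta> V)"
    then have gh': "g \<in> gsum (lin_part V)" "h \<in> gsum (lin_part V)" using sub by auto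
    show "act (hom_mod \<Theta> V) y (g + h) = act (hom_mod \<Theta> V) y g + act (hom_mod \<Theta> V) y h"
      by (rule ext) (simp add: act_hom_mod gh qvec.subspace_add[OF S] H(1)[OF gh'] scaleQ_add_right)
  next
    fix c h assume h: "h \<in> gsum (hom_part \<Theta> V)"
    then have h': "h \<in> gsum (lin_part V)" using sub by auto
    show "act (hom_mod \<Theta> V) y (c *\<^sub>q h) = c *\<^sub>q act (hom_mod \<Theta> V) y h"
      unfolding act_hom_mod[OF h] act_hom_mod[OF qvec.subspace_scale[OF S h]] H(2)[OF h']
      by (rule ext) (simp add: scaleQ_add_right scaleQ_fun_def qvec.scale_right_diff_distrib)
  qed
qed

text \<open>The hypothesis on weights only places \<open>h\<close> in a span of eigenvectors among
  all maps. Invariance of \<open>P p\<close> under right translation by each K_a moves the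
  decomposition into \<open>P p\<close> itself.\<close>

lemma cat_obj_hom_submodule:
  assumes sub: "\<And>p. qvec.subspace (P p)" "\<And>p. P p \<subseteq> hom_part \<Theta> V p"
    and stable: "\<And>y a h p. y \<in> uq_part a \<Longrightarrow> h \<in> P p \<Longrightarrow> act (hom_mod \<Theta> V) y h \<in> P (a + p)"
    and weights: "\<And>h p. h \<in> P p \<Longrightarrow> h \<in> qvec.span weight_maps"
    and fin: "\<And>h p. h \<in> P p \<Longrightarrow> finite_dim (range (\<lambda>y. act (hom_mod \<Theta> V) y h))"
  shows "cat_obj {1..CARD('m) + CARD('n) - 1} ((hom_mod \<Theta> V) \<lparr> part := P \<rparr>)"
proof -
  let ?M = "(hom_mod \<Theta> V) \<lparr> part := P \<rparr>"
  let ?A = "act (hom_mod \<Theta> V)"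
  have sc: "scarrier ?M = gsum P" by (simp add: scarrier_eq_gsum)
  have G: "graded P"
    unfolding graded_def
  proof (intro conjI allI sub)
    have "P 0 \<inter> P 1 \<subseteq> {0}"
      using sub(2)[of 0] sub(2)[of 1] graded_hom_part unfolding graded_def by blast
    then show "P 0 \<inter> P 1 = {0}" using qvec.subspace_0[OF sub(1)] by blast
  qed
  have gs: "gsum P \<subseteq> gsum (hom_part \<Theta> V)" by (rule gsum_mono[OF sub(2)])
  have "supermodule UNIV ?M"
  proof (rule supermodule_UNIV_I, unfold sc, simp_all add: G stable)
    show "qlinear_on (gsum P) (?A x)" for x
      by (rule qlinear_on_subset[OF qlinear_act_hom_mod(2) gs])
    show "qlinear (\<lambda>x. ?A x v)" if "v \<in> gsum P" for v
      by (rule qlinear_act_hom_mod(1)) (use that gs in blast)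
    show "?A 1 h = h" if "h \<in> P p" for h p
      using that sub(2)[of p] act_hom_mod_homogeneous[of h p 1 0]
      by (auto simp: uq_part_iff uq_twist_1 scaleQ_one par_twist_simps)
    fix x y :: "('m, 'n) uq" and h a d p
    assume x: "x \<in> uq_part a" and y: "y \<in> uq_part d" and "h \<in> P p"
    then have h: "h \<in> hom_part \<Theta> V p" using sub(2) by blast
    have xy: "x * y \<in> uq_part (a + d)" by (rule uq_part_mult[OF x y])
    have "?A x (?A y h) z = ?A (x * y) h z" for z
    proof -
      have l: "h \<in> lin_part V p" using h hom_part_subset by blast
      have "?A x (?A y h) z = sg (a * (d + p)) *\<^sub>q ?A y h (par_twist a z * x)"
        by (simp add: act_hom_mod_homogeneous[OF act_hom_part[OF h y] x])
      \<comment> \<open>Each action contributes one sign, and the twist for \<open>y\<close>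
        contributes (-1)^(d a) when it meets \<open>x\<close>. The terms a d cancel, which leaves
        the exponent (a + d) p.\<close>
      also have "\<dots> = sg (a * (d + p)) *\<^sub>q sg (d * p) *\<^sub>q sg (d * a) *\<^sub>q h (par_twist (a + d) z * (x * y))"
        by (simp add: act_hom_mod_homogeneous[OF h y] par_twist_simps par_twist_homogeneous[OF x]
            uq_scale_mult qlinearD[OF lin_part_qlinear[OF l]] mult.assoc add.commute)
      also have "\<dots> = sg ((a + d) * p) *\<^sub>q h (par_twist (a + d) z * (x * y))"
        by (simp add: scaleQ_scaleQ distrib_left distrib_right sg_add mult_ac)
      finally show ?thesis by (simp add: act_hom_mod_homogeneous[OF h xy])
    qed
    then show "?A (x * y) h = ?A x (?A y h)" by auto
  qed
  moreover have "gsum P = qvec.span {v. (\<exists>\<mu>. integral_weight_vec ?M \<mu> v) \<and> finite_dim (range (\<lambda>x. ?A x v))}"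
    (is "_ = qvec.span ?G")
  proof
    show "qvec.span ?G \<subseteq> gsum P"
      by (rule qvec.span_minimal[OF _ subspace_gsum[OF G]]) (auto simp: integral_weight_vec_def sc)
    have wt: "v \<in> ?G" if v: "v \<in> P p" "v \<in> weight_maps" for v p
    proof -
      have vs: "v \<in> gsum P" by (rule graded_in_gsum[OF G v(1)])
      obtain \<mu> where "\<forall>a\<in>{1..CARD('m) + CARD('n)}.
          (\<lambda>x. v (x * uq_gen (Kp a))) = power_int qq (wform CARD('m) CARD('n) \<mu> (eps a)) *\<^sub>q v"
        using v(2) unfolding weight_maps_iff by blast
      then have "integral_weight_vec ?M \<mu> v"
        unfolding integral_weight_vec_def sc using vs gs act_hom_mod_K[of v] by auto
      then show ?thesis using fin[OF v(1)] by blast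
    qed
    have K: "(\<lambda>x. h (x * uq_gen (Kp a))) \<in> P p"
      if "a \<in> {1..CARD('m) + CARD('n)}" "h \<in> P p" for a h p
    proof -
      have "(uq_gen (Kp a) :: ('m, 'n) uq) \<in> uq_part 0"
        using uq_gen_in_part[where 'm = 'm and 'n = 'n, of "Kp a"] that(1) by simp
      then have "?A (uq_gen (Kp a)) h \<in> P (0 + p)" by (rule stable[OF _ that(2)])
      moreover have "h \<in> gsum (hom_part \<Theta> V)" using graded_in_gsum[OF G that(2)] gs by blast
      ultimately show ?thesis using act_hom_mod_K[of h a] that(1) by simp
    qed
    have P: "h \<in> qvec.span ?G" if h: "h \<in> P p" for h p
    proof -
      have "h \<in> qvec.span (P p \<inter> weight_maps)"
        by (rule invariant_weight_span[OF sub(1) K h weights[OF h]])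
      moreover have "P p \<inter> weight_maps \<subseteq> ?G" using wt by blast
      ultimately show ?thesis using qvec.span_mono by blast
    qed
    then show "gsum P \<subseteq> qvec.span ?G" by (auto simp: gsum_def intro!: qvec.span_add)
  qed
  ultimately show ?thesis unfolding cat_obj_def sc uq_sub_UNIV by simp
qed

end

section \<open>The induced module\<close>

text \<open>The common value of both sides of the theorem, degree by degree:
  \<open>ind_obj_eq\<close> on the one hand, \<open>ident_S_part\<close> on the other.\<close>

definition fin_part ::
  "nat set \<Rightarrow> ('m::finite, 'n::finite, 'v::qvec) smod \<Rightarrow> bit \<Rightarrow> (('m, 'n) uq \<Rightarrow> 'v) set" where
  "fin_part \<Theta> V p = hom_part \<Theta> V p \<inter> fin_maps V"

context
  fixes \<Theta> :: "nat set" and V :: "('m::finite, 'n::finite, 'v::qvec) smod"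
  assumes V: "supermodule (uq_sub \<Theta>) V"
begin

lemma subspace_fin_part: "qvec.subspace (fin_part \<Theta> V p)"
  unfolding fin_part_def
  by (rule qvec.subspace_inter[OF graded_subspace[OF graded_hom_part[OF V]] subspace_fin_maps])

lemma graded_fin_part: "graded (fin_part \<Theta> V)"
proof -
  have "fin_part \<Theta> V 0 \<inter> fin_part \<Theta> V 1 \<subseteq> {0}"
    using graded_hom_part[OF V] unfolding graded_def fin_part_def by blast
  then show ?thesis
    using qvec.subspace_0[OF subspace_fin_part] subspace_fin_part unfolding graded_def by blast
qed

lemma cat_obj_fin_part:
  "cat_obj {1..CARD('m) + CARD('n) - 1} ((hom_mod \<Theta> V) \<lparr> part := fin_part \<Theta> V \<rparr>)"
proof (rule cat_obj_hom_submodule[OF V subspace_fin_part])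
  show "fin_part \<Theta> V p \<subseteq> hom_part \<Theta> V p" for p by (auto simp: fin_part_def)
  show "act (hom_mod \<Theta> V) y h \<in> fin_part \<Theta> V (a + p)"
    if y: "y \<in> uq_part a" and h: "h \<in> fin_part \<Theta> V p" for y a h p
  proof -
    have hp: "h \<in> hom_part \<Theta> V p" and hf: "h \<in> fin_maps V" using h by (auto simp: fin_part_def)
    have "(\<lambda>x. h (x * y)) \<in> fin_maps V" by (rule fin_maps_precomp[OF Ag_right_mult hf])
    then have "(\<lambda>x. h (par_twist a x * y)) \<in> fin_maps V"
      by (intro fin_maps_precomp[where k = "par_twist a" and h = "\<lambda>x. h (x * y)"] Ag_par_twist)
    then have "sg (a * p) *\<^sub>q (\<lambda>x. h (par_twist a x * y)) \<in> fin_maps V"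
      by (rule qvec.subspace_scale[OF subspace_fin_maps])
    then have "act (hom_mod \<Theta> V) y h \<in> fin_maps V"
      unfolding act_hom_mod_homogeneous[OF V hp y] by (simp only: scaleQ_fun_def)
    then show ?thesis using act_hom_part[OF V hp y] by (simp add: fin_part_def)
  qed
  show "h \<in> qvec.span weight_maps" if "h \<in> fin_part \<Theta> V p" for h p
    using that fin_maps_weights by (auto simp: fin_part_def)
  show "finite_dim (range (\<lambda>y. act (hom_mod \<Theta> V) y h))" if h: "h \<in> fin_part \<Theta> V p" for h p
  proof -
    have hp: "h \<in> hom_part \<Theta> V p" and hf: "h \<in> fin_maps V" using h by (auto simp: fin_part_def)
    let ?R = "range (\<lambda>z x. h (x * z))"
    let ?T = "\<lambda>a (g :: ('m, 'n) uq \<Rightarrow> 'v) x. g (par_twist a x)"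
    \<comment> \<open>By \<open>act_hom_mod_part\<close> the orbit of \<open>h\<close> consists of
      combinations of right translates of \<open>h\<close> and of their parity twists, and the right
      translates span a finite dimensional space.\<close>
    have R: "finite_dim ?R" using fin_maps_locally_finite[OF hf] by (simp add: locally_finite_def)
    have "finite_dim (?T a ` ?R)" for a
      by (rule finite_dim_image[OF R qlinear_imp_on[OF qlinear_precomp], of UNIV]) simp_all
    then have fd: "finite_dim (qvec.span (?T 0 ` ?R \<union> ?T 1 ` ?R))"
      by (intro finite_dim_span finite_dim_Un)
    have "act (hom_mod \<Theta> V) y h \<in> qvec.span (?T 0 ` ?R \<union> ?T 1 ` ?R)" for y
    proof -
      have "act (hom_mod \<Theta> V) y h = (\<Sum>a\<in>{0, 1}. sg (a * p) *\<^sub>q ?T a (\<lambda>x. h (x * uq_comp a y)))"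
        unfolding act_hom_mod_part[OF V hp] by (simp add: fun_eq_iff scaleQ_fun_def)
      also have "\<dots> \<in> qvec.span (?T 0 ` ?R \<union> ?T 1 ` ?R)"
        by (intro qvec.span_sum qvec.span_scale qvec.span_base) auto
      finally show ?thesis .
    qed
    then show ?thesis by (intro finite_dim_mono[OF fd]) auto
  qed
qed

text \<open>Evaluation at \<open>1\<close> recovers \<open>h\<close> from its orbit, so expanding the orbit in a basis of a finite
  dimensional submodule writes \<open>h\<close> in terms of matrix elements.\<close>

lemma finite_submodule_in_fin_maps:
  assumes P: "\<And>p. P p \<subseteq> hom_part \<Theta> V p"
    and cat: "cat_obj {1..CARD('m) + CARD('n) - 1} ((hom_mod \<Theta> V) \<lparr> part := P \<rparr>)"
    and fd: "finite_dim (gsum P)" and h: "h \<in> P p"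
  shows "h \<in> fin_maps V"
proof -
  let ?I = "{1..CARD('m) + CARD('n) - 1}"
  let ?M = "(hom_mod \<Theta> V) \<lparr> part := P \<rparr>"
  let ?A = "act (hom_mod \<Theta> V)"
  have sc: "scarrier ?M = gsum P" by (simp add: scarrier_eq_gsum)
  have sm: "supermodule (uq_sub ?I) ?M" using cat unfolding cat_obj_def by blast
  have G: "graded P" using supermodule_graded[OF sm] by simp
  note S = subspace_gsum[OF G]
  have A_in: "?A x g \<in> gsum P" if "g \<in> gsum P" for x g
    using supermodule_act_in[OF sm order_refl, of x g] that unfolding sc uq_sub_UNIV by simp
  obtain e :: "(('m, 'n) uq \<Rightarrow> 'v) \<Rightarrow> nat \<Rightarrow> Cq" and B i where e: "qlinear e" "finite B" "B \<subseteq> gsum P"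
    and exp: "\<And>u. u \<in> gsum P \<Longrightarrow> u = (\<Sum>b\<in>B. e u (i b) *\<^sub>q b)"
    using finite_dim_coordinates[OF S fd] by blast
  have inj: "inj_on e (gsum P)"
  proof (rule inj_onI)
    fix u v assume "u \<in> gsum P" "v \<in> gsum P" "e u = e v"
    then show "u = v" using exp[of u] exp[of v] by simp
  qed
  note el = qlinear_imp_on[OF e(1), of "gsum P"]
  let ?g = "inv_into (gsum P) e"
  have ge: "?g (e u) = u" if "u \<in> gsum P" for u by (rule inv_into_f_f[OF inj that])
  \<comment> \<open>The module on \<open>gsum P\<close>, copied into
    \<open>nat \<Rightarrow> Cq\<close> along the coordinate map \<open>e\<close>; its matrix
    elements are the coordinates of the orbit of \<open>h\<close>.\<close>
  define M where "M = \<lparr> part = (\<lambda>p. e ` P p), act = (\<lambda>x u. e (?A x (?g u))) \<rparr>"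
  have in_g: "u \<in> gsum P" if "u \<in> P p" for u p by (rule graded_in_gsum[OF G that])
  have scM: "scarrier M = e ` gsum P"
  proof (rule set_eqI)
    fix w
    have "w \<in> scarrier M \<longleftrightarrow> (\<exists>u\<in>P 0. \<exists>v\<in>P 1. w = e u + e v)"
      unfolding scarrier_def M_def by auto
    also have "\<dots> \<longleftrightarrow> w \<in> e ` gsum P"
    proof
      assume "\<exists>u\<in>P 0. \<exists>v\<in>P 1. w = e u + e v"
      then obtain u v where "u \<in> P 0" "v \<in> P 1" "w = e (u + v)" by (auto simp: qlinearD(1)[OF e(1)])
      then show "w \<in> e ` gsum P" unfolding gsum_def by blast
    next
      assume "w \<in> e ` gsum P"
      then obtain u v where "u \<in> P 0" "v \<in> P 1" "w = e (u + v)" unfolding gsum_def by blast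
      then show "\<exists>u\<in>P 0. \<exists>v\<in>P 1. w = e u + e v" using qlinearD(1)[OF e(1)] by blast
    qed
    finally show "w \<in> scarrier M \<longleftrightarrow> w \<in> e ` gsum P" .
  qed
  have "cat_obj ?I M"
  proof (rule cat_obj_transport[OF cat order_refl qlinear_on_inv_into[OF el inj S]])
    show "inj_on ?g (e ` gsum P)" by (rule inj_on_inv_into) simp
    show "qvec.subspace (e ` gsum P)" by (rule qlinear_on_image_subspace[OF el S])
    show "part M p \<subseteq> e ` gsum P" for p using in_g by (auto simp: M_def)
    show "?g ` part M p = part ?M p" for p
    proof -
      have "?g ` e ` P p = (\<lambda>u. ?g (e u)) ` P p" by (rule image_image)
      also have "\<dots> = (\<lambda>u. u) ` P p" by (rule image_cong[OF refl]) (rule ge[OF in_g])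
      finally show ?thesis by (simp add: M_def)
    qed
    fix x u assume "u \<in> scarrier M"
    then obtain v where v: "v \<in> gsum P" "u = e v" unfolding scM by blast
    show "act M x u \<in> e ` gsum P" by (simp add: M_def v ge A_in)
    show "?g (act M x u) = act ?M x (?g u)" by (simp add: M_def v ge A_in)
  qed
  moreover have "finite_dim (scarrier M)"
    unfolding scM by (rule finite_dim_image[OF fd el _ S]) simp
  moreover have eh: "e h \<in> scarrier M" unfolding scM using in_g[OF h] by blast
  moreover have "qlinear (\<lambda>u :: nat \<Rightarrow> Cq. u j)" for j
    by (rule qlinearI) (simp_all add: scaleQ_fun_def)
  ultimately have F: "(\<lambda>y. e (?A y h) j) \<in> Ag" for j
    using matrix_element_in_Ag[OF matrix_elementI, of M "e h" "\<lambda>u. u j"]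
    by (simp add: M_def ge in_g[OF h])
  \<comment> \<open>At the argument 1 only the sign (-1)^([y] p) of the action survives, so y
    applied to \<open>h\<close> has the value h(par_twist p y) there. Taking y = par_twist p x gives
    h(x).\<close>
  have "h = (\<lambda>x. \<Sum>b\<in>B. e (?A (par_twist p x) h) (i b) *\<^sub>q b 1)"
  proof
    fix x
    have hp: "h \<in> hom_part \<Theta> V p" using P h by blast
    have l: "qlinear h" using hp by (simp add: hom_part_def)
    have "?A (par_twist p x) h 1 = h (par_twist p (par_twist p x))"
      unfolding act_hom_mod_part[OF V hp]
      by (simp add: par_twist_simps(5) par_twist_eq_sum[of p "par_twist p x"] qlinearD[OF l] mult.commute)
    also have "\<dots> = h x" by (simp add: par_twist_simps)
    finally have "h x = ?A (par_twist p x) h 1" ..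
    also have "\<dots> = (\<Sum>b\<in>B. e (?A (par_twist p x) h) (i b) *\<^sub>q b) 1"
      by (rule arg_cong[OF exp[OF A_in[OF in_g[OF h]]], of "\<lambda>u. u 1"])
    finally show "h x = (\<Sum>b\<in>B. e (?A (par_twist p x) h) (i b) *\<^sub>q b 1)"
      by (simp add: sum_apply scaleQ_fun_def)
  qed
  also have "\<dots> = (\<Sum>b\<in>B. (\<lambda>x. e (?A (par_twist p x) h) (i b) *\<^sub>q b 1))"
    by (simp add: fun_eq_iff sum_apply)
  also have "\<dots> \<in> fin_maps V"
  proof (rule qvec.subspace_sum[OF subspace_fin_maps])
    fix b assume "b \<in> B"
    moreover have "gsum P \<subseteq> gsum (lin_part V)"
      by (rule order_trans[OF gsum_mono[OF P] gsum_hom_part_subset[OF V]])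
    ultimately have "b \<in> gsum (lin_part V)" using e(3) by blast
    then have "b 1 \<in> scarrier V" by (rule gsum_lin_partD[OF V])
    then show "(\<lambda>x. e (?A (par_twist p x) h) (i b) *\<^sub>q b 1) \<in> fin_maps V"
      by (rule fin_maps_base[OF Ag_par_twist[OF F]])
  qed
  finally show ?thesis .
qed

text \<open>It suffices to treat the weight vectors v with finite dimensional orbit that span the
  module. Such a v need not be homogeneous, nor its orbit graded; the homogeneous components of the
  orbit form a finite dimensional graded submodule whose sum contains v, and the preceding lemma
  applies to it.\<close>

lemma hom_submodule_subset_fin_part:
  assumes N: "\<And>p. N p \<subseteq> hom_part \<Theta> V p"
    and cat: "cat_obj {1..CARD('m) + CARD('n) - 1} ((hom_mod \<Theta> V) \<lparr> part := N \<rparr>)"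
  shows "N p \<subseteq> fin_part \<Theta> V p"
proof -
  let ?I = "{1..CARD('m) + CARD('n) - 1}"
  let ?M = "(hom_mod \<Theta> V) \<lparr> part := N \<rparr>"
  let ?A = "act (hom_mod \<Theta> V)"
  have sc: "scarrier ?M = gsum N" by (simp add: scarrier_eq_gsum)
  have sm: "supermodule (uq_sub ?I) ?M" using cat unfolding cat_obj_def by blast
  then have smU: "supermodule UNIV ?M" unfolding uq_sub_UNIV .
  have G: "graded N" using supermodule_graded[OF sm] by simp
  note S = subspace_gsum[OF G]
  have A_in: "?A x g \<in> gsum N" if "g \<in> gsum N" for x g
    using supermodule_act_in[OF sm order_refl, of x g] that unfolding sc uq_sub_UNIV by simp
  have A_mult: "?A (x * y) g = ?A x (?A y g)" if "g \<in> gsum N" for x y g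
    using supermodule_mult[OF smU, of x y g] that unfolding sc by simp
  have A_part: "?A y g \<in> N (a + r)" if "y \<in> uq_part a" "g \<in> N r" for y g a r
    using supermodule_part[OF smU, of y a g r] that by simp
  have A_lin: "qlinear_on (gsum N) (?A y)" for y
    using supermodule_linear[OF smU, of y] unfolding sc by simp
  let ?W = "{v. (\<exists>\<mu>. integral_weight_vec ?M \<mu> v) \<and> finite_dim (range (\<lambda>x. ?A x v))}"
  have sp: "gsum N = qvec.span ?W"
    using cat unfolding cat_obj_def uq_sub_UNIV sc by simp
  have gs: "gsum N \<subseteq> gsum (hom_part \<Theta> V)" by (rule gsum_mono[OF N])
  have "?W \<subseteq> weight_maps"
  proof
    fix v assume "v \<in> ?W"
    then obtain \<mu> where \<mu>: "integral_weight_vec ?M \<mu> v" by blast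
    then have "v \<in> gsum (hom_part \<Theta> V)" using gs unfolding integral_weight_vec_def sc by blast
    then show "v \<in> weight_maps"
      unfolding weight_maps_iff using \<mu> act_hom_mod_K[OF V, of v]
      by (intro exI[of _ \<mu>]) (simp add: integral_weight_vec_def)
  qed
  then have wt: "gsum N \<subseteq> qvec.span weight_maps" unfolding sp by (rule qvec.span_mono)
  have "v \<in> fin_maps V" if v: "v \<in> ?W" for v
  proof -
    have vN: "v \<in> gsum N" using v unfolding integral_weight_vec_def sc by blast
    define Orb where "Orb = range (\<lambda>x. ?A x v)"
    have lin: "qlinear_on UNIV (\<lambda>x. ?A x v)"
      using supermodule_linear'[OF smU, of v] vN unfolding sc by simp
    have OS: "qvec.subspace Orb" and Ofd: "finite_dim Orb" and ON: "Orb \<subseteq> gsum N"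
      unfolding Orb_def using qlinear_on_image_subspace[OF lin] v A_in[OF vN] by auto
    define P where "P p = hcomp N p ` Orb" for p
    have HO: "qlinear_on Orb (hcomp N p)" for p
      by (rule qlinear_on_subset[OF qlinear_on_hcomp[OF G] ON])
    have PN: "P p \<subseteq> N p" for p unfolding P_def using hcomp_in[OF G] ON by blast
    have Psub: "qvec.subspace (P p)" for p unfolding P_def by (rule qlinear_on_image_subspace[OF HO OS])
    have Pfd: "finite_dim (P p)" for p
      unfolding P_def by (rule finite_dim_image[OF Ofd HO order_refl OS])
    have GP: "graded P"
    proof -
      have "P 0 \<inter> P 1 \<subseteq> {0}" using PN[of 0] PN[of 1] G unfolding graded_def by blast
      then show ?thesis unfolding graded_def using qvec.subspace_0[OF Psub] Psub by blast
    qed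
    have "gsum P \<subseteq> qvec.span (P 0 \<union> P 1)"
      by (auto simp: gsum_def intro!: qvec.span_add intro: qvec.span_base)
    then have gfd: "finite_dim (gsum P)"
      using finite_dim_mono finite_dim_span finite_dim_Un Pfd by metis
    \<comment> \<open>For \<open>y\<close> of parity \<open>a\<close>, applying \<open>y\<close> to
      the degree \<open>r\<close> component of an orbit vector gives the degree \<open>a + r\<close>
      component of another orbit vector.\<close>
    have stable: "?A y g \<in> P (a + r)" if y: "y \<in> uq_part a" and g: "g \<in> P r" for y a g r
    proof -
      obtain x where x: "g = hcomp N r (?A x v)" using g unfolding P_def Orb_def by blast
      define u where "u = ?A x v"
      have u: "u \<in> gsum N" unfolding u_def by (rule A_in[OF vN])
      have c: "hcomp N r u \<in> N r" "hcomp N (r + 1) u \<in> N (r + 1)" using hcomp_in[OF G u] by blast+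
      have "u = hcomp N r u + hcomp N (r + 1) u"
        using hcomp_sum[OF G u] by (cases r) (simp_all add: add.commute)
      then have "hcomp N (a + r) (?A y u) = hcomp N (a + r) (?A y (hcomp N r u + hcomp N (r + 1) u))" by simp
      also have "?A y (hcomp N r u + hcomp N (r + 1) u) = ?A y (hcomp N r u) + ?A y (hcomp N (r + 1) u)"
        by (rule qlinear_onD(1)[OF A_lin]) (rule graded_in_gsum[OF G c(1)], rule graded_in_gsum[OF G c(2)])
      also have "hcomp N (a + r) (?A y (hcomp N r u) + ?A y (hcomp N (r + 1) u)) = ?A y (hcomp N r u)"
        using A_part[OF y c(1)] A_part[OF y c(2)]
        by (intro hcomp_add_distinct[OF G]) (simp_all add: add.assoc)
      finally have "?A y g = hcomp N (a + r) (?A (y * x) v)"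
        unfolding x u_def A_mult[OF vN] by simp
      then show ?thesis unfolding P_def Orb_def by blast
    qed
    have in_gP: "g \<in> gsum P" if "g \<in> P r" for g r by (rule graded_in_gsum[OF GP that])
    have PA_in: "?A y g \<in> gsum P" if g: "g \<in> P r" for y g r
    proof -
      have gh: "g \<in> gsum (hom_part \<Theta> V)" using g PN graded_in_gsum[OF G] gs by blast
      have "?A y g = ?A (uq_comp 0 y) g + ?A (uq_comp 1 y) g"
        using qlinearD(1)[OF qlinear_act_hom_mod(1)[OF V gh], of "uq_comp 0 y" "uq_comp 1 y"]
        by (simp add: uq_comp_sum)
      then show ?thesis
        using in_gP[OF stable[OF uq_comp_in g]] by (simp add: qvec.subspace_add[OF subspace_gsum[OF GP]])
    qed
    have PH: "P r \<subseteq> hom_part \<Theta> V r" for r using PN N by blast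
    have "cat_obj ?I ((hom_mod \<Theta> V) \<lparr> part := P \<rparr>)"
    proof (rule cat_obj_hom_submodule[OF V Psub PH stable])
      show "g \<in> qvec.span weight_maps" if "g \<in> P r" for g r
        using that PN graded_in_gsum[OF G] wt by blast
      show "finite_dim (range (\<lambda>y. ?A y g))" if "g \<in> P r" for g r
        by (rule finite_dim_mono[OF gfd]) (use PA_in[OF that] in blast)
    qed
    then have PF: "g \<in> fin_maps V" if "g \<in> P r" for g r
      by (rule finite_submodule_in_fin_maps[OF PH _ gfd that])
    have "?A 1 v = v" using supermodule_1[OF smU, of v] vN unfolding sc by simp
    then have "v \<in> Orb" unfolding Orb_def by (metis rangeI)
    then have "hcomp N r v \<in> fin_maps V" for r by (intro PF[of _ r]) (simp add: P_def)
    then have "hcomp N 0 v + hcomp N 1 v \<in> fin_maps V"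
      by (intro qvec.subspace_add[OF subspace_fin_maps])
    then show ?thesis by (simp add: hcomp_sum[OF G vN])
  qed
  then have "gsum N \<subseteq> fin_maps V"
    unfolding sp by (intro qvec.span_minimal[OF _ subspace_fin_maps]) blast
  then show ?thesis using N graded_in_gsum[OF G] unfolding fin_part_def by blast
qed

text \<open>\<open>fin_part\<close> contains every admissible family \<open>N\<close> and is itself
  admissible, so the sum of all of them is \<open>fin_part\<close>.\<close>

lemma ind_obj_eq: "ind_obj \<Theta> V = (hom_mod \<Theta> V) \<lparr> part := fin_part \<Theta> V \<rparr>"
proof -
  have "qvec.span (\<Union> {N p | N. (\<forall>r. N r \<subseteq> hom_part \<Theta> V r) \<and>
     cat_obj {1..CARD('m) + CARD('n) - 1} ((hom_mod \<Theta> V) \<lparr> part := N \<rparr>)}) = fin_part \<Theta> V p"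
    (is "qvec.span (\<Union> ?X) = _") for p
  proof
    have "\<Union> ?X \<subseteq> fin_part \<Theta> V p"
    proof (rule Union_least)
      fix X assume "X \<in> ?X"
      then obtain N where N: "X = N p" "\<forall>r. N r \<subseteq> hom_part \<Theta> V r"
        "cat_obj {1..CARD('m) + CARD('n) - 1} ((hom_mod \<Theta> V) \<lparr> part := N \<rparr>)"
        by (elim CollectE exE conjE)
      show "X \<subseteq> fin_part \<Theta> V p"
        unfolding N(1) by (rule hom_submodule_subset_fin_part[OF spec[OF N(2)] N(3)])
    qed
    then show "qvec.span (\<Union> ?X) \<subseteq> fin_part \<Theta> V p" by (rule qvec.span_minimal[OF _ subspace_fin_part])
    have "fin_part \<Theta> V p \<in> ?X"
    proof (intro CollectI exI conjI)
      show "\<forall>r. fin_part \<Theta> V r \<subseteq> hom_part \<Theta> V r" by (simp add: fin_part_def)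
    qed (rule refl cat_obj_fin_part)+
    then have "fin_part \<Theta> V p \<subseteq> \<Union> ?X" by (rule Union_upper)
    then show "fin_part \<Theta> V p \<subseteq> qvec.span (\<Union> ?X)"
      by (rule order_trans[OF _ qvec.span_superset])
  qed
  then show ?thesis unfolding ind_obj_def by (simp only:)
qed

end

section \<open>The functor \<open>S\<close>\<close>

lemma qlinear_on_apply:
  "qlinear_on A F \<Longrightarrow> qlinear_on A (\<lambda>\<zeta>. F \<zeta> y)" for F :: "'a::qvec \<Rightarrow> 'b \<Rightarrow> 'c::qvec"
  by (simp add: qlinear_on_def scaleQ_fun_def)

lemma qlinear_on_apply_iff:
  "qlinear_on A F \<longleftrightarrow> (\<forall>y. qlinear_on A (\<lambda>\<zeta>. F \<zeta> y))" for F :: "'a::qvec \<Rightarrow> 'b \<Rightarrow> 'c::qvec"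
  unfolding qlinear_on_def fun_eq_iff plus_fun_apply scaleQ_fun_def by blast

text \<open>For odd \<open>z\<close> the parities of \<open>y\<close> and of the product differ by
  one, so the sign of \<open>y\<close> can be read off the product. This is what compares the sign
  in \<open>dR\<close> with that of the action on maps.\<close>

lemma uq_comp_twist_mult:
  "z \<in> uq_part 1 \<Longrightarrow> uq_comp r (uq_twist y * z) = - sg r *\<^sub>q uq_comp r (y * z)"
proof -
  assume z: "z \<in> uq_part 1"
  have "uq_twist y * z = - uq_twist (y * z)"
    using z by (simp add: uq_twist_mult uq_part_iff uq_scale_mult)
  also have "uq_comp r \<dots> = - uq_comp r (uq_twist (y * z))" by (rule qlinearD(5)[OF qlinear_uq_comp])
  also have "uq_comp r (uq_twist (y * z)) = sg r *\<^sub>q uq_comp r (y * z)"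
    using par_twist_comp[of 1 r "y * z"] par_twist_homogeneous[OF uq_comp_in, of 1 r "y * z"]
    by (simp add: par_twist_def)
  finally show ?thesis by simp
qed

lemma dL_eq:
  assumes "f \<in> Ag"
  shows "dL x f = (\<lambda>y. \<Sum>a\<in>{0, 1}. \<Sum>c\<in>{0, 1}.
    sg (a * c) * f (uq_comp c (antipode (uq_comp a x) * y)))"
  unfolding dL_def hcomp_Ag_part[OF assms] ..

lemma dL_in_Ag: assumes "f \<in> Ag" shows "dL x f \<in> Ag"
proof -
  have "dL x f = (\<Sum>a\<in>{0, 1}. \<Sum>c\<in>{0, 1}. sg (a * c) *\<^sub>q (\<lambda>y. f (uq_comp c (antipode (uq_comp a x) * y))))"
    unfolding dL_eq[OF assms] by (simp add: fun_eq_iff scaleQ_fun_def scaleQ_Cq_def)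
  then show ?thesis
    by (simp only:) (intro qvec.subspace_sum[OF subspace_Ag] qvec.subspace_scale[OF subspace_Ag]
        Ag_left_mult[OF Ag_comp[OF assms]])
qed

lemma qlinear_on_dL: "qlinear_on Ag (dL x)"
proof (rule qlinear_onI)
  fix f g :: "('a, 'b) uq \<Rightarrow> Cq" assume fg: "f \<in> Ag" "g \<in> Ag"
  show "dL x (f + g) = dL x f + dL x g"
    unfolding dL_eq[OF fg(1)] dL_eq[OF fg(2)] dL_eq[OF qvec.subspace_add[OF subspace_Ag fg]]
    by (simp add: fun_eq_iff algebra_simps)
next
  fix c and f :: "('a, 'b) uq \<Rightarrow> Cq" assume f: "f \<in> Ag"
  show "dL x (c *\<^sub>q f) = c *\<^sub>q dL x f"
    unfolding dL_eq[OF f] dL_eq[OF qvec.subspace_scale[OF subspace_Ag f]]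
    by (simp add: fun_eq_iff scaleQ_fun_def scaleQ_Cq_def algebra_simps)
qed

lemma dR_in_Ag: assumes "f \<in> Ag" shows "dR x f \<in> Ag"
proof -
  have "dR x f = (\<Sum>a\<in>{0, 1}. sg a *\<^sub>q (\<lambda>y. f (y * uq_comp a x)))"
    unfolding dR_def by (simp add: fun_eq_iff scaleQ_fun_def scaleQ_Cq_def)
  then show ?thesis
    by (simp only:) (intro qvec.subspace_sum[OF subspace_Ag] qvec.subspace_scale[OF subspace_Ag]
        Ag_right_mult[OF assms])
qed

lemma qlinear_on_dR: "qlinear_on Ag (dR x)"
  by (rule qlinear_onI)
    (simp_all add: dR_def fun_eq_iff scaleQ_fun_def scaleQ_Cq_def algebra_simps)

lemma S_space_subset: "S_space \<Theta> V \<subseteq> VA V"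
  by (auto simp: S_space_def)

context
  fixes \<Theta> :: "nat set" and V :: "('m::finite, 'n::finite, 'v::qvec) smod"
  assumes V: "supermodule (uq_sub \<Theta>) V"
begin

lemma lift_VA:
  assumes b: "bilin_on (scarrier V) Ag b"
  shows "qlinear_on (VA V) (tensor_lift (scarrier V) Ag b)"
    "\<xi> \<in> scarrier V \<Longrightarrow> f \<in> Ag \<Longrightarrow> tensor_lift (scarrier V) Ag b (\<xi> \<otimes> f) = b \<xi> f"
  using tensor_lift[OF scarrier_subspace[OF V] subspace_Ag b] unfolding VA_def by blast+

lemma subspace_VA: "qvec.subspace (VA V)"
  unfolding VA_def by (rule subspace_tensor_of)

lemma tens_in_VA: "\<xi> \<in> scarrier V \<Longrightarrow> f \<in> Ag \<Longrightarrow> \<xi> \<otimes> f \<in> VA V"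
  unfolding VA_def by (rule tens_in_tensor_of)

lemma VA_eqI:
  assumes "qlinear_on (VA V) F" "qlinear_on (VA V) F'"
    "\<And>\<xi> f. \<xi> \<in> scarrier V \<Longrightarrow> f \<in> Ag \<Longrightarrow> F (\<xi> \<otimes> f) = F' (\<xi> \<otimes> f)" "\<zeta> \<in> VA V"
  shows "F \<zeta> = F' \<zeta>"
  using tensor_of_eqI[of "scarrier V" Ag F F' \<zeta>] assms unfolding VA_def by blast

lemma VA_image_subset:
  assumes "qlinear_on (VA V) F" "qvec.subspace W"
    "\<And>\<xi> f. \<xi> \<in> scarrier V \<Longrightarrow> f \<in> Ag \<Longrightarrow> F (\<xi> \<otimes> f) \<in> W" "\<zeta> \<in> VA V"
  shows "F \<zeta> \<in> W"
  by (rule qlinear_on_image_span_subset[OF assms(1)[unfolded VA_def tensor_of_def] _ assms(2)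
        assms(4)[unfolded VA_def tensor_of_def]]) (use assms(3) in blast)

lemma bilin_ident: "bilin_on (scarrier V) Ag (\<lambda>\<xi> f x. f x *\<^sub>q \<xi>)"
  by (auto simp: bilin_on_def qlinear_on_def fun_eq_iff scaleQ_fun_def scaleQ_add_left scaleQ_add_right
      scaleQ_Cq_def scaleQ_scaleQ mult.commute)

lemma qlinear_on_ident: "qlinear_on (VA V) (ident V)"
  unfolding ident_def by (rule lift_VA(1)[OF bilin_ident])

lemma ident_tens: "\<xi> \<in> scarrier V \<Longrightarrow> f \<in> Ag \<Longrightarrow> ident V (\<xi> \<otimes> f) = (\<lambda>x. f x *\<^sub>q \<xi>)"
  unfolding ident_def by (rule lift_VA(2)[OF bilin_ident])

lemma inj_on_ident: "inj_on (ident V) (VA V)"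
  unfolding VA_def
  by (rule inj_on_tensor_evaluation[OF scarrier_subspace[OF V] subspace_Ag
        qlinear_on_ident[unfolded VA_def] ident_tens])

lemma ident_image_VA: "ident V ` VA V = fin_maps V"
proof -
  have "ident V ` VA V = qvec.span (ident V ` {v \<otimes> w |v w. v \<in> scarrier V \<and> w \<in> Ag})"
    unfolding VA_def tensor_of_def
    by (rule qlinear_on_image_span) (rule qlinear_on_ident[unfolded VA_def tensor_of_def])
  also have "ident V ` {v \<otimes> w |v w. v \<in> scarrier V \<and> w \<in> Ag}
      = {(\<lambda>x. f x *\<^sub>q \<xi>) | f \<xi>. f \<in> Ag \<and> \<xi> \<in> scarrier V}" (is "?L = ?R")
  proof
    show "?L \<subseteq> ?R" using ident_tens by blast
    show "?R \<subseteq> ?L"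
    proof clarify
      fix f :: "('m, 'n) uq \<Rightarrow> Cq" and \<xi> assume "f \<in> Ag" "\<xi> \<in> scarrier V"
      then show "(\<lambda>x. f x *\<^sub>q \<xi>) \<in> ?L"
        by (intro image_eqI[of _ _ "\<xi> \<otimes> f"]) (auto simp: ident_tens)
    qed
  qed
  finally show ?thesis by (simp add: fin_maps_def)
qed

lemma VA_part_subset: "VA_part V p \<subseteq> VA V"
  unfolding VA_part_def
  by (rule qvec.span_minimal[OF _ subspace_VA])
    (auto intro!: tens_in_VA part_in_scarrier[OF V] simp: Ag_part_def)

lemma subspace_VA_part: "qvec.subspace (VA_part V p)"
  unfolding VA_part_def by (rule qvec.subspace_span)

text \<open>For the inclusion from right to left, project the maps x -> f(x) \<xi> to degree
  \<open>p\<close>: the result comes from the sum over r of the component of \<xi> of degree p + r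
  tensored with the component of f of degree r, and p + r + r = p.\<close>

lemma ident_image_VA_part: "ident V ` VA_part V p = fin_maps V \<inter> lin_part V p"
proof
  note GL = graded_lin_part[OF V]
  note lin = qlinear_on_subset[OF qlinear_on_ident VA_part_subset]
  have "ident V \<zeta> \<in> lin_part V p" if "\<zeta> \<in> VA_part V p" for \<zeta>
  proof (rule qlinear_on_image_span_subset[OF lin[of p, unfolded VA_part_def] _ graded_subspace[OF GL]
        that[unfolded VA_part_def]])
    fix \<zeta> :: "('m, 'n, 'v) VA" assume "\<zeta> \<in> {\<xi> \<otimes> f |\<xi> f r s. p = r + s \<and> \<xi> \<in> part V r \<and> f \<in> Ag_part s}"
    then obtain \<xi> f r s where \<zeta>: "\<zeta> = \<xi> \<otimes> f" "p = r + s" "\<xi> \<in> part V r" "f \<in> Ag_part s" by blast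
    have f: "f \<in> Ag" "\<And>x. x \<in> uq_part (s + 1) \<Longrightarrow> f x = 0" using \<zeta>(4) by (auto simp: Ag_part_def)
    have \<xi>: "\<xi> \<in> scarrier V" by (rule part_in_scarrier[OF V \<zeta>(3)])
    have "f x *\<^sub>q \<xi> \<in> part V (p + t)" if x: "x \<in> uq_part t" for x t
    proof (cases "t = s")
      case True
      then show ?thesis using \<zeta>(2,3) qvec.subspace_scale[OF part_subspace[OF V]] by (simp add: add.assoc)
    next
      case False
      then have "t = s + 1" by (cases s; cases t) auto
      then show ?thesis using f(2) x qvec.subspace_0[OF part_subspace[OF V]] by simp
    qed
    then show "ident V \<zeta> \<in> lin_part V p"
      unfolding \<zeta>(1) ident_tens[OF \<xi> f(1)] lin_part_def
      using gsum_lin_partD(1)[OF V generator_in_lin_part[OF V f(1) \<xi>]] by blast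
  qed
  then show "ident V ` VA_part V p \<subseteq> fin_maps V \<inter> lin_part V p"
    using VA_part_subset ident_image_VA by blast
  show "fin_maps V \<inter> lin_part V p \<subseteq> ident V ` VA_part V p"
  proof
    fix h assume h: "h \<in> fin_maps V \<inter> lin_part V p"
    have "hcomp (lin_part V) p h \<in> ident V ` VA_part V p"
    proof (rule fin_maps_image[where V = V and h = h])
      show "qlinear_on (fin_maps V) (hcomp (lin_part V) p)"
        by (rule qlinear_on_subset[OF qlinear_on_hcomp[OF GL] fin_maps_subset[OF V]])
      show "qvec.subspace (ident V ` VA_part V p)"
        by (rule qlinear_on_image_subspace[OF lin subspace_VA_part])
      show "h \<in> fin_maps V" using h by blast
      fix f :: "('m, 'n) uq \<Rightarrow> Cq" and \<xi> assume f: "f \<in> Ag" and \<xi>: "\<xi> \<in> scarrier V"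
      have \<xi>p: "hcomp (part V) r \<xi> \<in> part V r" for r
        using hcomp_in[OF part_graded[OF V]] \<xi> by (simp add: scarrier_eq_gsum)
      have fp: "(\<lambda>x. f (uq_comp r x)) \<in> Ag_part r" for r
        unfolding hcomp_Ag_part[OF f, symmetric]
        by (rule hcomp_in[OF graded_Ag_part]) (simp add: gsum_Ag_part f)
      have t: "hcomp (part V) (p + r) \<xi> \<otimes> (\<lambda>x. f (uq_comp r x)) \<in> VA_part V p" for r
        unfolding VA_part_def
        by (rule qvec.span_base, rule CollectI, rule exI[of _ "hcomp (part V) (p + r) \<xi>"],
            rule exI[of _ "\<lambda>x. f (uq_comp r x)"], rule exI[of _ "p + r"], rule exI[of _ r])
          (simp add: \<xi>p fp add.assoc)
      have "ident V (\<Sum>r\<in>{0, 1}. hcomp (part V) (p + r) \<xi> \<otimes> (\<lambda>x. f (uq_comp r x)))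
          = (\<Sum>r\<in>{0, 1}. ident V (hcomp (part V) (p + r) \<xi> \<otimes> (\<lambda>x. f (uq_comp r x))))"
        by (rule qlinear_on_sum[OF qlinear_on_ident subspace_VA]) (use t VA_part_subset in blast)
      also have "\<dots> = hcomp (lin_part V) p (\<lambda>x. f x *\<^sub>q \<xi>)"
        unfolding lin_comp_generator[OF V f \<xi>]
        by (simp add: ident_tens part_in_scarrier[OF V \<xi>p] Ag_comp[OF f] fun_eq_iff)
      finally show "hcomp (lin_part V) p (\<lambda>x. f x *\<^sub>q \<xi>) \<in> ident V ` VA_part V p"
        using qvec.subspace_sum[OF subspace_VA_part, of "{0, 1}"] t by (metis (no_types, lifting) imageI)
    qed
    then show "h \<in> ident V ` VA_part V p" using h by (simp add: hcomp_same[OF GL])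
  qed
qed

lemma
  assumes T: "\<And>y. qlinear_on Ag (T y)" "\<And>y f. f \<in> Ag \<Longrightarrow> T y f \<in> Ag"
  shows qlinear_on_id_tens: "qlinear_on (VA V) (id_tens V T x)"
    and id_tens_in_VA: "\<zeta> \<in> VA V \<Longrightarrow> id_tens V T x \<zeta> \<in> VA V"
    and ident_id_tens: "\<xi> \<in> scarrier V \<Longrightarrow> f \<in> Ag \<Longrightarrow> ident V (id_tens V T x (\<xi> \<otimes> f))
      = (\<lambda>y. \<Sum>a\<in>{0, 1}. \<Sum>b\<in>{0, 1}. sg (a * b) *\<^sub>q T (uq_comp a x) f y *\<^sub>q hcomp (part V) b \<xi>)"
proof -
  note PG = part_graded[OF V]
  note H = qlinear_onD[OF qlinear_on_hcomp[OF PG]]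
  let ?b = "\<lambda>\<xi> f. \<Sum>a\<in>{0, 1}. \<Sum>b\<in>{0, 1}. sg (a * b) *\<^sub>q (hcomp (part V) b \<xi> \<otimes> T (uq_comp a x) f)"
  have bl: "bilin_on (scarrier V) Ag ?b"
    unfolding bilin_on_def
  proof (intro conjI ballI qlinear_on_sumf qlinear_on_scale)
    show "qlinear_on Ag (\<lambda>f. hcomp (part V) b \<xi> \<otimes> T (uq_comp a x) f)" for a b \<xi>
      by (rule qlinear_onI) (simp_all add: qlinear_onD[OF T(1)] tens_add_right tens_scale_right)
    show "qlinear_on (scarrier V) (\<lambda>\<xi>. hcomp (part V) b \<xi> \<otimes> T (uq_comp a x) f)" for a b f
      by (rule qlinear_onI) (simp_all add: H scarrier_eq_gsum tens_add_left tens_scale_left)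
  qed
  show lin: "qlinear_on (VA V) (id_tens V T x)"
    unfolding id_tens_def by (rule lift_VA(1)[OF bl])
  have eq: "id_tens V T x (\<xi> \<otimes> f) = ?b \<xi> f" if "\<xi> \<in> scarrier V" "f \<in> Ag" for \<xi> f
    unfolding id_tens_def by (rule lift_VA(2)[OF bl that])
  have hs: "hcomp (part V) b \<xi> \<in> scarrier V" if "\<xi> \<in> scarrier V" for b \<xi>
    using that by (intro part_in_scarrier[OF V hcomp_in[OF PG]]) (simp add: scarrier_eq_gsum)
  have t: "sg (a * b) *\<^sub>q (hcomp (part V) b \<xi> \<otimes> T (uq_comp a x) f) \<in> VA V"
    if "\<xi> \<in> scarrier V" "f \<in> Ag" for a b \<xi> f
    by (intro qvec.subspace_scale[OF subspace_VA] tens_in_VA hs T(2) that)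
  show "id_tens V T x \<zeta> \<in> VA V" if "\<zeta> \<in> VA V"
  proof (rule VA_image_subset[OF lin subspace_VA _ that])
    fix \<xi> and f :: "('m, 'n) uq \<Rightarrow> Cq" assume "\<xi> \<in> scarrier V" "f \<in> Ag"
    then show "id_tens V T x (\<xi> \<otimes> f) \<in> VA V"
      unfolding eq[OF \<open>\<xi> \<in> scarrier V\<close> \<open>f \<in> Ag\<close>] by (intro qvec.subspace_sum[OF subspace_VA] t)
  qed
  show "ident V (id_tens V T x (\<xi> \<otimes> f))
      = (\<lambda>y. \<Sum>a\<in>{0, 1}. \<Sum>b\<in>{0, 1}. sg (a * b) *\<^sub>q T (uq_comp a x) f y *\<^sub>q hcomp (part V) b \<xi>)"
    if \<xi>f: "\<xi> \<in> scarrier V" "f \<in> Ag"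
  proof -
    have "ident V (?b \<xi> f) = (\<Sum>a\<in>{0, 1}. \<Sum>b\<in>{0, 1}.
        ident V (sg (a * b) *\<^sub>q (hcomp (part V) b \<xi> \<otimes> T (uq_comp a x) f)))"
      by (subst qlinear_on_sum[OF qlinear_on_ident subspace_VA])
        (intro qvec.subspace_sum[OF subspace_VA] t \<xi>f, intro sum.cong refl
          qlinear_on_sum[OF qlinear_on_ident subspace_VA] t \<xi>f)
    also have "\<dots> = (\<Sum>a\<in>{0, 1}. \<Sum>b\<in>{0, 1}.
        sg (a * b) *\<^sub>q (\<lambda>y. T (uq_comp a x) f y *\<^sub>q hcomp (part V) b \<xi>))"
      by (simp only: qlinear_onD(2)[OF qlinear_on_ident tens_in_VA] ident_tens hs T(2) \<xi>f)
    finally show ?thesis unfolding eq[OF \<xi>f] by (simp add: fun_eq_iff scaleQ_fun_def)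
  qed
qed

lemma qlinear_on_id_tens_d:
  "qlinear_on (VA V) (id_tens V dL x)" "qlinear_on (VA V) (id_tens V dR x)"
  by (rule qlinear_on_id_tens[OF qlinear_on_dL dL_in_Ag] qlinear_on_id_tens[OF qlinear_on_dR dR_in_Ag];
      assumption)+

lemma id_tens_dL_in_VA: "\<zeta> \<in> VA V \<Longrightarrow> id_tens V dL x \<zeta> \<in> VA V"
  by (rule id_tens_in_VA[OF qlinear_on_dL dL_in_Ag])

lemma id_tens_dR_in_VA: "\<zeta> \<in> VA V \<Longrightarrow> id_tens V dR x \<zeta> \<in> VA V"
  by (rule id_tens_in_VA[OF qlinear_on_dR dR_in_Ag])

lemma ident_id_tens_d:
  assumes "\<xi> \<in> scarrier V" "f \<in> Ag"
  shows "ident V (id_tens V dL x (\<xi> \<otimes> f))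
      = (\<lambda>y. \<Sum>a\<in>{0, 1}. \<Sum>b\<in>{0, 1}. sg (a * b) *\<^sub>q dL (uq_comp a x) f y *\<^sub>q hcomp (part V) b \<xi>)"
    "ident V (id_tens V dR x (\<xi> \<otimes> f))
      = (\<lambda>y. \<Sum>a\<in>{0, 1}. \<Sum>b\<in>{0, 1}. sg (a * b) *\<^sub>q dR (uq_comp a x) f y *\<^sub>q hcomp (part V) b \<xi>)"
  by (rule ident_id_tens[OF qlinear_on_dL dL_in_Ag assms] ident_id_tens[OF qlinear_on_dR dR_in_Ag assms];
      assumption)+

lemma ident_in_lin_part: "\<zeta> \<in> VA V \<Longrightarrow> ident V \<zeta> \<in> gsum (lin_part V)"
  using ident_image_VA fin_maps_subset[OF V] by blast

lemma qlinear_on_lin_comp_ident: "qlinear_on (VA V) (\<lambda>\<zeta>. hcomp (lin_part V) p (ident V \<zeta>))"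
  by (rule qlinear_on_compose[OF qlinear_on_ident _ qlinear_on_hcomp[OF graded_lin_part[OF V]]])
    (use ident_in_lin_part in blast)

text \<open>The factor (-1)^([x][\<xi>]) of id \<otimes> dL and the factor (-1)^([x][f]) of dL
  combine into a sign that depends only on [x] and the parity of the map x -> f(x) \<xi>. So the
  equations for S can be stated by components of the map alone.\<close>

lemma ident_id_tens_dL:
  assumes "\<zeta> \<in> VA V"
  shows "ident V (id_tens V dL x \<zeta>) = (\<lambda>y. \<Sum>a\<in>{0, 1}. \<Sum>p\<in>{0, 1}.
    sg (a * p) *\<^sub>q hcomp (lin_part V) p (ident V \<zeta>) (antipode (uq_comp a x) * y))" (is "_ = ?G \<zeta>")
proof (rule VA_eqI[OF _ _ _ assms, of "\<lambda>\<zeta>. ident V (id_tens V dL x \<zeta>)" ?G])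
  show "qlinear_on (VA V) (\<lambda>\<zeta>. ident V (id_tens V dL x \<zeta>))"
    by (rule qlinear_on_compose[OF qlinear_on_id_tens_d(1) _ qlinear_on_ident])
      (rule image_subsetI, rule id_tens_dL_in_VA)
  show "qlinear_on (VA V) ?G"
    unfolding qlinear_on_apply_iff
    by (intro allI qlinear_on_sumf qlinear_on_scale qlinear_on_apply[OF qlinear_on_lin_comp_ident])
  fix \<xi> and f :: "('m, 'n) uq \<Rightarrow> Cq" assume \<xi>: "\<xi> \<in> scarrier V" and f: "f \<in> Ag"
  note F = qlinearD[OF qlinear_Ag[OF f]]
  have S0: "antipode 0 = (0 :: ('m, 'n) uq)" by (rule qlinearD(3)[OF qlinear_antipode])
  show "ident V (id_tens V dL x (\<xi> \<otimes> f)) = ?G (\<xi> \<otimes> f)"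
    unfolding ident_id_tens_d(1)[OF \<xi> f] ident_tens[OF \<xi> f]
      lin_comp_generator[OF V f \<xi>] dL_eq[OF f]
    by (simp add: fun_eq_iff uq_comp_comp S0 F qlinearD[OF qlinear_uq_comp] scaleQ_add_left
        scaleQ_add_right scaleQ_one algebra_simps)
qed

text \<open>The signs are (-1)^[x] from dR and (-1)^([x][\<xi>]) from id \<otimes> dR. For
  homogeneous f the value f(y x) vanishes unless [f] = [y] + [x], and then the exponent equals
  [x]([y] + [f] + [\<xi>]), as in the action on homomorphisms.\<close>

lemma ident_id_tens_dR:
  assumes "\<zeta> \<in> VA V"
  shows "ident V (id_tens V dR x \<zeta>) = (\<lambda>y. \<Sum>a\<in>{0, 1}. \<Sum>c\<in>{0, 1}.
    sg (a * c) *\<^sub>q hcomp (lin_part V) c (ident V \<zeta>) (par_twist a y * uq_comp a x))" (is "_ = ?G \<zeta>")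
proof (rule VA_eqI[OF _ _ _ assms, of "\<lambda>\<zeta>. ident V (id_tens V dR x \<zeta>)" ?G])
  show "qlinear_on (VA V) (\<lambda>\<zeta>. ident V (id_tens V dR x \<zeta>))"
    by (rule qlinear_on_compose[OF qlinear_on_id_tens_d(2) _ qlinear_on_ident])
      (rule image_subsetI, rule id_tens_dR_in_VA)
  show "qlinear_on (VA V) ?G"
    unfolding qlinear_on_apply_iff
    by (intro allI qlinear_on_sumf qlinear_on_scale qlinear_on_apply[OF qlinear_on_lin_comp_ident])
  fix \<xi> and f :: "('m, 'n) uq \<Rightarrow> Cq" assume \<xi>: "\<xi> \<in> scarrier V" and f: "f \<in> Ag"
  note F = qlinearD[OF qlinear_Ag[OF f]]
  \<comment> \<open>The function \<open>f\<close> is not assumed homogeneous, so its values at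
    products have to be split by parity before the signs can be matched.\<close>
  have fs: "f u = f (uq_comp 0 u) + f (uq_comp 1 u)" for u
    using F(1)[of "uq_comp 0 u" "uq_comp 1 u"] by (simp add: uq_comp_sum)
  show "ident V (id_tens V dR x (\<xi> \<otimes> f)) = ?G (\<xi> \<otimes> f)"
    unfolding ident_id_tens_d(2)[OF \<xi> f] ident_tens[OF \<xi> f] lin_comp_generator[OF V f \<xi>]
    unfolding dR_def
    by (simp add: fun_eq_iff uq_comp_comp F par_twist_def uq_comp_twist_mult[OF uq_comp_in]
        fs[of "_ * uq_comp 0 x"] fs[of "_ * uq_comp 1 x"] scaleQ_add_left
        scaleQ_add_right scaleQ_one algebra_simps)
qed

lemma fin_part_subset: "fin_part \<Theta> V p \<subseteq> fin_maps V" "fin_part \<Theta> V p \<subseteq> lin_part V p"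
  using hom_part_subset[OF V] by (auto simp: fin_part_def)

end

section \<open>The equations defining S as a homomorphism condition\<close>

context
  fixes \<Theta> :: "nat set" and V :: "('m::finite, 'n::finite, 'v::qvec) smod"
  assumes \<Theta>: "\<Theta> \<subseteq> {1..CARD('m) + CARD('n) - 1}" and V: "supermodule (uq_sub \<Theta>) V"
begin

lemma
  assumes z: "z \<in> uq_sub \<Theta>"
  shows act_tens_id_in_VA: "\<zeta> \<in> VA V \<Longrightarrow> act_tens_id V z \<zeta> \<in> VA V"
    and ident_act_tens_id: "\<zeta> \<in> VA V \<Longrightarrow> ident V (act_tens_id V z \<zeta>) = (\<lambda>y. act V z (ident V \<zeta> y))"
proof -
  note A = qlinear_onD[OF supermodule_linear[OF V z]]
  have A_in: "act V z \<xi> \<in> scarrier V" if "\<xi> \<in> scarrier V" for \<xi>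
    by (rule supermodule_act_in[OF V \<Theta> z that])
  have bl: "bilin_on (scarrier V) Ag (\<lambda>\<xi> f. act V z \<xi> \<otimes> f)"
    by (simp add: bilin_on_def qlinear_on_def A tens_add_left tens_add_right tens_scale_left tens_scale_right)
  have lin: "qlinear_on (VA V) (act_tens_id V z)"
    unfolding act_tens_id_def by (rule lift_VA(1)[OF V bl])
  have eq: "act_tens_id V z (\<xi> \<otimes> f) = act V z \<xi> \<otimes> f" if "\<xi> \<in> scarrier V" "f \<in> Ag" for \<xi> f
    unfolding act_tens_id_def by (rule lift_VA(2)[OF V bl that])
  show VAin: "act_tens_id V z \<zeta> \<in> VA V" if "\<zeta> \<in> VA V" for \<zeta>
    by (rule VA_image_subset[OF V lin subspace_VA[OF V] _ that]) (simp add: eq tens_in_VA[OF V] A_in)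
  have in_c: "ident V \<zeta> y \<in> scarrier V" if "\<zeta> \<in> VA V" for \<zeta> y
    using that ident_image_VA[OF V] fin_maps_subset[OF V] gsum_lin_partD(2)[OF V] by blast
  show "ident V (act_tens_id V z \<zeta>) = (\<lambda>y. act V z (ident V \<zeta> y))" if "\<zeta> \<in> VA V"
  proof (rule VA_eqI[OF V _ _ _ that, of "\<lambda>\<zeta>. ident V (act_tens_id V z \<zeta>)" "\<lambda>\<zeta> y. act V z (ident V \<zeta> y)"])
    show "qlinear_on (VA V) (\<lambda>\<zeta>. ident V (act_tens_id V z \<zeta>))"
      by (rule qlinear_on_compose[OF lin _ qlinear_on_ident[OF V]]) (use VAin in blast)
    show "qlinear_on (VA V) (\<lambda>\<zeta> y. act V z (ident V \<zeta> y))"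
      by (rule qlinear_onI) (simp_all add: fun_eq_iff scaleQ_fun_def qlinear_onD[OF qlinear_on_ident[OF V]] A in_c)
    show "ident V (act_tens_id V z (\<xi> \<otimes> f)) = (\<lambda>y. act V z (ident V (\<xi> \<otimes> f) y))"
      if "\<xi> \<in> scarrier V" "f \<in> Ag" for \<xi> f
      using that by (simp add: eq ident_tens[OF V] A_in A)
  qed
qed

text \<open>Each equation for S equates sums over both components of the map. For homogeneous
  arguments the two components take values in different parts, so the equation separates into one
  condition for each component.\<close>

lemma S_space_iff:
  assumes \<zeta>: "\<zeta> \<in> VA V"
  shows "\<zeta> \<in> S_space \<Theta> V \<longleftrightarrow> (\<forall>p. hcomp (lin_part V) p (ident V \<zeta>) \<in> hom_part \<Theta> V p)"
proof -
  define h where "h p = hcomp (lin_part V) p (ident V \<zeta>)" for p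
  note GL = graded_lin_part[OF V]
  note PG = part_graded[OF V]
  have hl: "h p \<in> lin_part V p" for p
    unfolding h_def by (rule hcomp_in[OF GL ident_in_lin_part[OF V \<zeta>]])
  note L = qlinearD[OF lin_part_qlinear[OF V hl]]
  have h_in: "h p y \<in> scarrier V" for p y
    by (rule gsum_lin_partD(2)[OF V graded_in_gsum[OF GL hl]])
  have h_sum: "ident V \<zeta> y = h 0 y + h 1 y" for y
    using hcomp_sum[OF GL ident_in_lin_part[OF V \<zeta>]] unfolding h_def by (metis plus_fun_apply)
  have A: "act V z (u + v) = act V z u + act V z v"
    if "z \<in> uq_sub \<Theta>" "u \<in> scarrier V" "v \<in> scarrier V" for z u v
    by (rule qlinear_onD(1)[OF supermodule_linear[OF V that(1)] that(2,3)])
  have cond: "\<zeta> \<in> S_space \<Theta> V \<longleftrightarrow> (\<forall>x\<in>uq_sub \<Theta>. \<forall>y.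
    (\<Sum>a\<in>{0, 1}. \<Sum>p\<in>{0, 1}. sg (a * p) *\<^sub>q h p (antipode (uq_comp a x) * y))
      = act V (antipode x) (h 0 y + h 1 y))"
  proof -
    have "id_tens V dL x \<zeta> = act_tens_id V (antipode x) \<zeta> \<longleftrightarrow>
      ident V (id_tens V dL x \<zeta>) = ident V (act_tens_id V (antipode x) \<zeta>)"
      if "x \<in> uq_sub \<Theta>" for x
      by (rule inj_on_eq_iff[OF inj_on_ident[OF V] id_tens_dL_in_VA[OF V \<zeta>]
          act_tens_id_in_VA[OF antipode_sub[OF \<Theta> that] \<zeta>], symmetric])
    then show ?thesis
      unfolding S_space_def using \<zeta> antipode_sub[OF \<Theta>]
      by (simp add: ident_id_tens_dL[OF V] ident_act_tens_id fun_eq_iff h_sum flip: h_def)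
  qed
  show ?thesis
    unfolding h_def[symmetric]
  proof
    assume S: "\<zeta> \<in> S_space \<Theta> V"
    have key: "h p (z * y) = sg (a * p) *\<^sub>q act V z (h p y)"
      if z: "z \<in> uq_sub \<Theta>" "z \<in> uq_part a" and y: "y \<in> uq_part r" for p z y a r
    proof -
      obtain x where x: "x \<in> uq_sub \<Theta>" "x \<in> uq_part a" "antipode x = z"
        using antipode_sub_part_surj[OF \<Theta> z] by blast
      \<comment> \<open>Here \<open>z\<close> is the antipode of a homogeneous \<open>x\<close>.
        Both \<open>k p\<close> and the action of \<open>z\<close> on \<open>h p y\<close> lie in
        degree p + a + r, so the terms for p = 0 and p = 1 lie in complementary parts.\<close>
      define k where "k p = sg (a * p) *\<^sub>q h p (z * y)" for p
      have "(\<Sum>b\<in>{0, 1}. \<Sum>p\<in>{0, 1}. sg (b * p) *\<^sub>q h p (antipode (uq_comp b x) * y)) = k 0 + k 1"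
        using x uq_comp_same[OF x(2)] uq_comp_other[OF x(2)]
        by (cases a) (simp_all add: k_def qlinearD(3)[OF qlinear_antipode] L)
      then have eq: "k 0 + k 1 = act V z (h 0 y) + act V z (h 1 y)"
        using S x(1,3) A[OF z(1) h_in h_in] unfolding cond by simp
      have kp: "k p \<in> part V (p + (a + r))" for p
        unfolding k_def
        by (intro qvec.subspace_scale[OF part_subspace[OF V]] lin_part_in[OF V hl] uq_part_mult z y)
      have ap: "act V z (h p y) \<in> part V (p + (a + r))" for p
      proof -
        have "act V z (h p y) \<in> part V (a + (p + r))"
          by (rule supermodule_part[OF V z lin_part_in[OF V hl y]])
        then show ?thesis by (simp only: add.left_commute)
      qed
      have "k p = act V z (h p y)" for p
      proof -
        define d where "d p = k p - act V z (h p y)" for p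
        have dp: "d p \<in> part V (p + (a + r))" for p
          unfolding d_def by (rule qvec.subspace_diff[OF part_subspace[OF V] kp ap])
        have "d 0 + d 1 = 0" using eq by (simp add: d_def algebra_simps)
        \<comment> \<open>The two differences are negatives of each other and lie in opposite parts,
          so both vanish.\<close>
        then have "d p = - d (p + 1)" by (cases p) (simp_all add: eq_neg_iff_add_eq_0 add.commute)
        then have "d p \<in> part V (p + (a + r) + 1)"
          using qvec.subspace_neg[OF part_subspace[OF V] dp[of "p + 1"]] by (simp add: add_ac)
        then have "d p = 0" by (rule graded_disjoint[OF PG dp])
        then show ?thesis by (simp add: d_def)
      qed
      then have "sg (a * p) *\<^sub>q h p (z * y) = act V z (h p y)" by (simp only: k_def)
      then show ?thesis by (metis sg_mult_scale)
    qed
    show "\<forall>p. h p \<in> hom_part \<Theta> V p"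
      unfolding hom_part_def
    proof (intro allI CollectI conjI ballI)
      show "qlinear (h p)" "h p ` uq_part r \<subseteq> part V (p + r)" for p r
        using hl[of p] by (simp_all add: lin_part_def)
      fix p r z y assume z: "z \<in> uq_sub \<Theta> \<inter> (uq_part r :: ('m, 'n) uq set)"
      have "h p (z * y) = h p (z * uq_comp 0 y) + h p (z * uq_comp 1 y)"
        by (simp add: uq_comp_sum flip: L distrib_left)
      also have "\<dots> = sg (r * p) *\<^sub>q act V z (h p (uq_comp 0 y)) + sg (r * p) *\<^sub>q act V z (h p (uq_comp 1 y))"
        by (simp only: key[OF IntD1[OF z] IntD2[OF z] uq_comp_in])
      also have "\<dots> = sg (r * p) *\<^sub>q act V z (h p (uq_comp 0 y) + h p (uq_comp 1 y))"
        using z by (simp add: A h_in scaleQ_add_right)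
      also have "h p (uq_comp 0 y) + h p (uq_comp 1 y) = h p y"
        by (simp add: uq_comp_sum flip: L)
      finally show "h p (z * y) = sg (r * p) *\<^sub>q act V z (h p y)" .
    qed
  next
    assume hom: "\<forall>p. h p \<in> hom_part \<Theta> V p"
    have key: "h p (z * y) = sg (a * p) *\<^sub>q act V z (h p y)"
      if "z \<in> uq_sub \<Theta>" "z \<in> uq_part a" for p z y a
      using hom that unfolding hom_part_def by blast
    show "\<zeta> \<in> S_space \<Theta> V"
      unfolding cond
    proof (intro ballI allI)
      fix x y :: "('m, 'n) uq" assume x: "x \<in> uq_sub \<Theta>"
      have Sx: "antipode (uq_comp a x) \<in> uq_sub \<Theta>" "antipode (uq_comp a x) \<in> uq_part a" for a
        by (simp_all add: antipode_sub[OF \<Theta>] uq_comp_sub[OF \<Theta>] x antipode_in_part uq_comp_in)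
      have v: "h 0 y + h 1 y \<in> scarrier V" by (intro qvec.subspace_add[OF scarrier_subspace[OF V]] h_in)
      \<comment> \<open>The sign in the equation meets the same sign in the homomorphism property
        and cancels; afterwards the components of \<open>x\<close> can be reassembled.\<close>
      have "(\<Sum>a\<in>{0, 1}. \<Sum>p\<in>{0, 1}. sg (a * p) *\<^sub>q h p (antipode (uq_comp a x) * y))
          = (\<Sum>a\<in>{0, 1}. \<Sum>p\<in>{0, 1}. act V (antipode (uq_comp a x)) (h p y))"
        by (simp only: key[OF Sx] sg_mult_scale)
      also have "\<dots> = act V (antipode (uq_comp 0 x)) (h 0 y + h 1 y) + act V (antipode (uq_comp 1 x)) (h 0 y + h 1 y)"
        by (simp add: A[OF Sx(1) h_in h_in])
      also have "\<dots> = act V (antipode (uq_comp 0 x) + antipode (uq_comp 1 x)) (h 0 y + h 1 y)"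
        by (rule qlinear_onD(1)[OF supermodule_linear'[OF V v] Sx(1) Sx(1), symmetric])
      also have "antipode (uq_comp 0 x) + antipode (uq_comp 1 x) = antipode x"
        by (simp add: uq_comp_sum flip: qlinearD(1)[OF qlinear_antipode])
      finally show "(\<Sum>a\<in>{0, 1}. \<Sum>p\<in>{0, 1}. sg (a * p) *\<^sub>q h p (antipode (uq_comp a x) * y))
          = act V (antipode x) (h 0 y + h 1 y)" .
    qed
  qed
qed

lemma ident_S_space: "\<zeta> \<in> S_space \<Theta> V \<longleftrightarrow> \<zeta> \<in> VA V \<and> ident V \<zeta> \<in> gsum (fin_part \<Theta> V)"
proof
  assume S: "\<zeta> \<in> S_space \<Theta> V"
  then have \<zeta>: "\<zeta> \<in> VA V" using S_space_subset[of \<Theta> V] by blast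
  then have "ident V \<zeta> \<in> fin_maps V" using ident_image_VA[OF V] by blast
  then have "hcomp (lin_part V) p (ident V \<zeta>) \<in> fin_part \<Theta> V p" for p
    using S S_space_iff[OF \<zeta>] lin_comp_fin_maps[OF V] by (simp add: fin_part_def)
  then show "\<zeta> \<in> VA V \<and> ident V \<zeta> \<in> gsum (fin_part \<Theta> V)"
    using \<zeta> hcomp_sum[OF graded_lin_part[OF V] ident_in_lin_part[OF V \<zeta>]]
    unfolding gsum_def by (metis (mono_tags, lifting) mem_Collect_eq)
next
  assume \<zeta>: "\<zeta> \<in> VA V \<and> ident V \<zeta> \<in> gsum (fin_part \<Theta> V)"
  then obtain g k where gk: "ident V \<zeta> = g + k" "g \<in> fin_part \<Theta> V 0" "k \<in> fin_part \<Theta> V 1"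
    by (auto simp: gsum_def)
  note GL = graded_lin_part[OF V]
  have l: "g \<in> lin_part V 0" "k \<in> lin_part V 1" using gk fin_part_subset(2)[OF V] by blast+
  have "hcomp (lin_part V) 0 (g + k) = g" "hcomp (lin_part V) 1 (k + g) = k"
    using l by (auto intro!: hcomp_add_distinct[OF GL])
  then have "hcomp (lin_part V) p (ident V \<zeta>) \<in> hom_part \<Theta> V p" for p
    using gk by (cases p) (simp_all add: fin_part_def add.commute)
  then show "\<zeta> \<in> S_space \<Theta> V" using S_space_iff \<zeta> by blast
qed

lemma ident_S_part: "ident V ` part (S_obj \<Theta> V) p = fin_part \<Theta> V p"
proof
  note GL = graded_lin_part[OF V]
  show "ident V ` part (S_obj \<Theta> V) p \<subseteq> fin_part \<Theta> V p"
  proof clarify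
    fix \<zeta> assume "\<zeta> \<in> part (S_obj \<Theta> V) p"
    then have \<zeta>: "\<zeta> \<in> S_space \<Theta> V" "\<zeta> \<in> VA_part V p" by (simp_all add: S_obj_def)
    then have h: "ident V \<zeta> \<in> fin_maps V" "ident V \<zeta> \<in> lin_part V p"
      using ident_image_VA_part[OF V, of p] by blast+
    have "hcomp (lin_part V) p (ident V \<zeta>) \<in> hom_part \<Theta> V p"
      using S_space_iff \<zeta>(1) S_space_subset[of \<Theta> V] by blast
    then show "ident V \<zeta> \<in> fin_part \<Theta> V p" using h by (simp add: fin_part_def hcomp_same[OF GL])
  qed
  show "fin_part \<Theta> V p \<subseteq> ident V ` part (S_obj \<Theta> V) p"
  proof
    fix h assume h: "h \<in> fin_part \<Theta> V p"
    then have "h \<in> ident V ` VA_part V p" using ident_image_VA_part[OF V, of p] fin_part_subset[OF V] by blast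
    then obtain \<zeta> where \<zeta>: "\<zeta> \<in> VA_part V p" "h = ident V \<zeta>" by blast
    then have "\<zeta> \<in> S_space \<Theta> V"
      using ident_S_space graded_in_gsum[OF graded_fin_part[OF V] h] VA_part_subset[OF V] by blast
    then show "h \<in> ident V ` part (S_obj \<Theta> V) p" using \<zeta> by (simp add: S_obj_def)
  qed
qed

text \<open>Both actions have already been brought to the same formula, in
  \<open>ident_id_tens_dR\<close> and in \<open>act_hom_mod\<close>.\<close>

lemma ident_S_act:
  assumes "\<zeta> \<in> S_space \<Theta> V"
  shows "ident V (act (S_obj \<Theta> V) x \<zeta>) = act (hom_mod \<Theta> V) x (ident V \<zeta>)"
proof -
  have "ident V \<zeta> \<in> gsum (hom_part \<Theta> V)"
    using assms ident_S_space gsum_mono[of "fin_part \<Theta> V" "hom_part \<Theta> V"] by (auto simp: fin_part_def)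
  then show ?thesis
    using assms S_space_subset[of \<Theta> V]
    by (subst act_hom_mod[OF V]) (auto simp: S_obj_def ident_id_tens_dR[OF V])
qed

text \<open>It is not built into the definition that the solution space of the equations is graded.
  This is seen after applying the injective map \<open>ident\<close>, under which it corresponds to
  the graded space \<open>gsum (fin_part \<Theta> V)\<close>.\<close>

lemma scarrier_S_obj: "scarrier (S_obj \<Theta> V) = S_space \<Theta> V"
proof
  have part: "part (S_obj \<Theta> V) p \<subseteq> VA V" "part (S_obj \<Theta> V) p \<subseteq> S_space \<Theta> V" for p
    using S_space_subset[of \<Theta> V] by (auto simp: S_obj_def)
  have add: "ident V (u + w) = ident V u + ident V w" "u + w \<in> VA V"
    if "u \<in> VA V" "w \<in> VA V" for u w
    using that by (simp_all add: qlinear_onD[OF qlinear_on_ident[OF V]] qvec.subspace_add[OF subspace_VA[OF V]])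
  show "scarrier (S_obj \<Theta> V) \<subseteq> S_space \<Theta> V"
  proof
    fix \<zeta> assume "\<zeta> \<in> scarrier (S_obj \<Theta> V)"
    then obtain u w where uw: "\<zeta> = u + w" "u \<in> part (S_obj \<Theta> V) 0" "w \<in> part (S_obj \<Theta> V) 1"
      by (auto simp: scarrier_def)
    have VA: "u \<in> VA V" "w \<in> VA V" using uw(2,3) part(1) by blast+
    have "ident V u \<in> fin_part \<Theta> V 0" "ident V w \<in> fin_part \<Theta> V 1"
      using uw(2,3) unfolding ident_S_part[symmetric] by blast+
    then have "ident V u + ident V w \<in> gsum (fin_part \<Theta> V)" by (auto simp: gsum_def)
    then show "\<zeta> \<in> S_space \<Theta> V" unfolding ident_S_space uw(1) using add[OF VA] by simp
  qed
  show "S_space \<Theta> V \<subseteq> scarrier (S_obj \<Theta> V)"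
  proof
    fix \<zeta> assume "\<zeta> \<in> S_space \<Theta> V"
    then have \<zeta>: "\<zeta> \<in> VA V" "ident V \<zeta> \<in> gsum (fin_part \<Theta> V)" using ident_S_space by blast+
    then obtain g k where gk: "ident V \<zeta> = g + k" "g \<in> fin_part \<Theta> V 0" "k \<in> fin_part \<Theta> V 1"
      by (auto simp: gsum_def)
    then obtain u w where u: "g = ident V u" "u \<in> part (S_obj \<Theta> V) 0"
      and w: "k = ident V w" "w \<in> part (S_obj \<Theta> V) 1"
      unfolding ident_S_part[symmetric] by blast
    have VA: "u \<in> VA V" "w \<in> VA V" using u(2) w(2) part(1) by blast+
    have "ident V \<zeta> = ident V (u + w)" using gk(1) u(1) w(1) add[OF VA] by simp
    then have "\<zeta> = u + w" by (rule inj_onD[OF inj_on_ident[OF V] _ \<zeta>(1) add(2)[OF VA]])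
    then show "\<zeta> \<in> scarrier (S_obj \<Theta> V)" using u(2) w(2) by (auto simp: scarrier_def)
  qed
qed

lemma cat_obj_S_obj: "cat_obj {1..CARD('m) + CARD('n) - 1} (S_obj \<Theta> V)"
proof (rule cat_obj_transport[OF cat_obj_fin_part[OF V] order_refl qlinear_on_ident[OF V] inj_on_ident[OF V] subspace_VA[OF V]])
  show "part (S_obj \<Theta> V) p \<subseteq> VA V" for p using S_space_subset[of \<Theta> V] by (auto simp: S_obj_def)
  show "ident V ` part (S_obj \<Theta> V) p = part ((hom_mod \<Theta> V) \<lparr> part := fin_part \<Theta> V \<rparr>) p" for p
    by (simp add: ident_S_part)
  fix x \<zeta> assume "\<zeta> \<in> scarrier (S_obj \<Theta> V)"
  then have \<zeta>: "\<zeta> \<in> S_space \<Theta> V" by (simp only: scarrier_S_obj)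
  show "act (S_obj \<Theta> V) x \<zeta> \<in> VA V"
    using id_tens_dR_in_VA[OF V] \<zeta> S_space_subset[of \<Theta> V] by (auto simp: S_obj_def)
  show "ident V (act (S_obj \<Theta> V) x \<zeta>) = act ((hom_mod \<Theta> V) \<lparr> part := fin_part \<Theta> V \<rparr>) x (ident V \<zeta>)"
    by (simp add: ident_S_act[OF \<zeta>])
qed

lemma ident_S_space_image: "ident V ` S_space \<Theta> V = gsum (fin_part \<Theta> V)"
proof
  show "ident V ` S_space \<Theta> V \<subseteq> gsum (fin_part \<Theta> V)" using ident_S_space by blast
  show "gsum (fin_part \<Theta> V) \<subseteq> ident V ` S_space \<Theta> V"
  proof
    fix h assume h: "h \<in> gsum (fin_part \<Theta> V)"
    then have "h \<in> fin_maps V"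
      using fin_part_subset(1)[OF V] qvec.subspace_add[OF subspace_fin_maps] by (fastforce simp: gsum_def)
    then obtain \<zeta> where "\<zeta> \<in> VA V" "h = ident V \<zeta>" unfolding ident_image_VA[OF V, symmetric] by blast
    then show "h \<in> ident V ` S_space \<Theta> V" using h ident_S_space by blast
  qed
qed

end

section \<open>Morphisms\<close>

context
  fixes \<Theta> :: "nat set" and V :: "('m::finite, 'n::finite, 'v::qvec) smod"
    and W :: "('m, 'n, 'w::qvec) smod" and \<phi> :: "'v \<Rightarrow> 'w"
  assumes \<Theta>: "\<Theta> \<subseteq> {1..CARD('m) + CARD('n) - 1}" and V: "supermodule (uq_sub \<Theta>) V"
    and W: "supermodule (uq_sub \<Theta>) W" and \<phi>: "cat_mor \<Theta> V W \<phi>"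
begin

lemma mor_linear: "qlinear_on (scarrier V) \<phi>"
  and mor_part: "v \<in> part V p \<Longrightarrow> \<phi> v \<in> part W p"
  and mor_act: "x \<in> uq_sub \<Theta> \<Longrightarrow> v \<in> scarrier V \<Longrightarrow> \<phi> (act V x v) = act W x (\<phi> v)"
  using \<phi> by (auto simp: cat_mor_def)

lemma mor_scarrier:
  assumes "v \<in> scarrier V" shows "\<phi> v \<in> scarrier W"
proof -
  obtain u w where uw: "v = u + w" "u \<in> part V 0" "w \<in> part V 1"
    using assms unfolding scarrier_def by blast
  have "\<phi> v = \<phi> u + \<phi> w"
    unfolding uw(1) by (intro qlinear_onD(1)[OF mor_linear] part_in_scarrier[OF V uw(2)]
        part_in_scarrier[OF V uw(3)])
  then show ?thesis using mor_part[OF uw(2)] mor_part[OF uw(3)] unfolding scarrier_def by blast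
qed

lemma mor_lin_part:
  assumes "h \<in> lin_part V p" shows "ind_mor \<phi> h \<in> lin_part W p"
proof -
  have "h x \<in> scarrier V" for x
    by (rule gsum_lin_partD(2)[OF V graded_in_gsum[OF graded_lin_part[OF V] assms]])
  then have "qlinear (\<lambda>x. \<phi> (h x))"
    by (intro qlinearI)
      (simp_all add: qlinearD[OF lin_part_qlinear[OF V assms]] qlinear_onD[OF mor_linear])
  then show ?thesis
    by (simp add: lin_part_def ind_mor_def comp_def image_subset_iff mor_part lin_part_in[OF V assms])
qed

lemma qlinear_on_ind_mor: "qlinear_on (gsum (lin_part V)) (ind_mor \<phi>)"
  by (rule qlinear_onI)
    (simp_all add: ind_mor_def fun_eq_iff scaleQ_fun_def qlinear_onD[OF mor_linear] gsum_lin_partD(2)[OF V])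

text \<open>Morphisms of the category are even, so composing with \<phi> preserves degrees and hence
  components; the signs in the action on maps are then unaffected.\<close>

lemma lin_comp_ind_mor:
  assumes "h \<in> gsum (lin_part V)"
  shows "hcomp (lin_part W) p (ind_mor \<phi> h) = ind_mor \<phi> (hcomp (lin_part V) p h)"
proof (rule hcompI[OF graded_lin_part[OF W]])
  note GV = graded_lin_part[OF V]
  have d: "hcomp (lin_part V) p h \<in> lin_part V p" "h - hcomp (lin_part V) p h \<in> lin_part V (p + 1)"
    using hcomp_in_diff[OF GV assms] by blast+
  show "ind_mor \<phi> (hcomp (lin_part V) p h) \<in> lin_part W p" by (rule mor_lin_part[OF d(1)])
  have "ind_mor \<phi> h - ind_mor \<phi> (hcomp (lin_part V) p h) = ind_mor \<phi> (h - hcomp (lin_part V) p h)"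
    by (rule qlinear_on_diff[OF qlinear_on_ind_mor subspace_gsum[OF GV] assms
          graded_in_gsum[OF GV d(1)], symmetric])
  then show "ind_mor \<phi> h - ind_mor \<phi> (hcomp (lin_part V) p h) \<in> lin_part W (p + 1)"
    using mor_lin_part[OF d(2)] by simp
qed

lemma mor_hom_part:
  assumes "h \<in> hom_part \<Theta> V p" shows "ind_mor \<phi> h \<in> hom_part \<Theta> W p"
proof -
  have l: "h \<in> lin_part V p" using hom_part_subset[OF V] assms by blast
  have in_c: "h y \<in> scarrier V" for y
    by (rule gsum_lin_partD(2)[OF V graded_in_gsum[OF graded_lin_part[OF V] l]])
  have "ind_mor \<phi> h (x * y) = sg (r * p) *\<^sub>q act W x (ind_mor \<phi> h y)"
    if x: "x \<in> uq_sub \<Theta> \<inter> uq_part r" for r x y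
  proof -
    have "h (x * y) = sg (r * p) *\<^sub>q act V x (h y)" using assms x unfolding hom_part_def by blast
    moreover have "act V x (h y) \<in> scarrier V" using supermodule_act_in[OF V \<Theta> IntD1[OF x] in_c] .
    ultimately show ?thesis
      using x in_c by (simp add: ind_mor_def qlinear_onD[OF mor_linear] mor_act)
  qed
  then show ?thesis using mor_lin_part[OF l] by (simp add: hom_part_def lin_part_def)
qed

lemma ind_mor_act:
  assumes h: "h \<in> gsum (hom_part \<Theta> V)"
  shows "ind_mor \<phi> (act (hom_mod \<Theta> V) y h) = act (hom_mod \<Theta> W) y (ind_mor \<phi> h)"
proof -
  have hl: "h \<in> gsum (lin_part V)" using h gsum_hom_part_subset[OF V] by blast
  obtain g k where gk: "h = g + k" "g \<in> hom_part \<Theta> V 0" "k \<in> hom_part \<Theta> V 1"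
    using h by (auto simp: gsum_def)
  note GH = graded_hom_part[OF V]
  have "ind_mor \<phi> h = ind_mor \<phi> g + ind_mor \<phi> k"
    using gk graded_in_gsum[OF GH] gsum_hom_part_subset[OF V] by (auto intro!: qlinear_onD(1)[OF qlinear_on_ind_mor])
  then have mh: "ind_mor \<phi> h \<in> gsum (hom_part \<Theta> W)"
    using mor_hom_part gk by (auto simp: gsum_def)
  have lc: "hcomp (lin_part V) c h z \<in> scarrier V" for c z
    by (rule gsum_lin_partD(2)[OF V graded_in_gsum[OF graded_lin_part[OF V]
            hcomp_in[OF graded_lin_part[OF V] hl]]])
  note sub = scarrier_subspace[OF V]
  show ?thesis
    unfolding act_hom_mod[OF V h] act_hom_mod[OF W mh] lin_comp_ind_mor[OF hl]
    by (simp only: ind_mor_def comp_def)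
      (simp only: qlinear_on_sum[OF mor_linear sub] qlinear_onD(2)[OF mor_linear]
        qvec.subspace_sum[OF sub] qvec.subspace_scale[OF sub] lc)
qed

lemma bilin_mor: "bilin_on (scarrier V) Ag (\<lambda>\<xi> f. \<phi> \<xi> \<otimes> f)"
  by (simp add: bilin_on_def qlinear_on_def qlinear_onD[OF mor_linear]
      tens_add_left tens_add_right tens_scale_left tens_scale_right)

lemma qlinear_on_S_mor: "qlinear_on (VA V) (S_mor V \<phi>)"
  unfolding S_mor_def by (rule lift_VA(1)[OF V bilin_mor])

lemma S_mor_tens: "\<xi> \<in> scarrier V \<Longrightarrow> f \<in> Ag \<Longrightarrow> S_mor V \<phi> (\<xi> \<otimes> f) = \<phi> \<xi> \<otimes> f"
  unfolding S_mor_def by (rule lift_VA(2)[OF V bilin_mor])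

lemma S_mor_in_VA: "\<zeta> \<in> VA V \<Longrightarrow> S_mor V \<phi> \<zeta> \<in> VA W"
  by (rule VA_image_subset[OF V qlinear_on_S_mor subspace_VA[OF W]])
    (simp_all add: S_mor_tens tens_in_VA[OF W] mor_scarrier)

lemma ident_S_mor:
  assumes "\<zeta> \<in> VA V" shows "ident W (S_mor V \<phi> \<zeta>) = ind_mor \<phi> (ident V \<zeta>)"
proof (rule VA_eqI[OF V _ _ _ assms, of "\<lambda>\<zeta>. ident W (S_mor V \<phi> \<zeta>)" "\<lambda>\<zeta>. ind_mor \<phi> (ident V \<zeta>)"])
  show "qlinear_on (VA V) (\<lambda>\<zeta>. ident W (S_mor V \<phi> \<zeta>))"
    by (rule qlinear_on_compose[OF qlinear_on_S_mor _ qlinear_on_ident[OF W]])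
      (rule image_subsetI, rule S_mor_in_VA)
  show "qlinear_on (VA V) (\<lambda>\<zeta>. ind_mor \<phi> (ident V \<zeta>))"
    by (rule qlinear_on_compose[OF qlinear_on_ident[OF V] _ qlinear_on_ind_mor])
      (rule image_subsetI, rule ident_in_lin_part[OF V])
  show "ident W (S_mor V \<phi> (\<xi> \<otimes> f)) = ind_mor \<phi> (ident V (\<xi> \<otimes> f))"
    if "\<xi> \<in> scarrier V" "f \<in> Ag" for \<xi> f
    using that by (simp add: S_mor_tens ident_tens[OF W] ident_tens[OF V] mor_scarrier
        ind_mor_def comp_def qlinear_onD[OF mor_linear])
qed

text \<open>Finiteness is inherited through tensors: \<open>h\<close> comes from some \<zeta>, and
  \<open>S_mor\<close> sends \<zeta> to a tensor that represents
  \<open>ind_mor \<phi> h\<close>.\<close>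

lemma mor_fin_part:
  assumes "h \<in> fin_part \<Theta> V p" shows "ind_mor \<phi> h \<in> fin_part \<Theta> W p"
proof -
  obtain \<zeta> where "\<zeta> \<in> VA V" "h = ident V \<zeta>"
    using assms ident_image_VA[OF V] by (auto simp: fin_part_def)
  then have "ind_mor \<phi> h \<in> fin_maps W"
    using S_mor_in_VA ident_image_VA[OF W] by (auto simp flip: ident_S_mor)
  then show ?thesis using assms mor_hom_part by (simp add: fin_part_def)
qed

lemma cat_mor_ind_mor:
  "cat_mor {1..CARD('m) + CARD('n) - 1} (ind_obj \<Theta> V) (ind_obj \<Theta> W) (ind_mor \<phi>)"
proof -
  have sub: "gsum (fin_part \<Theta> V) \<subseteq> gsum (hom_part \<Theta> V)"
    by (rule gsum_mono) (simp add: fin_part_def)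
  have "qlinear_on (gsum (fin_part \<Theta> V)) (ind_mor \<phi>)"
    by (rule qlinear_on_subset[OF qlinear_on_ind_mor order_trans[OF sub gsum_hom_part_subset[OF V]]])
  then show ?thesis
    unfolding cat_mor_def ind_obj_eq[OF V] ind_obj_eq[OF W] scarrier_eq_gsum
    using sub mor_fin_part ind_mor_act by auto
qed

text \<open>Parity and equivariance are tested after applying the injective map
  \<open>ident W\<close>, where they reduce to the corresponding facts about
  \<open>ind_mor\<close>.\<close>

lemma cat_mor_S_mor:
  "cat_mor {1..CARD('m) + CARD('n) - 1} (S_obj \<Theta> V) (S_obj \<Theta> W) (S_mor V \<phi>)"
  unfolding cat_mor_def scarrier_S_obj[OF \<Theta> V]
proof (intro conjI allI ballI image_subsetI)
  note inj = inj_on_ident[OF W]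
  note VS = S_space_subset[of \<Theta> V]
  show "qlinear_on (S_space \<Theta> V) (S_mor V \<phi>)"
    by (rule qlinear_on_subset[OF qlinear_on_S_mor VS])
  show part: "S_mor V \<phi> \<zeta> \<in> part (S_obj \<Theta> W) p" if \<zeta>: "\<zeta> \<in> part (S_obj \<Theta> V) p" for \<zeta> p
  proof -
    have VA: "\<zeta> \<in> VA V" using \<zeta> VS by (auto simp: S_obj_def)
    have "ident V \<zeta> \<in> fin_part \<Theta> V p" using \<zeta> unfolding ident_S_part[OF \<Theta> V, symmetric] by blast
    then have "ident W (S_mor V \<phi> \<zeta>) \<in> ident W ` part (S_obj \<Theta> W) p"
      unfolding ident_S_mor[OF VA] ident_S_part[OF \<Theta> W] by (rule mor_fin_part)
    then obtain \<omega> where \<omega>: "\<omega> \<in> part (S_obj \<Theta> W) p" "ident W (S_mor V \<phi> \<zeta>) = ident W \<omega>" by blast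
    have "\<omega> \<in> VA W" using \<omega>(1) S_space_subset[of \<Theta> W] by (auto simp: S_obj_def)
    then have "S_mor V \<phi> \<zeta> = \<omega>" by (rule inj_onD[OF inj \<omega>(2) S_mor_in_VA[OF VA]])
    then show ?thesis using \<omega>(1) by simp
  qed
  fix x \<zeta> assume \<zeta>: "\<zeta> \<in> S_space \<Theta> V"
  have VA: "\<zeta> \<in> VA V" using \<zeta> VS by blast
  have fin: "ident V \<zeta> \<in> gsum (fin_part \<Theta> V)" using \<zeta> ident_S_space[OF \<Theta> V] by blast
  have hom: "ident V \<zeta> \<in> gsum (hom_part \<Theta> V)"
    using fin gsum_mono[of "fin_part \<Theta> V" "hom_part \<Theta> V"] by (auto simp: fin_part_def)
  have act_VA: "act (S_obj \<Theta> V) x \<zeta> \<in> VA V"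
    using id_tens_dR_in_VA[OF V VA] by (simp add: S_obj_def)
  obtain u w where uw: "\<zeta> = u + w" "u \<in> part (S_obj \<Theta> V) 0" "w \<in> part (S_obj \<Theta> V) 1"
    using \<zeta> unfolding scarrier_S_obj[OF \<Theta> V, symmetric] scarrier_def by blast
  have "u \<in> VA V" "w \<in> VA V" using uw(2,3) VS by (auto simp: S_obj_def)
  then have "S_mor V \<phi> \<zeta> = S_mor V \<phi> u + S_mor V \<phi> w"
    unfolding uw(1) by (rule qlinear_onD(1)[OF qlinear_on_S_mor])
  then have mS: "S_mor V \<phi> \<zeta> \<in> S_space \<Theta> W"
    using part[OF uw(2)] part[OF uw(3)] unfolding scarrier_S_obj[OF \<Theta> W, symmetric] scarrier_def by blast
  have "ident W (S_mor V \<phi> (act (S_obj \<Theta> V) x \<zeta>)) = ind_mor \<phi> (act (hom_mod \<Theta> V) x (ident V \<zeta>))"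
    by (simp add: ident_S_mor[OF act_VA] ident_S_act[OF \<Theta> V \<zeta>])
  also have "\<dots> = act (hom_mod \<Theta> W) x (ind_mor \<phi> (ident V \<zeta>))" by (rule ind_mor_act[OF hom])
  also have "\<dots> = ident W (act (S_obj \<Theta> W) x (S_mor V \<phi> \<zeta>))"
    by (simp add: ident_S_act[OF \<Theta> W mS] ident_S_mor[OF VA])
  finally have eq: "ident W (S_mor V \<phi> (act (S_obj \<Theta> V) x \<zeta>)) = ident W (act (S_obj \<Theta> W) x (S_mor V \<phi> \<zeta>))" .
  have "act (S_obj \<Theta> W) x (S_mor V \<phi> \<zeta>) \<in> VA W"
    using id_tens_dR_in_VA[OF W S_mor_in_VA[OF VA]] by (simp add: S_obj_def)
  then show "S_mor V \<phi> (act (S_obj \<Theta> V) x \<zeta>) = act (S_obj \<Theta> W) x (S_mor V \<phi> \<zeta>)"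
    by (rule inj_onD[OF inj eq S_mor_in_VA[OF act_VA]])
qed

end

theorem theorem5p1:
  fixes \<Theta> :: "nat set"
    and \<Xi> :: "('m::finite, 'n::finite, 'v::qvec) smod"
  assumes "\<Theta> \<subseteq> {1..CARD('m) + CARD('n) - 1}"
    and "cat_obj \<Theta> \<Xi>"
  defines "I' \<equiv> {1..CARD('m) + CARD('n) - 1}"
  shows
    "cat_obj I' (ind_obj \<Theta> \<Xi>) \<and> cat_obj I' (S_obj \<Theta> \<Xi>) \<and>
     scarrier (S_obj \<Theta> \<Xi>) = S_space \<Theta> \<Xi> \<and>
     \<comment> \<open>the identification of \<open>\<Xi> \<otimes> A(g)\<close> with a space of linear maps\<close>
     qlinear_on (VA \<Xi>) (ident \<Xi>) \<and> inj_on (ident \<Xi>) (VA \<Xi>) \<and>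
     (\<forall>\<xi>\<in>scarrier \<Xi>. \<forall>f\<in>Ag. ident \<Xi> (\<xi> \<otimes> f) = (\<lambda>x. f x *\<^sub>q \<xi>)) \<and>
     (\<forall>\<zeta>\<in>VA \<Xi>. qlinear (ident \<Xi> \<zeta>) \<and> range (ident \<Xi> \<zeta>) \<subseteq> scarrier \<Xi>) \<and>
     \<comment> \<open>objects\<close>
     ident \<Xi> ` S_space \<Theta> \<Xi> = scarrier (ind_obj \<Theta> \<Xi>) \<and>
     (\<forall>p. ident \<Xi> ` part (S_obj \<Theta> \<Xi>) p = part (ind_obj \<Theta> \<Xi>) p) \<and>
     (\<forall>x. \<forall>\<zeta>\<in>S_space \<Theta> \<Xi>.
        ident \<Xi> (act (S_obj \<Theta> \<Xi>) x \<zeta>) = act (ind_obj \<Theta> \<Xi>) x (ident \<Xi> \<zeta>)) \<and>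
     \<comment> \<open>morphisms\<close>
     (\<forall>(\<Psi> :: ('m, 'n, 'w::qvec) smod) \<phi>. cat_obj \<Theta> \<Psi> \<and> cat_mor \<Theta> \<Xi> \<Psi> \<phi> \<longrightarrow>
        cat_mor I' (ind_obj \<Theta> \<Xi>) (ind_obj \<Theta> \<Psi>) (ind_mor \<phi>) \<and>
        cat_mor I' (S_obj \<Theta> \<Xi>) (S_obj \<Theta> \<Psi>) (S_mor \<Xi> \<phi>) \<and>
        (\<forall>\<zeta>\<in>S_space \<Theta> \<Xi>. ident \<Psi> (S_mor \<Xi> \<phi> \<zeta>) = ind_mor \<phi> (ident \<Xi> \<zeta>)))"
proof -
  have V: "supermodule (uq_sub \<Theta>) \<Xi>" using assms(2) by (simp add: cat_obj_def)
  note c = assms(1) V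
  have sc: "scarrier (ind_obj \<Theta> \<Xi>) = gsum (fin_part \<Theta> \<Xi>)"
    by (simp add: ind_obj_eq[OF V] scarrier_eq_gsum)
  show ?thesis
    unfolding I'_def sc
  proof (intro conjI allI ballI impI; (elim conjE)?)
    show "cat_obj {1..CARD('m) + CARD('n) - 1} (ind_obj \<Theta> \<Xi>)"
      unfolding ind_obj_eq[OF V] by (rule cat_obj_fin_part[OF V])
    show "cat_obj {1..CARD('m) + CARD('n) - 1} (S_obj \<Theta> \<Xi>)" by (rule cat_obj_S_obj[OF c])
    show "scarrier (S_obj \<Theta> \<Xi>) = S_space \<Theta> \<Xi>" by (rule scarrier_S_obj[OF c])
    show "qlinear_on (VA \<Xi>) (ident \<Xi>)" by (rule qlinear_on_ident[OF V])
    show "inj_on (ident \<Xi>) (VA \<Xi>)" by (rule inj_on_ident[OF V])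
    show "ident \<Xi> (\<xi> \<otimes> f) = (\<lambda>x. f x *\<^sub>q \<xi>)" if "\<xi> \<in> scarrier \<Xi>" "f \<in> Ag" for \<xi> f
      by (rule ident_tens[OF V that])
    show "qlinear (ident \<Xi> \<zeta>)" "range (ident \<Xi> \<zeta>) \<subseteq> scarrier \<Xi>" if "\<zeta> \<in> VA \<Xi>" for \<zeta>
      using gsum_lin_partD[OF V ident_in_lin_part[OF V that]] by auto
    show "ident \<Xi> ` S_space \<Theta> \<Xi> = gsum (fin_part \<Theta> \<Xi>)" by (rule ident_S_space_image[OF c])
    show "ident \<Xi> ` part (S_obj \<Theta> \<Xi>) p = part (ind_obj \<Theta> \<Xi>) p" for p
      by (simp add: ident_S_part[OF c] ind_obj_eq[OF V])
    show "ident \<Xi> (act (S_obj \<Theta> \<Xi>) x \<zeta>) = act (ind_obj \<Theta> \<Xi>) x (ident \<Xi> \<zeta>)"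
      if "\<zeta> \<in> S_space \<Theta> \<Xi>" for x \<zeta>
      by (simp add: ident_S_act[OF c that] ind_obj_eq[OF V])
  next
    fix \<Psi> :: "('m, 'n, 'w) smod" and \<phi>
    assume "cat_obj \<Theta> \<Psi>" and \<phi>: "cat_mor \<Theta> \<Xi> \<Psi> \<phi>"
    then have W: "supermodule (uq_sub \<Theta>) \<Psi>" by (simp add: cat_obj_def)
    note m = c W \<phi>
    show "cat_mor {1..CARD('m) + CARD('n) - 1} (ind_obj \<Theta> \<Xi>) (ind_obj \<Theta> \<Psi>) (ind_mor \<phi>)"
      by (rule cat_mor_ind_mor[OF m])
    show "cat_mor {1..CARD('m) + CARD('n) - 1} (S_obj \<Theta> \<Xi>) (S_obj \<Theta> \<Psi>) (S_mor \<Xi> \<phi>)"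
      by (rule cat_mor_S_mor[OF m])
    show "ident \<Psi> (S_mor \<Xi> \<phi> \<zeta>) = ind_mor \<phi> (ident \<Xi> \<zeta>)" if "\<zeta> \<in> S_space \<Theta> \<Xi>" for \<zeta>
      using that S_space_subset[of \<Theta> \<Xi>] by (intro ident_S_mor[OF m]) blast
  qed
qed

end
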